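(* Let $k\geq r\geq 2$ be integers and let $p\geq r$ be real. Then there is $n_0$ such that for every $F_{k+1}^{(r)}$-free $r$-graph $H$ on $n>n_0$ vertices, \[ \lambda^{(p)}(H)\leq\lambda^{(p)}(T_r(n,k)), \] with equality if and only if $H\cong T_r(n,k)$.
   Context: An $r$-graph is an $r$-uniform hypergraph. For an $r$-graph $H$ on vertex set $[n]$ and real $p\geq1$, $\lambda^{(p)}(H)=\max_{\bm{x}\in\mathbb{R}^n,\ \|\bm{x}\|_p=1} r!\sum_{e\in E(H)}\prod_{v\in e}x_v$. $T_r(n,k)$ is the complete $k$-partite $r$-graph on $n$ vertices with part sizes differing by at most one (edges: all $r$-sets with at most one vertex in each part). $F_{k+1}^{(r)}$ is the $r$-graph whose edges are $[r]=\{1,\dots,r\}$ together with $E_{ij}\cup\{i,j\}$ for all pairs $\{i,j\}\in\binom{[k+1]}{2}\setminus\binom{[r]}{2}$, where the $E_{ij}$ are pairwise disjoint $(r-2)$-sets disjoint from $[k+1]$. $H$ is $F$-free if it has no subgraph isomorphic to $F$. *)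

theory Defs
  imports "HOL-Analysis.Analysis"
begin

type_synonym 'a hgraph = "'a set \<times> 'a set set"

abbreviation hverts :: "'a hgraph \<Rightarrow> 'a set" where "hverts \<equiv> fst"
abbreviation hedges :: "'a hgraph \<Rightarrow> 'a set set" where "hedges \<equiv> snd"

definition r_graph :: "nat \<Rightarrow> 'a hgraph \<Rightarrow> bool" where
  "r_graph r H \<longleftrightarrow> finite (hverts H) \<and> (\<forall>e\<in>hedges H. e \<subseteq> hverts H \<and> card e = r)"

definition hsubgraph :: "'a hgraph \<Rightarrow> 'a hgraph \<Rightarrow> bool" where
  "hsubgraph G H \<longleftrightarrow>
     hverts G \<subseteq> hverts H \<and> hedges G \<subseteq> hedges H \<and> (\<forall>e\<in>hedges G. e \<subseteq> hverts G)"

definition hgraph_iso :: "'a hgraph \<Rightarrow> 'b hgraph \<Rightarrow> bool" where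
  "hgraph_iso G H \<longleftrightarrow>
     (\<exists>f. bij_betw f (hverts G) (hverts H) \<and> (\<lambda>e. f ` e) ` hedges G = hedges H)"

definition hgraph_free :: "'b hgraph \<Rightarrow> 'a hgraph \<Rightarrow> bool" where
  "hgraph_free F H \<longleftrightarrow> \<not> (\<exists>G. hsubgraph G H \<and> hgraph_iso G F)"


definition p_norm :: "real \<Rightarrow> 'a set \<Rightarrow> ('a \<Rightarrow> real) \<Rightarrow> real" where
  "p_norm p V x = (\<Sum>v\<in>V. \<bar>x v\<bar> powr p) powr (1 / p)"

definition graph_form :: "nat \<Rightarrow> 'a hgraph \<Rightarrow> ('a \<Rightarrow> real) \<Rightarrow> real" where
  "graph_form r H x = fact r * (\<Sum>e\<in>hedges H. \<Prod>v\<in>e. x v)"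

text \<open>Vectors are functions of which only the values on the vertex set matter. The supremum is
  a maximum; see \<open>p_spectral_radius_attained\<close> below.\<close>

definition p_spectral_radius :: "nat \<Rightarrow> real \<Rightarrow> 'a hgraph \<Rightarrow> real" where
  "p_spectral_radius r p H = (SUP x \<in> {x. p_norm p (hverts H) x = 1}. graph_form r H x)"


definition complete_partite :: "nat \<Rightarrow> 'a set \<Rightarrow> ('a \<Rightarrow> 'c) \<Rightarrow> 'a hgraph" where
  "complete_partite r V c = (V, {e. e \<subseteq> V \<and> card e = r \<and> inj_on c e})"

text \<open>The parts are the residue classes modulo \<open>k\<close>; they are balanced by
  \<open>turan_part_sizes\<close> below.\<close>

definition turan :: "nat \<Rightarrow> nat \<Rightarrow> nat \<Rightarrow> nat hgraph" where
  "turan r n k = complete_partite r {..<n} (\<lambda>v. v mod k)"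


text \<open>The vertex \<open>Inl i\<close> is the core vertex \<open>i\<close>, and \<open>E\<^sub>i\<^sub>j\<close> consists of the
  \<open>r - 2\<close> vertices \<open>Inr ({i, j}, l)\<close>. The expanded graph \<open>F\<close> with
  superscript \<open>(r)\<close> and subscript \<open>k + 1\<close> is \<open>expanded_clique r (k + 1)\<close>.\<close>

definition pairs_upto :: "nat \<Rightarrow> nat set set" where
  "pairs_upto m = {P. P \<subseteq> {1..m} \<and> card P = 2}"

definition pair_ext :: "nat \<Rightarrow> nat set \<Rightarrow> (nat + nat set \<times> nat) set" where
  "pair_ext r P = (\<lambda>l. Inr (P, l)) ` {..<r - 2}"

definition expanded_clique :: "nat \<Rightarrow> nat \<Rightarrow> (nat + nat set \<times> nat) hgraph" where
  "expanded_clique r m =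
     (Inl ` {1..m} \<union> (\<Union>P\<in>pairs_upto m - pairs_upto r. pair_ext r P),
      {Inl ` {1..r}} \<union> (\<lambda>P. pair_ext r P \<union> Inl ` P) ` (pairs_upto m - pairs_upto r))"


lemma expanded_clique_r_graph:
  assumes "2 \<le> r" "r \<le> m"
  shows "r_graph r (expanded_clique r m)"
proof -
  have fin: "finite (pairs_upto m)"
    by (rule finite_subset[of _ "Pow {1..m}"]) (auto simp: pairs_upto_def)
  have cext: "card (pair_ext r P) = r - 2" "finite (pair_ext r P)" for P
    by (auto simp: pair_ext_def card_image inj_on_def)
  have c: "card (pair_ext r P \<union> Inl ` P) = r" if "P \<in> pairs_upto m" for P
  proof -
    from that have P: "card P = 2" "finite P"
      by (auto simp: pairs_upto_def intro: finite_subset)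
    have "card (pair_ext r P \<union> Inl ` P) = card (pair_ext r P) + card (Inl ` P :: (nat + nat set \<times> nat) set)"
      by (rule card_Un_disjoint) (auto simp: cext P, auto simp: pair_ext_def)
    with P cext assms show ?thesis by (simp add: card_image)
  qed
  show ?thesis
    using assms c fin cext
    by (auto simp: r_graph_def expanded_clique_def card_image) (auto simp: pairs_upto_def)
qed

lemma turan_part_sizes:
  assumes "i < k"
  shows "card {v \<in> {..<n}. v mod k = i} \<in> {n div k, n div k + 1}"
proof -
  have "{v \<in> {..<n}. v mod k = i} = (\<lambda>q. q * k + i) ` {q. q * k + i < n}"
  proof (intro equalityI subsetI)
    fix v assume v: "v \<in> {v \<in> {..<n}. v mod k = i}"
    then have "v = (v div k) * k + i" using div_mult_mod_eq[of v k] by simp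
    with v show "v \<in> (\<lambda>q. q * k + i) ` {q. q * k + i < n}"
      by (intro image_eqI[of _ _ "v div k"]) auto
  qed (use assms in auto)
  moreover have "inj_on (\<lambda>q. q * k + i) {q. q * k + i < n}"
    using assms by (auto simp: inj_on_def)
  ultimately have card: "card {v \<in> {..<n}. v mod k = i} = card {q. q * k + i < n}"
    by (simp add: card_image)
  have sub1: "{..<n div k} \<subseteq> {q. q * k + i < n}"
  proof
    fix q assume "q \<in> {..<n div k}"
    then have "(q + 1) * k \<le> (n div k) * k" by (intro mult_right_mono) auto
    also have "\<dots> \<le> n" by (rule div_times_less_eq_dividend)
    finally have "q * k + k \<le> n" by (simp add: algebra_simps)
    then show "q \<in> {q. q * k + i < n}" using assms by simp
  qed
  have sub2: "{q. q * k + i < n} \<subseteq> {..<n div k + 1}"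
  proof
    fix q assume "q \<in> {q. q * k + i < n}"
    then have "q * k \<le> n" by simp
    then have "q \<le> n div k" using assms by (simp add: less_eq_div_iff_mult_less_eq)
    then show "q \<in> {..<n div k + 1}" by simp
  qed
  have "n div k \<le> card {q. q * k + i < n}"
    using card_mono[OF finite_subset[OF sub2] sub1] by simp
  moreover have "card {q. q * k + i < n} \<le> n div k + 1"
    using card_mono[OF _ sub2] by simp
  ultimately show ?thesis unfolding card by auto
qed

lemma p_spectral_radius_attained:
  assumes H: "r_graph r H" and V: "hverts H \<noteq> {}" and p: "1 \<le> p"
  obtains x where "p_norm p (hverts H) x = 1" "graph_form r H x = p_spectral_radius r p H"
    and "\<And>y. p_norm p (hverts H) y = 1 \<Longrightarrow> graph_form r H y \<le> graph_form r H x"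
proof -
  define V where "V = hverts H"
  have fV: "finite V" and sub: "\<And>e. e \<in> hedges H \<Longrightarrow> e \<subseteq> V" and ne: "V \<noteq> {}"
    using H V by (auto simp: V_def r_graph_def)
  have coord: "continuous_on A (\<lambda>x::'a \<Rightarrow> real. x v)" for A v
    by (rule continuous_on_subset[OF continuous_on_product_coordinates]) auto
  define B where "B = Pi\<^sub>E UNIV (\<lambda>v. if v \<in> V then {-1..1::real} else {0})"
  have "compactin (product_topology (\<lambda>_. euclidean) UNIV) B"
    unfolding B_def by (subst compactin_PiE) auto
  then have cB: "compact B"
    by (simp add: euclidean_product_topology)
  have contn: "continuous_on A (p_norm p V)" for A
    unfolding p_norm_def using p
    by (intro continuous_on_powr' continuous_on_sum continuous_intros coord) (auto intro: sum_nonneg)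
  have conth: "continuous_on A (graph_form r H)" for A
    unfolding graph_form_def by (intro continuous_intros coord)
  define S where "S = {x \<in> B. p_norm p V x = 1}"
  have "compact (B \<inter> p_norm p V -` {1})"
    by (rule compact_Int_closed[OF cB closed_vimage[OF closed_singleton contn]])
  moreover have "S = B \<inter> p_norm p V -` {1}" by (auto simp: S_def)
  ultimately have cS: "compact S" by simp
  have bnd: "\<bar>x v\<bar> \<le> 1" if x: "p_norm p V x = 1" and v: "v \<in> V" for x v
  proof -
    have "0 \<le> (\<Sum>v\<in>V. \<bar>x v\<bar> powr p)"
      by (intro sum_nonneg) simp
    then have "(\<Sum>v\<in>V. \<bar>x v\<bar> powr p) = p_norm p V x powr p"
      using p by (simp add: p_norm_def powr_powr)
    then have s: "(\<Sum>v\<in>V. \<bar>x v\<bar> powr p) = 1"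
      using x by simp
    have "\<bar>x v\<bar> powr p \<le> 1"
      unfolding s[symmetric] by (rule member_le_sum) (use v fV in auto)
    moreover have "1 < \<bar>x v\<bar> powr p" if "1 < \<bar>x v\<bar>"
      using that p by (intro gr_one_powr) auto
    ultimately show ?thesis by linarith
  qed
  have restr: "(\<lambda>v. if v \<in> V then x v else 0) \<in> S
       \<and> graph_form r H (\<lambda>v. if v \<in> V then x v else 0) = graph_form r H x"
    if x: "p_norm p V x = 1" for x
  proof
    have "p_norm p V (\<lambda>v. if v \<in> V then x v else 0) = 1"
      using x by (simp add: p_norm_def)
    then show "(\<lambda>v. if v \<in> V then x v else 0) \<in> S"
      using bnd[OF x] by (auto simp: S_def B_def PiE_iff abs_le_iff minus_le_iff)
    show "graph_form r H (\<lambda>v. if v \<in> V then x v else 0) = graph_form r H x"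
      unfolding graph_form_def
      by (intro arg_cong2[where f = "(*)"] sum.cong prod.cong refl) (use sub in auto)
  qed
  obtain v0 where v0: "v0 \<in> V" using ne by auto
  have "p_norm p V (\<lambda>v. if v = v0 then 1 else 0) = 1"
  proof -
    have "(\<Sum>v\<in>V. \<bar>(if v = v0 then 1 else 0)::real\<bar> powr p) = (\<Sum>v\<in>V. if v = v0 then 1 else 0)"
      by (intro sum.cong) auto
    then show ?thesis using fV v0 by (simp add: p_norm_def)
  qed
  then have "S \<noteq> {}" using restr by blast
  then obtain x where x: "x \<in> S" "\<And>y. y \<in> S \<Longrightarrow> graph_form r H y \<le> graph_form r H x"
    using continuous_attains_sup[OF cS _ conth] by blast
  have x1: "p_norm p V x = 1" using x(1) by (simp add: S_def)
  have mx: "graph_form r H y \<le> graph_form r H x" if "p_norm p V y = 1" for y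
    using restr[OF that] x(2) by metis
  have "p_spectral_radius r p H = graph_form r H x"
    unfolding p_spectral_radius_def V_def[symmetric]
    by (rule cSup_eq_maximum) (use x1 mx in auto)
  then show ?thesis using that[of x] x1 mx by (simp add: V_def)
qed

end

theory Submission
  imports Defs
begin

text \<open>
  The proof combines a degree-stability theorem with a vertex-deletion argument.

  Degree stability: call a pair of vertices heavy if edges cover it robustly, that is, even after
  forbidding a bounded number of other vertices. Let \<open>E'\<close> be the set of edges all of whose pairs
  are heavy. An edge of \<open>E'\<close> lies in no \<open>(k + 1)\<close>-clique of the shadow of \<open>E'\<close>, so the
  Motzkin--Straus bound, applied to links, shows that every vertex has at most about \<open>n / k\<close>
  non-neighbours in the shadow. An edge of \<open>E'\<close> extends to a \<open>k\<close>-clique whose members have no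
  common neighbour, hence the non-neighbourhoods of adjacent vertices are almost disjoint; this
  yields a partition into \<open>k\<close> almost equal classes. Two vertices of one class cannot lie in a
  common edge, as this would complete a copy of the expanded clique. Boundedly many vertices may
  have too many edges outside \<open>E'\<close>; a first pass without them shows that they are not
  exceptional after all.

  Spectral part: let \<open>x\<close> be a nonnegative maximizer. If every \<open>x v powr p\<close> is at least
  \<open>(1 - \<delta>) / n\<close>, the eigenvalue equation forces large minimum degree, so the hypergraph is
  \<open>k\<close>-partite and the comparison with the balanced complete \<open>k\<close>-partite hypergraph is a concavity
  argument. Otherwise deleting a vertex of small weight increases the ratio of the spectral
  radius to \<open>n powr (r - r / p)\<close> by a factor \<open>1 + \<Omega>(1 / n)\<close>, which beats the
  \<open>1 - O(1 / n\<^sup>2)\<close> loss of the Turan hypergraph.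
\<close>

section \<open>Elementary symmetric functions and Lagrangians\<close>

text \<open>An expanded clique needs, for each pair of core vertices, a covering edge that is
  disjoint from the others outside the core. A heavy pair has such an edge whatever boundedly many
  vertices were used before, so the forbidden hypergraph can be traded for a forbidden clique, to
  which Lagrangians apply. The price is small: a pair that is not heavy lies in O(n^(r-3)) edges, so
  O(n^(r-1)) edges are lost in all. This loss may still concentrate on O(1) vertices, which is why
  two passes are made.

  On the spectral side the obstacle is a maximizer with tiny entries, at whose vertices no degree
  bound follows. Deleting a vertex of weight \<open>y\<close> lowers the form by the fraction
  \<open>r * y\<close>, and renormalisation gives back \<open>(1 - y) powr (r / p)\<close>. For
  \<open>y \<le> (1 - \<delta>) / n\<close> the net cost is less than the drop of
  \<open>n powr (r - r / p)\<close> by a fixed multiple of \<open>1 / n\<close>. The Turan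
  hypergraph falls short of its limit density only in second order because the deviations of the
  part sizes from \<open>n / k\<close> add up to zero.\<close>

definition esym :: "nat \<Rightarrow> 'i set \<Rightarrow> ('i \<Rightarrow> real) \<Rightarrow> real" where
  "esym s I x = (\<Sum>S | S \<subseteq> I \<and> card S = s. \<Prod>i\<in>S. x i)"

lemma esym_0: "finite I \<Longrightarrow> esym 0 I x = 1"
proof -
  assume "finite I"
  then have "{S. S \<subseteq> I \<and> card S = 0} = {{}}" by (auto dest: finite_subset)
  then show ?thesis by (simp add: esym_def)
qed

lemma esym_insert:
  assumes "finite I" "a \<notin> I"
  shows "esym (Suc s) (insert a I) x = esym (Suc s) I x + x a * esym s I x"
proof -
  let ?A = "{S. S \<subseteq> I \<and> card S = Suc s}" and ?B = "{S. S \<subseteq> I \<and> card S = s}"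
  have fin: "finite ?A" "finite ?B" using assms by (auto intro: finite_subset[of _ "Pow I"])
  have eq: "{S. S \<subseteq> insert a I \<and> card S = Suc s} = ?A \<union> insert a ` ?B"
  proof (intro equalityI subsetI)
    fix S assume S: "S \<in> {S. S \<subseteq> insert a I \<and> card S = Suc s}"
    show "S \<in> ?A \<union> insert a ` ?B"
    proof (cases "a \<in> S")
      case True
      then have "S = insert a (S - {a})" by auto
      moreover have "S - {a} \<in> ?B" using S True assms
        by (auto simp: card_Diff_singleton)
      ultimately show ?thesis by blast
    qed (use S in auto)
  next
    fix S assume "S \<in> ?A \<union> insert a ` ?B"
    then show "S \<in> {S. S \<subseteq> insert a I \<and> card S = Suc s}"
    proof
      assume "S \<in> insert a ` ?B"
      then obtain T where "T \<subseteq> I" "card T = s" "S = insert a T" by auto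
      moreover from this have "finite T" "a \<notin> T" using assms finite_subset[of T I] by auto
      ultimately show ?thesis by auto
    qed auto
  qed
  have inj: "inj_on (insert a) ?B" using assms by (auto simp: inj_on_def)
  have "(\<Sum>S\<in>insert a ` ?B. \<Prod>i\<in>S. x i) = (\<Sum>T\<in>?B. \<Prod>i\<in>insert a T. x i)"
    using inj by (subst sum.reindex) auto
  also have "\<dots> = (\<Sum>T\<in>?B. x a * (\<Prod>i\<in>T. x i))"
    using assms by (intro sum.cong refl prod.insert) (auto dest: finite_subset)
  finally have "(\<Sum>S\<in>insert a ` ?B. \<Prod>i\<in>S. x i) = x a * (\<Sum>T\<in>?B. \<Prod>i\<in>T. x i)"
    by (simp add: sum_distrib_left)
  moreover have "(\<Sum>S\<in>?A \<union> insert a ` ?B. \<Prod>i\<in>S. x i)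
      = (\<Sum>S\<in>?A. \<Prod>i\<in>S. x i) + (\<Sum>S\<in>insert a ` ?B. \<Prod>i\<in>S. x i)"
    using fin assms by (intro sum.union_disjoint) auto
  ultimately show ?thesis unfolding esym_def eq by simp
qed

lemma esym_nonneg: "(\<And>i. i \<in> I \<Longrightarrow> 0 \<le> x i) \<Longrightarrow> 0 \<le> esym s I x"
  unfolding esym_def by (intro sum_nonneg prod_nonneg) auto

lemma esym_cong: "(\<And>i. i \<in> I \<Longrightarrow> x i = y i) \<Longrightarrow> esym s I x = esym s I y"
  unfolding esym_def by (intro sum.cong refl prod.cong) auto

lemma esym_mono:
  assumes "\<And>i. i \<in> I \<Longrightarrow> 0 \<le> x i" "\<And>i. i \<in> I \<Longrightarrow> x i \<le> y i"
  shows "esym s I x \<le> esym s I y"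
  unfolding esym_def using assms by (intro sum_mono prod_mono) auto

lemma esym_const:
  fixes a :: real
  assumes "finite I"
  shows "esym s I (\<lambda>_. a) = (card I choose s) * a ^ s"
  using n_subsets[OF assms, of s] by (simp add: esym_def)

text \<open>As a function of two entries, the symmetric function depends only on their sum and
  product, and the coefficients are nonnegative on nonnegative input. Every smoothing step is judged
  by these two quantities alone.\<close>

lemma esym_split2:
  assumes "finite J" "a \<notin> J" "b \<notin> J" "a \<noteq> b"
  shows "esym (Suc (Suc s)) (insert a (insert b J)) x
    = esym (Suc (Suc s)) J x + (x a + x b) * esym (Suc s) J x + x a * x b * esym s J x"
  using assms by (simp add: esym_insert algebra_simps)

lemma esym_mono_pair:
  assumes fin: "finite I" and ab: "a \<in> I" "b \<in> I" "a \<noteq> b"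
    and nn: "\<And>i. i \<in> I \<Longrightarrow> 0 \<le> x i"
    and eq: "\<And>i. i \<in> I \<Longrightarrow> i \<noteq> a \<Longrightarrow> i \<noteq> b \<Longrightarrow> y i = x i"
    and le: "x a + x b \<le> y a + y b" "x a * x b \<le> y a * y b"
  shows "esym s I x \<le> esym s I y"
proof -
  define J where "J = I - {a, b}"
  have I: "I = insert a (insert b J)" and J: "finite J" "a \<notin> J" "b \<notin> J"
    using fin ab by (auto simp: J_def)
  have e: "esym t J y = esym t J x" for t
    by (rule esym_cong) (use eq in \<open>auto simp: J_def\<close>)
  have nnJ: "0 \<le> esym t J x" for t
    by (rule esym_nonneg) (use nn in \<open>auto simp: J_def\<close>)
  consider "s = 0" | "s = 1" | t where "s = Suc (Suc t)"
    by (metis One_nat_def not0_implies_Suc)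
  then show ?thesis
  proof cases
    case 1 then show ?thesis using fin by (simp add: esym_0)
  next
    case 2
    then show ?thesis unfolding I using J ab le e[of 1] by (simp add: esym_insert esym_0)
  next
    case 3
    have "(x a + x b) * esym (Suc t) J x \<le> (y a + y b) * esym (Suc t) J x"
      "x a * x b * esym t J x \<le> y a * y b * esym t J x"
      using le nnJ by (auto intro: mult_right_mono)
    then show ?thesis unfolding I 3 esym_split2[OF J ab(3)] e by linarith
  qed
qed

text \<open>The product of the two entries carries the coefficient \<open>esym (s - 2)\<close> of
  the remaining ones; once that is positive, the sum may stay equal.\<close>

lemma esym_strict_mono_pair:
  assumes fin: "finite I" and ab: "a \<in> I" "b \<in> I" "a \<noteq> b" and s: "2 \<le> s"
    and nn: "\<And>i. i \<in> I \<Longrightarrow> 0 \<le> x i"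
    and eq: "\<And>i. i \<in> I \<Longrightarrow> i \<noteq> a \<Longrightarrow> i \<noteq> b \<Longrightarrow> y i = x i"
    and le: "x a + x b \<le> y a + y b" "x a * x b < y a * y b"
    and pos: "0 < esym (s - 2) (I - {a, b}) x"
  shows "esym s I x < esym s I y"
proof -
  define J where "J = I - {a, b}"
  have I: "I = insert a (insert b J)" and J: "finite J" "a \<notin> J" "b \<notin> J"
    using fin ab by (auto simp: J_def)
  have e: "esym t J y = esym t J x" for t
    by (rule esym_cong) (use eq in \<open>auto simp: J_def\<close>)
  have nnJ: "0 \<le> esym t J x" for t
    by (rule esym_nonneg) (use nn in \<open>auto simp: J_def\<close>)
  obtain t where t: "s = Suc (Suc t)" using s by (metis One_nat_def Suc_1 Suc_le_D Suc_le_mono)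
  have "x a * x b * esym t J x < y a * y b * esym t J x"
    using le pos by (simp add: t J_def)
  moreover have "(x a + x b) * esym (Suc t) J x \<le> (y a + y b) * esym (Suc t) J x"
    using le nnJ by (intro mult_right_mono) auto
  ultimately show ?thesis unfolding I t esym_split2[OF J ab(3)] e by linarith
qed

text \<open>Smoothing: moving one entry to the mean while keeping the sum increases the product of
  the two entries that change.\<close>

lemma maclaurin_esym:
  assumes fin: "finite I" and ne: "I \<noteq> {}" and nn: "\<And>i. i \<in> I \<Longrightarrow> 0 \<le> x i"
  shows "esym s I x \<le> (card I choose s) * (sum x I / card I) ^ s"
  using nn
proof (induction "card {i \<in> I. x i \<noteq> sum x I / card I}" arbitrary: x rule: less_induct)
  case less
  define \<mu> where "\<mu> = sum x I / card I"
  have cI: "card I > 0" using fin ne by (simp add: card_gt_0_iff)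
  have smu: "sum x I = (\<Sum>i\<in>I. \<mu>)" using cI by (simp add: \<mu>_def)
  show ?case
  proof (cases "\<forall>i\<in>I. x i = \<mu>")
    case True
    then have "esym s I x = esym s I (\<lambda>_. \<mu>)" by (intro esym_cong) auto
    also have "\<dots> = (card I choose s) * \<mu> ^ s" by (rule esym_const[OF fin])
    finally show ?thesis by (simp add: \<mu>_def)
  next
    case False
    have "\<exists>a\<in>I. x a < \<mu>"
    proof (rule ccontr)
      assume "\<not> ?thesis"
      then have le: "\<And>i. i \<in> I \<Longrightarrow> \<mu> \<le> x i" by force
      moreover from False obtain i where "i \<in> I" "\<mu> < x i" using le by force
      ultimately have "(\<Sum>i\<in>I. \<mu>) < sum x I" using fin by (intro sum_strict_mono_ex1) auto
      then show False using smu by simp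
    qed
    then obtain a where a: "a \<in> I" "x a < \<mu>" by auto
    have "\<exists>b\<in>I. \<mu> < x b"
    proof (rule ccontr)
      assume "\<not> ?thesis"
      then have le: "\<And>i. i \<in> I \<Longrightarrow> x i \<le> \<mu>" by force
      then have "sum x I < (\<Sum>i\<in>I. \<mu>)" using fin a by (intro sum_strict_mono_ex1) auto
      then show False using smu by simp
    qed
    then obtain b where b: "b \<in> I" "\<mu> < x b" by auto
    have ab: "a \<noteq> b" using a b by auto
    define y where "y = x(a := \<mu>, b := x a + x b - \<mu>)"
    have ya: "y a = \<mu>" "y b = x a + x b - \<mu>" using ab by (auto simp: y_def)
    have yo: "y i = x i" if "i \<noteq> a" "i \<noteq> b" for i using that by (simp add: y_def)
    have xa: "0 \<le> x a" using less.prems a by auto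
    have "0 \<le> \<mu>" "\<mu> \<le> x a + x b" using a b xa by linarith+
    then have ynn: "0 \<le> y i" if "i \<in> I" for i
      using that less.prems by (auto simp: y_def)
    have I: "I = insert a (insert b (I - {a,b}))" using a b by auto
    have sI: "sum f I = f a + f b + sum f (I - {a,b})" for f :: "_ \<Rightarrow> real"
      using fin ab by (subst I) (simp add: insert_Diff_if)
    have sy: "sum y I = sum x I"
      unfolding sI[of y] sI[of x] ya by (simp add: yo)
    \<comment> \<open>The entry \<open>b\<close> was off the mean before, so \<open>a\<close>
      reaching the mean shrinks the set even if \<open>b\<close> stays off it.\<close>
    have "{i \<in> I. y i \<noteq> \<mu>} \<subseteq> {i \<in> I. x i \<noteq> \<mu>}"
    proof
      fix i assume i: "i \<in> {i \<in> I. y i \<noteq> \<mu>}"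
      then show "i \<in> {i \<in> I. x i \<noteq> \<mu>}" using ya yo[of i] b by (cases "i = a"; cases "i = b") auto
    qed
    moreover have "a \<in> {i \<in> I. x i \<noteq> \<mu>}" "a \<notin> {i \<in> I. y i \<noteq> \<mu>}" using a ya by auto
    ultimately have "{i \<in> I. y i \<noteq> \<mu>} \<subset> {i \<in> I. x i \<noteq> \<mu>}" by blast
    then have "card {i \<in> I. y i \<noteq> \<mu>} < card {i \<in> I. x i \<noteq> \<mu>}"
      using fin by (intro psubset_card_mono) auto
    then have "card {i \<in> I. y i \<noteq> sum y I / card I} < card {i \<in> I. x i \<noteq> sum x I / card I}"
      unfolding sy \<mu>_def .
    from less.hyps[OF this ynn]
    have "esym s I y \<le> (card I choose s) * (sum x I / card I) ^ s" by (simp add: sy)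
    moreover have "esym s I x \<le> esym s I y"
    proof (rule esym_mono_pair[OF fin a(1) b(1) ab])
      have "0 \<le> (\<mu> - x a) * (x b - \<mu>)" using a b by simp
      then show "x a * x b \<le> y a * y b" by (simp add: ya algebra_simps)
    qed (use less.prems yo in \<open>auto simp: ya\<close>)
    ultimately show ?thesis by linarith
  qed
qed

text \<open>Maclaurin's bound for the 0/1 vector with \<open>j\<close> ones among \<open>t\<close>
  entries.\<close>

lemma choose_ratio_mono:
  assumes "j \<le> t" "0 < t"
  shows "real (j choose s) \<le> (t choose s) * (j / t) ^ s"
proof -
  define x where "x = (\<lambda>i::nat. if i < j then 1 else 0 :: real)"
  have "real (j choose s) = esym s {..<j} x"
    using esym_const[of "{..<j}" s 1] by (subst esym_cong[of _ x "\<lambda>_. 1"]) (auto simp: x_def)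
  also have "\<dots> \<le> esym s {..<t} x"
    unfolding esym_def using assms
    by (intro sum_mono2 prod_nonneg) (auto intro: finite_subset[of _ "Pow {..<t}"] simp: x_def)
  also have "\<dots> \<le> (card {..<t} choose s) * (sum x {..<t} / card {..<t}) ^ s"
    by (rule maclaurin_esym) (use assms in \<open>auto simp: x_def\<close>)
  also have "sum x {..<t} = (\<Sum>i\<in>{..<t} \<inter> {..<j}. 1)"
    unfolding x_def by (subst sum.inter_restrict) auto
  also have "{..<t} \<inter> {..<j} = {..<j}" using assms by auto
  finally show ?thesis by simp
qed

text \<open>The support left by the Motzkin--Straus argument is only known to have at most
  \<open>t\<close> points, so the bound must be stated for an upper bound on the size of the index
  set.\<close>

lemma esym_le_choose:
  assumes "finite I" "card I \<le> t" "0 < t" "\<And>i. i \<in> I \<Longrightarrow> 0 \<le> x i"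
  shows "esym s I x \<le> (t choose s) * (sum x I / t) ^ s"
proof (cases "I = {}")
  case True
  show ?thesis
  proof (cases s)
    case (Suc s')
    have "{S. S \<subseteq> I \<and> card S = s} = {}" using True Suc by auto
    then have "esym s I x = 0" unfolding esym_def by (simp only: sum.empty)
    then show ?thesis using True by simp
  qed (use assms in \<open>simp add: esym_0\<close>)
next
  case False
  have c: "card I > 0" using False assms by (simp add: card_gt_0_iff)
  have nn: "0 \<le> sum x I" using assms by (intro sum_nonneg) auto
  have "esym s I x \<le> (card I choose s) * (sum x I / card I) ^ s"
    using assms False by (intro maclaurin_esym) auto
  also have "\<dots> \<le> ((t choose s) * (card I / t) ^ s) * (sum x I / card I) ^ s"
    using choose_ratio_mono[OF assms(2,3)] nn by (intro mult_right_mono) auto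
  also have "\<dots> = (t choose s) * (sum x I / t) ^ s"
    using c by (simp add: power_divide)
  finally show ?thesis .
qed

text \<open>The Motzkin--Straus argument: the form is linear along the segment that moves weight between
  two non-adjacent vertices, so one of the two can be dropped from the support.\<close>

lemma clique_lagrangian:
  fixes x :: "'a \<Rightarrow> real"
  assumes fin: "finite V" and E: "\<And>e. e \<in> E \<Longrightarrow> e \<subseteq> V \<and> card e = s"
    and st: "s \<le> t" "0 < t"
    and sym: "\<And>u v. adj u v \<Longrightarrow> adj v u"
    and sh: "\<And>e u v. e \<in> E \<Longrightarrow> u \<in> e \<Longrightarrow> v \<in> e \<Longrightarrow> u \<noteq> v \<Longrightarrow> adj u v"
    and nocl: "\<And>K e. K \<subseteq> V \<Longrightarrow> card K = Suc t \<Longrightarrow> (\<And>u v. u \<in> K \<Longrightarrow> v \<in> K \<Longrightarrow> u \<noteq> v \<Longrightarrow> adj u v)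
        \<Longrightarrow> e \<in> E \<Longrightarrow> e \<subseteq> K \<Longrightarrow> False"
    and nn: "\<And>v. v \<in> V \<Longrightarrow> 0 \<le> x v"
  shows "(\<Sum>e\<in>E. \<Prod>v\<in>e. x v) \<le> (t choose s) * (sum x V / t) ^ s"
  using nn
proof (induction "card {v \<in> V. x v \<noteq> 0}" arbitrary: x rule: less_induct)
  case less
  have finE: "finite E" using E fin by (intro finite_subset[of E "Pow V"]) auto
  have fe: "finite e" if "e \<in> E" for e using E[OF that] fin finite_subset by auto
  define S where "S = {v \<in> V. x v \<noteq> 0}"
  have S: "finite S" "S \<subseteq> V" using fin by (auto simp: S_def)
  show ?case
  proof (cases "\<exists>u\<in>S. \<exists>v\<in>S. u \<noteq> v \<and> \<not> adj u v")
    case True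
    \<comment> \<open>\<open>B u\<close> is the coefficient of \<open>x u\<close> in the form. No
      edge contains both \<open>u\<close> and \<open>v\<close>, so moving all weight of the two to
      the larger coefficient does not decrease the form, and the support shrinks.\<close>
    define B where "B = (\<lambda>u. \<Sum>e\<in>{e\<in>E. u \<in> e}. \<Prod>w\<in>e-{u}. x w)"
    from True obtain u v where uv: "u \<in> S" "v \<in> S" "u \<noteq> v" "\<not> adj u v" "B v \<le> B u"
      using sym by (metis linear)
    define y where "y = x(u := x u + x v, v := 0)"
    have split: "(\<Sum>e\<in>E. \<Prod>w\<in>e. z w) =
       z u * (\<Sum>e\<in>{e\<in>E. u \<in> e}. \<Prod>w\<in>e-{u}. z w) + z v * (\<Sum>e\<in>{e\<in>E. v \<in> e}. \<Prod>w\<in>e-{v}. z w)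
       + (\<Sum>e\<in>{e\<in>E. u \<notin> e \<and> v \<notin> e}. \<Prod>w\<in>e. z w)" for z :: "'a \<Rightarrow> real"
    proof -
      have EE: "E = {e\<in>E. u \<in> e} \<union> ({e\<in>E. v \<in> e} \<union> {e\<in>E. u \<notin> e \<and> v \<notin> e})" by auto
      have "(\<Sum>e\<in>E. \<Prod>w\<in>e. z w) = (\<Sum>e\<in>{e\<in>E. u \<in> e}. \<Prod>w\<in>e. z w)
          + ((\<Sum>e\<in>{e\<in>E. v \<in> e}. \<Prod>w\<in>e. z w) + (\<Sum>e\<in>{e\<in>E. u \<notin> e \<and> v \<notin> e}. \<Prod>w\<in>e. z w))"
      proof (subst EE, subst sum.union_disjoint)
        show "{e\<in>E. u \<in> e} \<inter> ({e\<in>E. v \<in> e} \<union> {e\<in>E. u \<notin> e \<and> v \<notin> e}) = {}"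
          using sh uv by blast
        show "(\<Sum>e\<in>{e \<in> E. u \<in> e}. prod z e) + (\<Sum>e\<in>{e \<in> E. v \<in> e} \<union> {e \<in> E. u \<notin> e \<and> v \<notin> e}. prod z e)
          = (\<Sum>e\<in>{e \<in> E. u \<in> e}. prod z e) +
            ((\<Sum>e\<in>{e \<in> E. v \<in> e}. prod z e) + (\<Sum>e\<in>{e \<in> E. u \<notin> e \<and> v \<notin> e}. prod z e))"
          using finE by (subst sum.union_disjoint) auto
      qed (use finE in auto)
      moreover have "(\<Sum>e\<in>{e\<in>E. q \<in> e}. \<Prod>w\<in>e. z w) = z q * (\<Sum>e\<in>{e\<in>E. q \<in> e}. \<Prod>w\<in>e-{q}. z w)" for q
        unfolding sum_distrib_left by (intro sum.cong refl prod.remove) (use fe in auto)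
      ultimately show ?thesis by simp
    qed
    have Bu: "(\<Sum>e\<in>{e\<in>E. u \<in> e}. \<Prod>w\<in>e-{u}. y w) = B u"
      unfolding B_def by (intro sum.cong refl prod.cong) (use sh uv in \<open>auto simp: y_def\<close>)
    have Bx: "(\<Sum>e\<in>{e\<in>E. q \<in> e}. \<Prod>w\<in>e-{q}. x w) = B q" for q
      by (simp add: B_def)
    have Bo: "(\<Sum>e\<in>{e\<in>E. u \<notin> e \<and> v \<notin> e}. \<Prod>w\<in>e. y w) = (\<Sum>e\<in>{e\<in>E. u \<notin> e \<and> v \<notin> e}. \<Prod>w\<in>e. x w)"
      by (intro sum.cong refl prod.cong) (auto simp: y_def)
    have yuv: "y u = x u + x v" "y v = 0" using uv by (auto simp: y_def)
    have xv: "0 \<le> x v" "0 \<le> x u" using less.prems uv by (auto simp: S_def)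
    have "x v * B v \<le> x v * B u" using uv xv by (intro mult_left_mono) auto
    then have le: "(\<Sum>e\<in>E. \<Prod>w\<in>e. x w) \<le> (\<Sum>e\<in>E. \<Prod>w\<in>e. y w)"
      unfolding split[of x] split[of y] Bu Bo yuv Bx by (simp add: distrib_right)
    have V: "V = insert u (insert v (V - {u,v}))" using uv S by auto
    have sI: "sum f V = f u + f v + sum f (V - {u,v})" for f :: "_ \<Rightarrow> real"
      using fin uv by (subst V) (simp add: insert_Diff_if)
    have sy: "sum y V = sum x V"
      unfolding sI[of y] sI[of x] yuv by (auto simp: y_def intro: sum.cong)
    have "{w \<in> V. y w \<noteq> 0} \<subset> {w \<in> V. x w \<noteq> 0}"
      using uv by (auto simp: y_def S_def)
    then have "card {w \<in> V. y w \<noteq> 0} < card {w \<in> V. x w \<noteq> 0}"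
      using fin by (intro psubset_card_mono) auto
    from less.hyps[OF this] have "(\<Sum>e\<in>E. \<Prod>w\<in>e. y w) \<le> (t choose s) * (sum x V / t) ^ s"
      using less.prems xv by (auto simp: sy) (auto simp: y_def)
    with le show ?thesis by linarith
  next
    case False
    have sumS: "sum x V = sum x S"
      using fin by (intro sum.mono_neutral_right) (auto simp: S_def)
    have nn: "0 \<le> sum x V" using less.prems by (intro sum_nonneg) auto
    have "(\<Sum>e\<in>E. \<Prod>v\<in>e. x v) = (\<Sum>e\<in>{e\<in>E. e \<subseteq> S}. \<Prod>v\<in>e. x v)"
      using finE fe E by (intro sum.mono_neutral_right) (auto simp: S_def)
    \<comment> \<open>The support is now a clique. Only cliques containing an edge are excluded,
      hence the case distinction: an edge inside a support of more than \<open>t\<close> vertices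
      could be padded to an excluded clique with \<open>Suc t\<close> vertices, and without an edge
      inside the support the sum is empty.\<close>
    also have "\<dots> \<le> (t choose s) * (sum x V / t) ^ s"
    proof (cases "\<exists>e\<in>E. e \<subseteq> S")
      case True
      then obtain e where e: "e \<in> E" "e \<subseteq> S" by auto
      have "card S \<le> t"
      proof (rule ccontr)
        assume "\<not> card S \<le> t"
        then have "Suc t - card e \<le> card (S - e)"
          using e E[OF e(1)] S st by (subst card_Diff_subset) (auto intro: fe)
        then obtain R where R: "R \<subseteq> S - e" "card R = Suc t - card e" "finite R"
          by (meson obtain_subset_with_card_n)
        have "card (e \<union> R) = Suc t"
          using R E[OF e(1)] st fe[OF e(1)] by (subst card_Un_disjoint) auto
        moreover have "e \<union> R \<subseteq> S" using R e by auto
        ultimately show False using nocl[of "e \<union> R" e] e S False by blast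
      qed
      have "(\<Sum>e\<in>{e\<in>E. e \<subseteq> S}. \<Prod>v\<in>e. x v) \<le> esym s S x"
        unfolding esym_def using S E less.prems
        by (intro sum_mono2 prod_nonneg) (auto intro: finite_subset[of _ "Pow S"])
      also have "\<dots> \<le> (t choose s) * (sum x S / t) ^ s"
        using S \<open>card S \<le> t\<close> less.prems st by (intro esym_le_choose) auto
      finally show ?thesis by (simp add: sumS)
    next
      case False
      then have "{e\<in>E. e \<subseteq> S} = {}" by auto
      then show ?thesis using nn by (simp only: sum.empty) simp
    qed
    finally show ?thesis .
  qed
qed

section \<open>Near-partitions from large minimum degree\<close>

definition shadow :: "'a set set \<Rightarrow> 'a \<Rightarrow> 'a \<Rightarrow> bool" where
  "shadow E u v \<longleftrightarrow> u \<noteq> v \<and> (\<exists>e\<in>E. u \<in> e \<and> v \<in> e)"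

lemma shadow_sym: "shadow E u v \<Longrightarrow> shadow E v u"
  by (auto simp: shadow_def)

lemma card_UN_le_mult:
  fixes b :: real
  assumes "finite S" "\<And>u. u \<in> S \<Longrightarrow> card (B u) \<le> b"
  shows "card (\<Union>u\<in>S. B u) \<le> card S * b"
proof -
  have "card (\<Union>v\<in>S. B v) \<le> (\<Sum>v\<in>S. card (B v))" using assms(1) by (rule card_UN_le)
  then have "real (card (\<Union>v\<in>S. B v)) \<le> (\<Sum>v\<in>S. real (card (B v)))"
    by (metis of_nat_le_iff of_nat_sum)
  also have "\<dots> \<le> (\<Sum>v\<in>S. b)" using assms by (intro sum_mono) auto
  finally show ?thesis by simp
qed

text \<open>The link of \<open>v\<close> is an \<open>(r - 1)\<close>-graph on the neighbours of
  \<open>v\<close>. A \<open>k\<close>-clique around one of its edges would together with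
  \<open>v\<close> give an excluded \<open>(k + 1)\<close>-clique, so the Lagrangian bound applies
  to the link with \<open>t = k - 1\<close> and all weights equal to one.\<close>

lemma link_size_le:
  assumes fin: "finite V" and E: "\<And>e. e \<in> E \<Longrightarrow> e \<subseteq> V \<and> card e = r"
    and rk: "2 \<le> r" "r \<le> k"
    and nocl: "\<And>K e. K \<subseteq> V \<Longrightarrow> card K = Suc k \<Longrightarrow> (\<And>u v. u \<in> K \<Longrightarrow> v \<in> K \<Longrightarrow> u \<noteq> v \<Longrightarrow> shadow E u v)
        \<Longrightarrow> e \<in> E \<Longrightarrow> e \<subseteq> K \<Longrightarrow> False"
    and v: "v \<in> V"
  shows "real (card {e\<in>E. v \<in> e}) \<le>
    ((k - 1) choose (r - 1)) * (card {u\<in>V. shadow E v u} / (real k - 1)) ^ (r - 1)"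
proof -
  define N where "N = {u\<in>V. shadow E v u}"
  define L where "L = (\<lambda>e. e - {v}) ` {e\<in>E. v \<in> e}"
  have inj: "inj_on (\<lambda>e. e - {v}) {e\<in>E. v \<in> e}" by (auto simp: inj_on_def)
  have L: "e \<subseteq> N \<and> card e = r - 1" "insert v e \<in> E" "v \<notin> e" if "e \<in> L" for e
    using that E finite_subset[OF _ fin]
    by (auto simp: L_def N_def shadow_def insert_absorb card_Diff_singleton)
  have "(\<Sum>e\<in>L. \<Prod>v\<in>e. (1::real)) \<le> ((k-1) choose (r-1)) * (sum (\<lambda>_. 1) N / real (k-1)) ^ (r-1)"
  proof (rule clique_lagrangian[where adj = "shadow E"])
    show "finite N" using fin by (simp add: N_def)
    show "e \<subseteq> N \<and> card e = r - 1" if "e \<in> L" for e using L[OF that] by auto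
    show "r - 1 \<le> k - 1" "0 < k - 1" using rk by auto
    show "shadow E u w" if "shadow E w u" for u w using that by (rule shadow_sym)
    show "shadow E u w" if "e \<in> L" "u \<in> e" "w \<in> e" "u \<noteq> w" for e u w
      using that L(2)[OF that(1)] by (auto simp: shadow_def intro!: bexI[of _ "insert v e"])
    show False if K: "K \<subseteq> N" "card K = Suc (k - 1)"
      "\<And>u w. u \<in> K \<Longrightarrow> w \<in> K \<Longrightarrow> u \<noteq> w \<Longrightarrow> shadow E u w" and e: "e \<in> L" "e \<subseteq> K" for K e
    proof (rule nocl[of "insert v K" "insert v e"])
      have "v \<notin> K" using K by (auto simp: N_def shadow_def)
      moreover have "finite K" using K fin by (auto simp: N_def intro: finite_subset)
      ultimately show "card (insert v K) = Suc k" using K rk by simp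
      show "shadow E u w" if "u \<in> insert v K" "w \<in> insert v K" "u \<noteq> w" for u w
        using that K shadow_sym[of E] by (auto simp: N_def)
    qed (use K e L v in \<open>auto simp: N_def\<close>)
  qed auto
  moreover have "card L = card {e\<in>E. v \<in> e}" unfolding L_def using inj by (rule card_image)
  ultimately show ?thesis using rk by (simp add: N_def of_nat_diff)
qed

text \<open>Here \<open>a\<close> is about \<open>n / k\<close> and \<open>d\<close> is an error
  term. Fewer than \<open>k\<close> non-neighbourhoods cannot cover \<open>V\<close>, so every edge
  grows to a \<open>k\<close>-clique; the non-neighbourhoods of its members do cover
  \<open>V\<close>, since otherwise it would grow once more. As \<open>k\<close> sets of size at
  most \<open>a + d\<close> cover at least \<open>k * a - d\<close> points, they all have size about
  \<open>a\<close> and hardly overlap. One fixed clique \<open>Q\<close> then provides the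
  classes.\<close>

lemma partition_from_nonneighbours:
  fixes a d :: real and V :: "'a set"
  assumes fin: "finite V" and ne: "V \<noteq> {}" and E: "\<And>e. e \<in> E \<Longrightarrow> e \<subseteq> V \<and> card e = r"
    and rk: "r \<le> k" "0 < k"
    and cov: "\<And>v. v \<in> V \<Longrightarrow> \<exists>e\<in>E. v \<in> e"
    and nocl: "\<And>K e. K \<subseteq> V \<Longrightarrow> card K = Suc k \<Longrightarrow> (\<And>u v. u \<in> K \<Longrightarrow> v \<in> K \<Longrightarrow> u \<noteq> v \<Longrightarrow> shadow E u v)
        \<Longrightarrow> e \<in> E \<Longrightarrow> e \<subseteq> K \<Longrightarrow> False"
    and nonnb: "\<And>v. v \<in> V \<Longrightarrow> real (card {u\<in>V. \<not> shadow E v u}) \<le> a + d"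
    and cV: "k * a - d \<le> card V" and d: "0 \<le> d" "(real k + 1) ^ 3 * d < a"
  shows "\<exists>(Q :: 'a set) (col :: 'a \<Rightarrow> 'a). finite Q \<and> card Q = k \<and> col ` V \<subseteq> Q
    \<and> (\<forall>u\<in>V. \<forall>v\<in>V. shadow E u v \<longrightarrow> col u \<noteq> col v)
    \<and> (\<forall>v\<in>V. card {u\<in>V. col u \<noteq> col v \<and> \<not> shadow E v u} \<le> (real k + 1) ^ 2 * d)
    \<and> (\<forall>q\<in>Q. a - (real k + 1) ^ 2 * d \<le> card {v\<in>V. col v = q})"
proof -
  \<comment> \<open>\<open>A v\<close> contains \<open>v\<close> itself, because
    \<open>shadow\<close> is irreflexive; it is the prospective class of \<open>v\<close>.\<close>
  define A where "A = (\<lambda>v. {u\<in>V. \<not> shadow E v u})"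
  have fA: "finite (A v)" for v using fin by (simp add: A_def)
  have AV: "A v \<subseteq> V" for v by (auto simp: A_def)
  have Ale: "card (A v) \<le> a + d" if "v \<in> V" for v using nonnb[OF that] by (simp add: A_def)
  have Asym: "u \<in> A v \<Longrightarrow> v \<in> V \<Longrightarrow> v \<in> A u" for u v using shadow_sym[of E] by (auto simp: A_def)
  \<comment> \<open>The total excess \<open>k * (a + d) - (k * a - d)\<close> equals
    \<open>D\<close>, so \<open>D\<close> bounds the overlap of two non-neighbourhoods of such a
    clique and also the defect \<open>a - card (A v)\<close>.\<close>
  define D where "D = (real k + 1) * d"
  have kD: "0 \<le> D" "d \<le> D" "k * d = D - d" "(real k + 1) * (real k + 1) * D < a"
  proof -
    show "0 \<le> D" "d \<le> D" using d mult_right_mono[of 1 "real k + 1" d] by (simp_all add: D_def)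
    show "k * d = D - d" by (simp add: D_def algebra_simps)
    have "(real k + 1) * (real k + 1) * D = (real k + 1) ^ 3 * d"
      by (simp add: D_def power3_eq_cube)
    then show "(real k + 1) * (real k + 1) * D < a" using d by simp
  qed
  have kk: "0 \<le> k * D" "0 \<le> k * (k * D)" using kD by auto
  have key: "k * (k * D) + 2 * (k * D) + D < a" using kD(4) by (simp add: algebra_simps)
  have a0: "0 < a" using key kk kD by linarith
  have sumA: "card (\<Union>v\<in>K. A v) \<le> card K * (a + d)" if "K \<subseteq> V" for K
    using that Ale finite_subset[OF that fin] by (intro card_UN_le_mult) auto
  define cl where "cl = (\<lambda>K. K \<subseteq> V \<and> (\<forall>u\<in>K. \<forall>v\<in>K. u \<noteq> v \<longrightarrow> shadow E u v))"
  have clins: "cl (insert w K)" "w \<notin> K" if "cl K" "w \<in> V" "w \<notin> (\<Union>v\<in>K. A v)" for w K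
  proof -
    have w: "shadow E u w" "shadow E w u" if "u \<in> K" for u
      using that \<open>w \<in> V\<close> \<open>w \<notin> (\<Union>v\<in>K. A v)\<close> shadow_sym[of E] by (auto simp: A_def)
    show "cl (insert w K)" using w that by (auto simp: cl_def)
    show "w \<notin> K" using w by (auto simp: shadow_def)
  qed
  have ext: "\<exists>w\<in>V. w \<notin> (\<Union>v\<in>K. A v)" if K: "cl K" "card K < k" for K
  proof (rule ccontr)
    assume "\<not> ?thesis"
    then have "V \<subseteq> (\<Union>v\<in>K. A v)" by auto
    then have "real (card V) \<le> card (\<Union>v\<in>K. A v)"
      unfolding of_nat_le_iff
      using K fin fA by (intro card_mono) (auto simp: cl_def intro: finite_subset)
    also have "real (card (\<Union>v\<in>K. A v)) \<le> card K * (a + d)" using K sumA by (simp add: cl_def)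
    also have "\<dots> \<le> (real k - 1) * (a + d)"
      using K a0 d by (intro mult_right_mono) auto
    also have "\<dots> = k * a - a + k * d - d" by (simp add: algebra_simps)
    finally show False using cV kD kk key d(1) by linarith
  qed
  have exQ: "\<exists>Q. cl Q \<and> e \<subseteq> Q \<and> card Q = k" if e: "e \<in> E" for e
    using rk(1)
  proof (induction rule: dec_induct)
    case base
    show ?case using E[OF e] e by (intro exI[of _ e]) (auto simp: cl_def shadow_def)
  next
    case (step j)
    then obtain K where K: "cl K" "e \<subseteq> K" "card K = j" by auto
    obtain w where w: "w \<in> V" "w \<notin> (\<Union>v\<in>K. A v)" using ext[of K] K step by auto
    have "finite K" using K fin by (auto simp: cl_def intro: finite_subset)
    then show ?case using clins[OF K(1) w] K by (intro exI[of _ "insert w K"]) auto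
  qed
  have Qcov: "(\<Union>v\<in>Q. A v) = V" if Q: "cl Q" "e \<in> E" "e \<subseteq> Q" "card Q = k" for Q e
  proof (rule ccontr)
    assume "(\<Union>v\<in>Q. A v) \<noteq> V"
    then obtain w where w: "w \<in> V" "w \<notin> (\<Union>v\<in>Q. A v)" using AV by blast
    have fQ: "finite Q" using Q fin by (auto simp: cl_def intro: finite_subset)
    show False
      by (rule nocl[of "insert w Q" e])
        (use clins[OF Q(1) w] Q fQ in \<open>auto simp: cl_def\<close>)
  qed
  have Alow: "a - D \<le> card (A v)" if v: "v \<in> V" for v
  proof -
    obtain e where e: "e \<in> E" "v \<in> e" using cov v by auto
    obtain Q where Q: "cl Q" "e \<subseteq> Q" "card Q = k" using exQ e by blast
    have QV: "Q \<subseteq> V" "finite Q" using Q fin by (auto simp: cl_def intro: finite_subset)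
    have "V = A v \<union> (\<Union>u\<in>Q-{v}. A u)" using Qcov[OF Q(1) e(1) Q(2,3)] Q(2) e(2) by auto
    then have "card V \<le> card (A v) + card (\<Union>u\<in>Q-{v}. A u)" by (metis card_Un_le)
    moreover have "real (card (\<Union>u\<in>Q-{v}. A u)) \<le> card (Q - {v}) * (a + d)"
      using QV by (intro sumA) auto
    moreover have "real (card (Q - {v})) = real k - 1"
      using Q e QV rk by (subst card_Diff_singleton) (auto simp: of_nat_diff)
    ultimately have "real (card V) \<le> card (A v) + (real k - 1) * (a + d)" by simp
    moreover have "(real k - 1) * (a + d) = k * a - a + k * d - d" by (simp add: algebra_simps)
    ultimately show ?thesis using cV kD d(1) by linarith
  qed
  have Aint2: "card (A u \<inter> A v) \<le> D"
    if Q: "cl Q" "e \<in> E" "e \<subseteq> Q" "card Q = k" and uv: "u \<in> Q" "v \<in> Q" "u \<noteq> v" for Q e u v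
  proof -
    have QV: "Q \<subseteq> V" "finite Q" using Q fin by (auto simp: cl_def intro: finite_subset)
    have k2: "card (Q - {u,v}) = k - 2" "2 \<le> k"
      using card_Diff_subset[of "{u,v}" Q] card_mono[of Q "{u,v}"] uv Q QV by auto
    have "V = (A u \<union> A v) \<union> (\<Union>w\<in>Q-{u,v}. A w)" using Qcov[OF Q] uv by auto
    then have "card V \<le> card (A u \<union> A v) + card (\<Union>w\<in>Q-{u,v}. A w)" by (metis card_Un_le)
    moreover have "real (card (\<Union>w\<in>Q-{u,v}. A w)) \<le> card (Q-{u,v}) * (a + d)"
      using QV by (intro sumA) auto
    moreover have "card (A u \<union> A v) + card (A u \<inter> A v) = card (A u) + card (A v)"
      using card_Un_Int[of "A u" "A v"] fA by simp
    moreover have "card (A u) \<le> a + d" "card (A v) \<le> a + d" using uv QV Ale by auto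
    ultimately have "real (card V) + card (A u \<inter> A v) \<le> (a + d) + (a + d) + real (k - 2) * (a + d)"
      unfolding k2 by linarith
    then have "real (card V) + card (A u \<inter> A v) \<le> k * (a + d)"
      using k2(2) by (simp add: of_nat_diff algebra_simps)
    moreover have "k * (a + d) = k * a + k * d" by (simp add: algebra_simps)
    ultimately show ?thesis using cV kD d(1) by linarith
  qed
  have Aint: "card (A u \<inter> A v) \<le> D" if "shadow E u v" for u v
  proof -
    obtain e where e: "e \<in> E" "u \<in> e" "v \<in> e" "u \<noteq> v" using \<open>shadow E u v\<close> by (auto simp: shadow_def)
    obtain Q where "cl Q" "e \<subseteq> Q" "card Q = k" using exQ e by blast
    then show ?thesis using Aint2[of Q e u v] e by auto
  qed
  obtain v0 where "v0 \<in> V" using ne by auto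
  then obtain e0 where e0: "e0 \<in> E" using cov by auto
  obtain Q where Q: "cl Q" "e0 \<subseteq> Q" "card Q = k" using exQ e0 by blast
  have QV: "Q \<subseteq> V" "finite Q" using Q fin by (auto simp: cl_def intro: finite_subset)
  have cQ: "real (card (Q - {q})) = real k - 1" if "q \<in> Q" for q
    using Q QV that rk by (subst card_Diff_singleton) (auto simp: of_nat_diff)
  note VQ = Qcov[OF Q(1) e0 Q(2,3)]
  \<comment> \<open>The core of the class of \<open>q\<close>: vertices adjacent to every member of
    \<open>Q\<close> except \<open>q\<close>. Only overlaps of non-neighbourhoods are missing from
    it, so it is almost all of \<open>A q\<close>.\<close>
  define P where "P = (\<lambda>q. {w\<in>V. A w \<inter> Q = {q}})"
  have Qsh: "shadow E q q'" if "q \<in> Q" "q' \<in> Q" "q \<noteq> q'" for q q' using that Q by (auto simp: cl_def)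
  have qP: "q \<in> P q" if "q \<in> Q" for q
    using that Qsh QV by (auto simp: P_def A_def shadow_def)
  have PA: "P q \<subseteq> A q" if "q \<in> Q" for q using that QV Asym by (auto simp: P_def)
  have Psh: "shadow E w q'" if "w \<in> P q" "q' \<in> Q" "q \<noteq> q'" for w q q'
    using that QV by (auto simp: P_def A_def)
  have Plow: "a - k * D \<le> card (P q)" if q: "q \<in> Q" for q
  proof -
    have "A q \<subseteq> P q \<union> (\<Union>q'\<in>Q-{q}. A q \<inter> A q')"
    proof
      fix w assume w: "w \<in> A q"
      then have "q \<in> A w" using Asym q QV by auto
      moreover have "w \<in> A q'" if "q' \<in> A w" for q' using that w AV Asym by blast
      ultimately show "w \<in> P q \<union> (\<Union>q'\<in>Q-{q}. A q \<inter> A q')" using w q AV by (auto simp: P_def)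
    qed
    then have "card (A q) \<le> card (P q \<union> (\<Union>q'\<in>Q-{q}. A q \<inter> A q'))"
      using fin QV fA by (intro card_mono) (auto simp: P_def)
    also have "\<dots> \<le> card (P q) + card (\<Union>q'\<in>Q-{q}. A q \<inter> A q')" by (rule card_Un_le)
    finally have "real (card (A q)) \<le> card (P q) + card (\<Union>q'\<in>Q-{q}. A q \<inter> A q')" by linarith
    moreover have "card (\<Union>q'\<in>Q-{q}. A q \<inter> A q') \<le> card (Q-{q}) * D"
      using QV Aint Qsh q by (intro card_UN_le_mult) auto
    moreover have "a - D \<le> card (A q)" using Alow q QV by blast
    moreover have "card (Q-{q}) * D = k * D - D" unfolding cQ[OF q] by (simp add: algebra_simps)
    ultimately show ?thesis by linarith
  qed
  \<comment> \<open>For \<open>w\<close> in the core of \<open>q\<close>, the set \<open>A w\<close>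
    hardly meets \<open>A q'\<close> for the other members \<open>q'\<close>, hence lies almost
    inside \<open>A q\<close>; since the two sets have nearly the same size, the converse difference
    is small as well.\<close>
  have Pclose: "card (A q - A w) \<le> (real k + 1) * D" if q: "q \<in> Q" and w: "w \<in> P q" for q w
  proof -
    have wV: "w \<in> V" using w by (simp add: P_def)
    have "A w - A q \<subseteq> (\<Union>q'\<in>Q-{q}. A w \<inter> A q')" using VQ AV by blast
    then have "card (A w - A q) \<le> card (\<Union>q'\<in>Q-{q}. A w \<inter> A q')"
      using QV fA by (intro card_mono) auto
    moreover have "card (\<Union>q'\<in>Q-{q}. A w \<inter> A q') \<le> card (Q-{q}) * D"
      using QV Aint Psh[OF w] q by (intro card_UN_le_mult) auto
    ultimately have 1: "card (A w - A q) \<le> (real k - 1) * D" using cQ[OF q] by simp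
    have "card (A q - A w) + card (A q \<inter> A w) = card (A q)"
      "card (A w - A q) + card (A q \<inter> A w) = card (A w)"
      using card_Diff_subset_Int[of "A q" "A w"] card_Diff_subset_Int[of "A w" "A q"] fA
        card_mono[of "A q" "A q \<inter> A w"] card_mono[of "A w" "A q \<inter> A w"] by (auto simp: Int_commute)
    then have "real (card (A q - A w)) = card (A q) - real (card (A w)) + card (A w - A q)" by linarith
    also have "\<dots> \<le> (a + d) - (a - D) + (real k - 1) * D"
      using 1 Ale[of q] Alow[OF wV] q QV by auto
    finally show ?thesis using kD by (simp add: algebra_simps)
  qed
  have far: "card (A v \<inter> A q) \<le> (real k + 2) * D" if v: "v \<in> V" and q: "q \<in> Q" and w: "w \<in> P q" "shadow E v w" for v q w
  proof -
    have "A v \<inter> A q \<subseteq> (A v \<inter> A w) \<union> (A q - A w)" by auto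
    then have "card (A v \<inter> A q) \<le> card ((A v \<inter> A w) \<union> (A q - A w))"
      using fA by (intro card_mono) auto
    also have "\<dots> \<le> card (A v \<inter> A w) + card (A q - A w)" by (rule card_Un_le)
    finally have "real (card (A v \<inter> A q)) \<le> card (A v \<inter> A w) + card (A q - A w)" by linarith
    then show ?thesis using Aint[OF w(2)] Pclose[OF q w(1)] by (simp add: algebra_simps)
  qed
  \<comment> \<open>If \<open>v\<close> had a neighbour in every core, then \<open>A v\<close> would
    be almost disjoint from every \<open>A q\<close>. These sets cover \<open>V\<close>, so
    \<open>A v\<close> would be too small.\<close>
  have excol: "\<exists>q\<in>Q. P q \<subseteq> A v" if v: "v \<in> V" for v
  proof (rule ccontr)
    assume "\<not> ?thesis"
    then have w: "\<exists>w\<in>P q. shadow E v w" if "q \<in> Q" for q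
      using that by (auto simp: A_def P_def)
    have "A v \<subseteq> (\<Union>q\<in>Q. A v \<inter> A q)" using VQ AV by blast
    then have "card (A v) \<le> card (\<Union>q\<in>Q. A v \<inter> A q)"
      using QV fA by (intro card_mono) auto
    moreover have "card (\<Union>q\<in>Q. A v \<inter> A q) \<le> card Q * ((real k + 2) * D)"
      using QV w far[OF v] by (intro card_UN_le_mult) auto
    ultimately have "card (A v) \<le> k * ((real k + 2) * D)" using Q by simp
    then show False using Alow[OF v] kD key kk by (simp add: algebra_simps)
  qed
  define col where "col = (\<lambda>v. SOME q. q \<in> Q \<and> P q \<subseteq> A v)"
  have col: "col v \<in> Q" "P (col v) \<subseteq> A v" if "v \<in> V" for v
    using someI_ex[of "\<lambda>q. q \<in> Q \<and> P q \<subseteq> A v"] excol[OF that] by (auto simp: col_def)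
  have colP: "col w = q" if "w \<in> P q" "q \<in> Q" for w q
  proof (rule ccontr)
    assume c: "col w \<noteq> q"
    have wV: "w \<in> V" using that by (simp add: P_def)
    then have "col w \<in> A w" using col[OF wV] qP by auto
    moreover have "shadow E w (col w)" using Psh[OF that(1)] col(1)[OF wV] c by auto
    ultimately show False by (simp add: A_def)
  qed
  show ?thesis
  proof (intro exI[of _ Q] exI[of _ col] conjI ballI impI)
    show "finite Q" "card Q = k" "col ` V \<subseteq> Q" using QV Q col by auto
    \<comment> \<open>A common colour puts a whole core of about \<open>a\<close> vertices into
      \<open>A u \<inter> A v\<close>, whereas adjacency limits this overlap to
      \<open>D\<close>.\<close>
    show "col u \<noteq> col v" if "u \<in> V" "v \<in> V" "shadow E u v" for u v
    proof
      assume "col u = col v"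
      then have "P (col u) \<subseteq> A u \<inter> A v" using col(2)[of u] col(2)[of v] that by (metis Int_subset_iff)
      then have "card (P (col u)) \<le> card (A u \<inter> A v)" using fA by (intro card_mono) auto
      then show False using Aint[OF that(3)] Plow[of "col u"] col that key kk by fastforce
    qed
    have kp: "(real k + 1)\<^sup>2 * d = (real k + 1) * D" by (simp add: D_def power2_eq_square)
    show "real (card {u\<in>V. col u \<noteq> col v \<and> \<not> shadow E v u}) \<le> (real k + 1)\<^sup>2 * d" if v: "v \<in> V" for v
    proof -
      let ?q = "col v"
      have "{u\<in>V. col u \<noteq> ?q \<and> \<not> shadow E v u} \<subseteq> A v - P ?q"
        using colP col v by (auto simp: A_def)
      then have "card {u\<in>V. col u \<noteq> ?q \<and> \<not> shadow E v u} \<le> card (A v - P ?q)"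
        using fA by (intro card_mono) auto
      also have "real (card (A v - P ?q)) = card (A v) - real (card (P ?q))"
        using col[OF v] fA card_mono[OF fA col(2)[OF v]]
        by (subst card_Diff_subset) (auto intro: finite_subset)
      finally show ?thesis unfolding kp
        using Ale[OF v] Plow[of ?q] col v kD by (simp add: algebra_simps)
    qed
    show "a - (real k + 1)\<^sup>2 * d \<le> card {v\<in>V. col v = q}" if q: "q \<in> Q" for q
    proof -
      have "P q \<subseteq> {v\<in>V. col v = q}" using colP q by (auto simp: P_def)
      then have "card (P q) \<le> card {v\<in>V. col v = q}" using fin by (intro card_mono) auto
      then show ?thesis unfolding kp using Plow[OF q] kD by (simp add: algebra_simps)
    qed
  qed
qed


text \<open>The degree in the balanced complete \<open>k\<close>-partite hypergraph divided by
  \<open>n ^ (r - 1)\<close>, in the limit: \<open>r - 1\<close> of the \<open>k - 1\<close> other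
  classes, and \<open>n / k\<close> vertices in each.\<close>

definition turan_deg :: "nat \<Rightarrow> nat \<Rightarrow> real" where
  "turan_deg r k = ((k - 1) choose (r - 1)) / k ^ (r - 1)"

lemma turan_deg_pos: "1 \<le> r \<Longrightarrow> r \<le> k \<Longrightarrow> 0 < turan_deg r k"
  by (simp add: turan_deg_def)

text \<open>Colours have the vertex type because the classes arise from the members of a
  \<open>k\<close>-clique.\<close>

definition near_partition ::
  "'a set \<Rightarrow> 'a set set \<Rightarrow> nat \<Rightarrow> real \<Rightarrow> 'a set \<Rightarrow> ('a \<Rightarrow> 'a) \<Rightarrow> bool" where
  "near_partition V E k m Q col \<longleftrightarrow> finite Q \<and> card Q = k \<and> col ` V \<subseteq> Q
    \<and> (\<forall>u\<in>V. \<forall>v\<in>V. shadow E u v \<longrightarrow> col u \<noteq> col v)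
    \<and> (\<forall>v\<in>V. real (card {u\<in>V. col u \<noteq> col v \<and> \<not> shadow E v u}) \<le> m)"

text \<open>The edges live on \<open>V'\<close>, but degrees are measured against
  \<open>card V\<close>; \<open>V - V'\<close> is the small set of vertices set aside. It is
  nonempty at most in the first pass; the second takes \<open>V' = V\<close>.\<close>

definition dense_clique_free ::
  "nat \<Rightarrow> nat \<Rightarrow> real \<Rightarrow> 'a set \<Rightarrow> 'a set \<Rightarrow> 'a set set \<Rightarrow> bool" where
  "dense_clique_free r k \<epsilon> V V' E \<longleftrightarrow> finite V \<and> V \<noteq> {} \<and> V' \<subseteq> V \<and> real (card (V - V')) \<le> \<epsilon> * card V \<and>
     (\<forall>e\<in>E. e \<subseteq> V' \<and> card e = r) \<and>
     (\<forall>v\<in>V'. (turan_deg r k - \<epsilon>) * real (card V) ^ (r - 1) \<le> card {e\<in>E. v \<in> e}) \<and>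
     (\<forall>K e. K \<subseteq> V' \<longrightarrow> card K = Suc k \<longrightarrow> (\<forall>u\<in>K. \<forall>v\<in>K. u \<noteq> v \<longrightarrow> shadow E u v)
        \<longrightarrow> e \<in> E \<longrightarrow> \<not> e \<subseteq> K)"

lemma min_degree_near_partition:
  fixes \<epsilon>' :: real and k r :: nat
  assumes rk: "2 \<le> r" "r \<le> k" and eps': "0 < \<epsilon>'"
  obtains \<epsilon> :: real where "0 < \<epsilon>" "\<epsilon> \<le> turan_deg r k / 2" and
    "\<And>(V::'a set) V' E. dense_clique_free r k \<epsilon> V V' E \<Longrightarrow>
      \<exists>Q col. near_partition V' E k (\<epsilon>' * card V) Q col
        \<and> (\<forall>q\<in>Q. (1 / k - \<epsilon>') * card V \<le> card {v\<in>V'. col v = q})"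
proof -
  \<comment> \<open>\<open>e1 * n\<close> becomes the error \<open>d\<close> of
    \<open>partition_from_nonneighbours\<close>. The two bounds in the minimum give its final error
    \<open>(k + 1)^2 * d \<le> \<epsilon>' * n\<close> and its hypothesis
    \<open>(k + 1)^3 * d < n / k\<close>. With \<open>\<alpha>\<close> the limit density of a
    neighbourhood, \<open>turan_deg r k\<close> is \<open>\<kappa> * \<alpha> ^ (r - 1)\<close>, and
    \<open>\<kappa> * \<eta>\<close> is the drop of the bound in \<open>link_size_le\<close> when a
    neighbourhood falls short by \<open>e1 * n\<close>; \<open>\<epsilon>\<close> stays below that
    drop.\<close>
  define e1 where "e1 = min (\<epsilon>' / (real k + 1)^2) (1 / (2 * k * (real k + 1)^3))"
  define \<alpha> where "\<alpha> = (real k - 1) / k"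
  define B where "B = real ((k - 1) choose (r - 1))"
  define \<eta> where "\<eta> = \<alpha> ^ (r - 1) - (\<alpha> - e1) ^ (r - 1)"
  define \<kappa> where "\<kappa> = B / (real k - 1) ^ (r - 1)"
  define \<epsilon> where "\<epsilon> = min (min e1 (turan_deg r k / 2)) (\<kappa> * \<eta> / 2)"
  have k2: "2 \<le> real k" using rk by auto
  have e1: "0 < e1" using eps' k2 by (simp add: e1_def)
  have e1k: "e1 \<le> 1 / (2 * k * (real k + 1)^3)" by (simp add: e1_def)
  also have "\<dots> < 1 / 4"
  proof -
    have "1 * 1 < 2 * k * (real k + 1) ^ 3 / 4"
    proof -
      have "1 < (real k + 1)^3" using k2 by (intro one_less_power) auto
      then have "1 * 1 < (2 * k / 4) * (real k + 1)^3" using k2 by (intro mult_le_less_imp_less) auto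
      then show ?thesis by simp
    qed
    then show ?thesis using k2 by (simp add: field_simps)
  qed
  finally have e14: "e1 < 1 / 4" .
  have \<alpha>: "1 / 2 \<le> \<alpha>" using k2 by (simp add: \<alpha>_def field_simps)
  have B: "0 < B" using rk by (simp add: B_def)
  have \<kappa>: "0 < \<kappa>" using B k2 by (simp add: \<kappa>_def)
  have "(\<alpha> - e1) ^ (r - 1) < \<alpha> ^ (r - 1)" using e1 e14 \<alpha> rk by (intro power_strict_mono) auto
  then have \<eta>: "0 < \<eta>" by (simp add: \<eta>_def)
  have c: "0 < turan_deg r k" using rk by (intro turan_deg_pos) auto
  have \<epsilon>: "0 < \<epsilon>" "\<epsilon> \<le> e1" "\<epsilon> \<le> turan_deg r k / 2" "\<epsilon> < \<kappa> * \<eta>"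
  proof -
    have "0 < \<kappa> * \<eta>" using \<kappa> \<eta> by (rule mult_pos_pos)
    then show "0 < \<epsilon>" using e1 c by (simp add: \<epsilon>_def)
    have "\<epsilon> \<le> \<kappa> * \<eta> / 2" by (simp add: \<epsilon>_def)
    then show "\<epsilon> < \<kappa> * \<eta>" using \<open>0 < \<kappa> * \<eta>\<close> by linarith
    show "\<epsilon> \<le> e1" "\<epsilon> \<le> turan_deg r k / 2" by (simp_all add: \<epsilon>_def)
  qed
  have ck: "turan_deg r k = \<kappa> * \<alpha> ^ (r - 1)"
    using k2 by (simp add: turan_deg_def \<kappa>_def \<alpha>_def B_def power_divide)
  show ?thesis
  proof (rule that[OF \<epsilon>(1,3)])
    fix V V' :: "'a set" and E
    assume dense: "dense_clique_free r k \<epsilon> V V' E"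
    then have fin: "finite V" and ne: "V \<noteq> {}" and V': "V' \<subseteq> V" "card (V - V') \<le> \<epsilon> * card V"
      and E: "\<And>e. e \<in> E \<Longrightarrow> e \<subseteq> V' \<and> card e = r"
      and deg: "\<And>v. v \<in> V' \<Longrightarrow> (turan_deg r k - \<epsilon>) * real (card V) ^ (r - 1) \<le> card {e\<in>E. v \<in> e}"
      unfolding dense_clique_free_def by auto
    have nocl: False if "K \<subseteq> V'" "card K = Suc k" "\<And>u v. u \<in> K \<Longrightarrow> v \<in> K \<Longrightarrow> u \<noteq> v \<Longrightarrow> shadow E u v"
        "e \<in> E" "e \<subseteq> K" for K e
      using dense that unfolding dense_clique_free_def by simp
    define n where "n = real (card V)"
    have n: "0 < n" using fin ne by (simp add: n_def card_gt_0_iff)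
    have fin': "finite V'" using V' fin finite_subset by auto
    have cV': "real (card V') = n - card (V - V')"
      using V' fin' fin card_mono[OF fin V'(1)] by (simp add: card_Diff_subset n_def of_nat_diff)
    have "\<epsilon> * n \<le> e1 * n" using \<epsilon> n by (intro mult_right_mono) auto
    then have cV'2: "n - e1 * n \<le> card V'" using cV' V' by (simp add: n_def)
    have "e1 * n < 1 * n" using e14 n by (intro mult_strict_right_mono) auto
    then have ne': "V' \<noteq> {}" using cV'2 by auto
    have cov: "\<exists>e\<in>E. v \<in> e" if v: "v \<in> V'" for v
    proof -
      have "0 < (turan_deg r k - \<epsilon>) * n ^ (r - 1)" using \<epsilon> c n by (intro mult_pos_pos) auto
      then have "0 < card {e\<in>E. v \<in> e}" using deg[OF v] by (simp add: n_def)
      then have "{e\<in>E. v \<in> e} \<noteq> {}" by (metis card.empty less_numeral_extra(3))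
      then show ?thesis by auto
    qed
    have nb: "(\<alpha> - e1) * n \<le> card {u\<in>V'. shadow E v u}" if v: "v \<in> V'" for v
    proof (rule ccontr)
      assume less: "\<not> ?thesis"
      define N where "N = real (card {u\<in>V'. shadow E v u})"
      have "(turan_deg r k - \<epsilon>) * n ^ (r - 1) \<le> card {e\<in>E. v \<in> e}" using deg[OF v] by (simp add: n_def)
      also have "\<dots> \<le> B * (N / (real k - 1)) ^ (r - 1)"
        unfolding B_def N_def by (rule link_size_le[OF fin' E rk nocl v])
      also have "\<dots> \<le> B * ((\<alpha> - e1) * n / (real k - 1)) ^ (r - 1)"
        using less B k2 by (intro mult_left_mono power_mono divide_right_mono) (auto simp: N_def)
      also have "\<dots> = \<kappa> * (\<alpha> - e1) ^ (r - 1) * n ^ (r - 1)"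
        using rk by (simp add: \<kappa>_def power_divide power_mult_distrib of_nat_diff)
      also have "\<dots> = (turan_deg r k - \<kappa> * \<eta>) * n ^ (r - 1)"
        by (simp add: ck \<eta>_def algebra_simps)
      finally have "turan_deg r k - \<epsilon> \<le> turan_deg r k - \<kappa> * \<eta>"
        using n by (simp add: mult_le_cancel_right)
      then show False using \<epsilon> by simp
    qed
    have nonnb: "real (card {u\<in>V'. \<not> shadow E v u}) \<le> n / k + e1 * n" if v: "v \<in> V'" for v
    proof -
      have "{u\<in>V'. \<not> shadow E v u} = V' - {u\<in>V'. shadow E v u}" by auto
      then have "real (card {u\<in>V'. \<not> shadow E v u}) = card V' - real (card {u\<in>V'. shadow E v u})"
        using fin' card_mono[of V' "{u\<in>V'. shadow E v u}"]
        by (simp add: card_Diff_subset of_nat_diff)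
      also have "\<dots> \<le> n - (\<alpha> - e1) * n" using nb[OF v] cV' by simp
      also have "\<dots> = n / k + e1 * n" using k2 by (simp add: \<alpha>_def field_simps)
      finally show ?thesis .
    qed
    have small: "(real k + 1) ^ 3 * (e1 * n) < n / k"
    proof -
      have "(real k + 1) ^ 3 * e1 \<le> (real k + 1) ^ 3 * (1 / (2 * k * (real k + 1)^3))"
        using e1k by (intro mult_left_mono) auto
      also have "\<dots> = 1 / (2 * k)"
      proof -
        have "(real k + 1) ^ 3 \<noteq> 0" using k2 by simp
        then show ?thesis by simp
      qed
      also have "\<dots> < 1 / k" using k2 by (simp add: field_simps)
      finally have "(real k + 1) ^ 3 * e1 * n < 1 / k * n" using n by (intro mult_strict_right_mono)
      then show ?thesis by (simp add: mult.assoc)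
    qed
    have "\<exists>(Q :: 'a set) (col :: 'a \<Rightarrow> 'a). finite Q \<and> card Q = k \<and> col ` V' \<subseteq> Q
      \<and> (\<forall>u\<in>V'. \<forall>v\<in>V'. shadow E u v \<longrightarrow> col u \<noteq> col v)
      \<and> (\<forall>v\<in>V'. card {u\<in>V'. col u \<noteq> col v \<and> \<not> shadow E v u} \<le> (real k + 1) ^ 2 * (e1 * n))
      \<and> (\<forall>q\<in>Q. n / k - (real k + 1) ^ 2 * (e1 * n) \<le> card {v\<in>V'. col v = q})"
    proof (rule partition_from_nonneighbours[OF fin' ne' E rk(2) _ cov])
      show False if "K \<subseteq> V'" "card K = Suc k" "\<And>u v. u \<in> K \<Longrightarrow> v \<in> K \<Longrightarrow> u \<noteq> v \<Longrightarrow> shadow E u v"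
        "e \<in> E" "e \<subseteq> K" for K e using that by (rule nocl)
      show "real (card {u\<in>V'. \<not> shadow E v u}) \<le> n / k + e1 * n" if "v \<in> V'" for v
        using that by (rule nonnb)
    qed (use k2 cV'2 e1 n small in auto)
    then obtain Q :: "'a set" and col :: "'a \<Rightarrow> 'a" where Q: "finite Q" "card Q = k" "col ` V' \<subseteq> Q"
      "\<forall>u\<in>V'. \<forall>v\<in>V'. shadow E u v \<longrightarrow> col u \<noteq> col v"
      "\<forall>v\<in>V'. card {u\<in>V'. col u \<noteq> col v \<and> \<not> shadow E v u} \<le> (real k + 1) ^ 2 * (e1 * n)"
      "\<forall>q\<in>Q. n / k - (real k + 1) ^ 2 * (e1 * n) \<le> card {v\<in>V'. col v = q}"
      by (elim exE conjE) (rule that; assumption)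
    have "e1 \<le> \<epsilon>' / (real k + 1)^2" by (simp add: e1_def)
    then have "(real k + 1)^2 * e1 \<le> \<epsilon>'" using k2 by (simp add: field_simps)
    then have le: "(real k + 1) ^ 2 * (e1 * n) \<le> \<epsilon>' * n"
      using n by (metis mult.assoc mult_right_mono less_imp_le)
    have eq: "(1 / k - \<epsilon>') * n = n / k - \<epsilon>' * n" by (simp add: algebra_simps)
    have Q5: "\<forall>v\<in>V'. card {u\<in>V'. col u \<noteq> col v \<and> \<not> shadow E v u} \<le> \<epsilon>' * n"
      using Q(5) le by (meson order_trans)
    have Q6: "\<forall>q\<in>Q. n / k - \<epsilon>' * n \<le> card {v\<in>V'. col v = q}"
    proof
      fix q assume "q \<in> Q"
      with Q(6) le show "n / k - \<epsilon>' * n \<le> card {v\<in>V'. col v = q}" by fastforce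
    qed
    show "\<exists>Q col. near_partition V' E k (\<epsilon>' * card V) Q col
        \<and> (\<forall>q\<in>Q. (1 / k - \<epsilon>') * card V \<le> card {v\<in>V'. col v = q})"
      unfolding near_partition_def n_def[symmetric] eq
      by (rule exI[of _ Q], rule exI[of _ col]) (intro conjI Q(1-4) Q5 Q6)
  qed
qed

section \<open>Embedding expanded cliques\<close>

lemma hgraph_iso_sym:
  assumes "hgraph_iso G H" and E: "\<And>e. e \<in> hedges G \<Longrightarrow> e \<subseteq> hverts G"
  shows "hgraph_iso H G"
proof -
  obtain f where f: "bij_betw f (hverts G) (hverts H)" "(\<lambda>e. f ` e) ` hedges G = hedges H"
    using assms by (auto simp: hgraph_iso_def)
  define g where "g = inv_into (hverts G) f"
  have g: "bij_betw g (hverts H) (hverts G)" using f bij_betw_inv_into by (auto simp: g_def)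
  have "g ` f ` e = e" if "e \<in> hedges G" for e
    using E[OF that] f by (auto simp: g_def bij_betw_def inv_into_image_cancel)
  then have "(\<lambda>e. g ` e) ` hedges H = hedges G" unfolding f(2)[symmetric] image_image by simp
  with g show ?thesis by (auto simp: hgraph_iso_def)
qed

lemma hgraph_free_subgraph:
  assumes "hgraph_free F H" "hverts G \<subseteq> hverts H" "hedges G \<subseteq> hedges H"
  shows "hgraph_free F G"
proof -
  have "hsubgraph G' H" if "hsubgraph G' G" for G'
    using that assms(2,3) unfolding hsubgraph_def by auto
  then show ?thesis using assms(1) unfolding hgraph_free_def by auto
qed

text \<open>\<open>Z\<close> stands for the vertices already used by a partial embedding, so an
  \<open>M\<close> that depends on \<open>r\<close> and \<open>k\<close> only is enough.\<close>

definition heavy :: "nat \<Rightarrow> 'a set \<Rightarrow> 'a set set \<Rightarrow> 'a \<Rightarrow> 'a \<Rightarrow> bool" where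
  "heavy M V E u v \<longleftrightarrow> u \<noteq> v \<and>
     (\<forall>Z\<subseteq>V. card Z \<le> M \<longrightarrow> u \<notin> Z \<longrightarrow> v \<notin> Z \<longrightarrow> (\<exists>e\<in>E. u \<in> e \<and> v \<in> e \<and> e \<inter> Z = {}))"

lemma heavy_sym: "heavy M V E u v \<Longrightarrow> heavy M V E v u"
  unfolding heavy_def by meson

text \<open>A greedy choice: the edge for a new pair avoids the rest of \<open>K\<close> and all
  edges chosen before. The pair \<open>P0\<close> is exempt from heaviness because it brings its own
  edge \<open>f\<close>; this edge comes first and accounts for the \<open>Suc\<close> in
  \<open>r * Suc (card PP)\<close>.\<close>

lemma disjoint_pair_extensions:
  assumes fin: "finite V" and E: "\<And>e. e \<in> E \<Longrightarrow> e \<subseteq> V \<and> card e = r"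
    and K: "K \<subseteq> V" "card K = Suc k"
    and f: "f \<in> E" "f \<inter> K = P0"
    and PP: "finite PP" "\<And>P. P \<in> PP \<Longrightarrow> P \<subseteq> K \<and> card P = 2" "P0 \<notin> PP"
    and hv: "\<And>u v. {u, v} \<in> PP \<Longrightarrow> u \<noteq> v \<Longrightarrow> heavy M V E u v"
    and M: "Suc k + r * Suc (card PP) \<le> M"
  shows "\<exists>X. (\<forall>P\<in>insert P0 PP. X P \<in> E \<and> X P \<inter> K = P) \<and>
    (\<forall>P\<in>insert P0 PP. \<forall>P'\<in>insert P0 PP. P \<noteq> P' \<longrightarrow> X P \<inter> X P' \<subseteq> K)"
  using PP hv M
proof (induction rule: finite_induct)
  case empty
  show ?case using f by (intro exI[of _ "\<lambda>_. f"]) auto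
next
  case (insert P PP)
  have M: "Suc k + r * Suc (card PP) \<le> M" "card (insert P PP) = Suc (card PP)"
    using insert by auto
  have P: "P \<subseteq> K" "card P = 2" and P0: "P0 \<noteq> P" "P0 \<notin> PP" using insert.prems by auto
  have "\<exists>X. (\<forall>P\<in>insert P0 PP. X P \<in> E \<and> X P \<inter> K = P) \<and>
    (\<forall>P\<in>insert P0 PP. \<forall>P'\<in>insert P0 PP. P \<noteq> P' \<longrightarrow> X P \<inter> X P' \<subseteq> K)"
    by (rule insert.IH) (use insert.prems M in auto)
  then obtain X where X0: "(\<forall>P\<in>insert P0 PP. X P \<in> E \<and> X P \<inter> K = P) \<and>
    (\<forall>P\<in>insert P0 PP. \<forall>P'\<in>insert P0 PP. P \<noteq> P' \<longrightarrow> X P \<inter> X P' \<subseteq> K)" by (rule exE)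
  have X: "\<And>P. P \<in> insert P0 PP \<Longrightarrow> X P \<in> E \<and> X P \<inter> K = P"
    "\<And>P P'. P \<in> insert P0 PP \<Longrightarrow> P' \<in> insert P0 PP \<Longrightarrow> P \<noteq> P' \<Longrightarrow> X P \<inter> X P' \<subseteq> K"
    by (rule bspec[OF conjunct1[OF X0]], assumption,
        rule mp[OF bspec[OF bspec[OF conjunct2[OF X0]]]], assumption+)
  obtain u v where uv: "P = {u, v}" "u \<noteq> v" using P by (auto simp: card_2_iff)
  have hv: "heavy M V E u v" using insert.prems uv by auto
  define U where "U = (\<Union>P'\<in>insert P0 PP. X P')"
  define Z where "Z = (K \<union> U) - P"
  have fK: "finite K" using K fin finite_subset by auto
  have XV: "X P' \<subseteq> V" "card (X P') = r" if "P' \<in> insert P0 PP" for P' using X(1)[OF that] E by auto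
  have UV: "U \<subseteq> V" unfolding U_def by (rule UN_least) (rule XV)
  have "card U \<le> (\<Sum>P'\<in>insert P0 PP. card (X P'))" unfolding U_def using insert.hyps by (intro card_UN_le) auto
  also have "\<dots> = r * Suc (card PP)" using XV insert.hyps P0 by simp
  finally have cU: "card U \<le> r * Suc (card PP)" .
  have "card Z \<le> card (K \<union> U)" unfolding Z_def using fK finite_subset[OF UV fin] by (intro card_mono) auto
  also have "\<dots> \<le> card K + card U" by (rule card_Un_le)
  also have "\<dots> \<le> M" using cU K M by simp
  finally have cZ: "card Z \<le> M" .
  have "Z \<subseteq> V" "u \<notin> Z" "v \<notin> Z" using K UV uv unfolding Z_def by blast+
  then obtain e where e: "e \<in> E" "u \<in> e" "v \<in> e" "e \<inter> Z = {}" using hv cZ unfolding heavy_def by meson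
  have eK: "e \<inter> K = P" using e uv P unfolding Z_def by blast
  have eX: "e \<inter> X P' \<subseteq> K" if "P' \<in> insert P0 PP" for P'
  proof -
    have "X P' \<subseteq> U" unfolding U_def using that by (rule UN_upper)
    then have "e \<inter> X P' \<subseteq> P" using e(4) unfolding Z_def by blast
    then show ?thesis using P by auto
  qed
  define Y where "Y = X(P := e)"
  have YP: "Y P = e" and Yo: "\<And>P'. P' \<in> insert P0 PP \<Longrightarrow> Y P' = X P'"
    using insert.hyps P0 by (auto simp: Y_def)
  show ?case
  proof (rule exI[of _ Y], intro conjI ballI impI)
    fix P' assume "P' \<in> insert P0 (insert P PP)"
    then consider "P' = P" | "P' \<in> insert P0 PP" by blast
    then have "Y P' \<in> E \<and> Y P' \<inter> K = P'"
    proof cases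
      case 1 then show ?thesis using YP e(1) eK by simp
    next
      case 2 then show ?thesis using Yo[OF 2] X(1)[OF 2] by simp
    qed
    then show "Y P' \<in> E" "Y P' \<inter> K = P'" by simp_all
  next
    fix P1 P2 assume P12: "P1 \<in> insert P0 (insert P PP)" "P2 \<in> insert P0 (insert P PP)" "P1 \<noteq> P2"
    then consider "P1 = P" "P2 \<in> insert P0 PP" | "P2 = P" "P1 \<in> insert P0 PP"
      | "P1 \<in> insert P0 PP" "P2 \<in> insert P0 PP" by blast
    then show "Y P1 \<inter> Y P2 \<subseteq> K"
    proof cases
      case 1 then show ?thesis using eX YP Yo by simp
    next
      case 2
      then have "Y P1 \<inter> Y P2 = e \<inter> X P1" using YP Yo by (simp add: Int_commute)
      then show ?thesis using eX[OF 2(2)] by simp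
    next
      case 3 then show ?thesis using X(2)[OF 3 P12(3)] Yo by simp
    qed
  qed
qed

text \<open>\<open>e0\<close> plays the edge \<open>{1..r}\<close>, so pairs inside it need no edge
  of their own. One more pair is excused from being heavy if an edge \<open>f\<close> meets
  \<open>K\<close> exactly there; this exception is what makes the argument about two vertices of
  one class possible. The number of pairs is bounded crudely by \<open>2 ^ Suc k\<close>.\<close>

lemma expanded_clique_embedding:
  assumes H: "r_graph r H" and rk: "2 \<le> r" "r \<le> k"
    and K: "K \<subseteq> hverts H" "card K = Suc k"
    and e0: "e0 \<in> hedges H" "e0 \<subseteq> K"
    and f: "f \<in> hedges H" "f \<inter> K = {u0, v0}" "u0 \<noteq> v0"
    and hv: "\<And>u v. u \<in> K \<Longrightarrow> v \<in> K \<Longrightarrow> u \<noteq> v \<Longrightarrow> \<not> {u, v} \<subseteq> e0 \<Longrightarrow> {u, v} \<noteq> {u0, v0}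
        \<Longrightarrow> heavy M (hverts H) (hedges H) u v"
    and M: "Suc k + r * Suc (2 ^ Suc k) \<le> M"
  shows "\<not> hgraph_free (expanded_clique r (k + 1)) H"
proof -
  define V where "V = hverts H"
  define E where "E = hedges H"
  have fin: "finite V" and E: "\<And>e. e \<in> E \<Longrightarrow> e \<subseteq> V \<and> card e = r"
    using H by (auto simp: r_graph_def V_def E_def)
  have fK: "finite K" using K fin finite_subset by (auto simp: V_def)
  define PP where "PP = {P. P \<subseteq> K \<and> card P = 2 \<and> \<not> P \<subseteq> e0}"
  define PP' where "PP' = PP - {{u0, v0}}"
  have PPf: "finite PP'" "card PP' \<le> 2 ^ Suc k"
  proof -
    have s: "PP' \<subseteq> Pow K" by (auto simp: PP'_def PP_def)
    then show "finite PP'" using fK finite_subset by auto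
    show "card PP' \<le> 2 ^ Suc k" using card_mono[OF _ s] fK K by (simp add: card_Pow)
  qed
  have "\<exists>X. (\<forall>P\<in>insert {u0,v0} PP'. X P \<in> E \<and> X P \<inter> K = P) \<and>
    (\<forall>P\<in>insert {u0,v0} PP'. \<forall>P'\<in>insert {u0,v0} PP'. P \<noteq> P' \<longrightarrow> X P \<inter> X P' \<subseteq> K)"
  proof (rule disjoint_pair_extensions[OF fin E _ K(2) _ f(2) PPf(1)])
    show "heavy M V E u v" if "{u, v} \<in> PP'" "u \<noteq> v" for u v
      using that hv[of u v] by (auto simp: PP'_def PP_def V_def E_def)
    have "r * Suc (card PP') \<le> r * Suc (2 ^ Suc k)" using PPf by (intro mult_le_mono) auto
    then show "Suc k + r * Suc (card PP') \<le> M" using M by linarith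
  qed (use K f in \<open>auto simp: PP'_def PP_def V_def E_def\<close>)
  then obtain X where X0: "(\<forall>P\<in>insert {u0,v0} PP'. X P \<in> E \<and> X P \<inter> K = P) \<and>
    (\<forall>P\<in>insert {u0,v0} PP'. \<forall>P'\<in>insert {u0,v0} PP'. P \<noteq> P' \<longrightarrow> X P \<inter> X P' \<subseteq> K)" by (rule exE)
  have X: "\<And>P. P \<in> insert {u0,v0} PP' \<Longrightarrow> X P \<in> E \<and> X P \<inter> K = P"
    "\<And>P P'. P \<in> insert {u0,v0} PP' \<Longrightarrow> P' \<in> insert {u0,v0} PP' \<Longrightarrow> P \<noteq> P' \<Longrightarrow> X P \<inter> X P' \<subseteq> K"
    by (rule bspec[OF conjunct1[OF X0]], assumption,
        rule mp[OF bspec[OF bspec[OF conjunct2[OF X0]]]], assumption+)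
  have PPs: "P \<in> insert {u0,v0} PP'" if "P \<in> PP" for P using that by (auto simp: PP'_def)
  have ce0: "card e0 = r" "finite e0" using e0 E fK finite_subset by (auto simp: E_def)
  obtain g1 where g1: "bij_betw g1 {1..r} e0"
    using finite_same_card_bij[of "{1..r}" e0] ce0 by auto
  have cKe: "card (K - e0) = Suc k - r" using card_Diff_subset[OF ce0(2) e0(2)] K ce0 by simp
  obtain g2 where g2: "bij_betw g2 {Suc r..Suc k} (K - e0)"
    using finite_same_card_bij[of "{Suc r..Suc k}" "K - e0"] cKe fK rk by auto
  define g where "g = (\<lambda>i. if i \<le> r then g1 i else g2 i)"
  have gg1: "bij_betw g {1..r} e0" using g1 by (subst bij_betw_cong[of _ _ g1]) (auto simp: g_def)
  moreover have "bij_betw g {Suc r..Suc k} (K - e0)"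
    using g2 by (subst bij_betw_cong[of _ _ g2]) (auto simp: g_def)
  ultimately have "bij_betw g ({1..r} \<union> {Suc r..Suc k}) (e0 \<union> (K - e0))"
    by (rule bij_betw_combine) auto
  moreover have "{1..r} \<union> {Suc r..Suc k} = {1..Suc k}" using rk by auto
  moreover have "e0 \<union> (K - e0) = K" using e0 by auto
  ultimately have g: "bij_betw g {1..Suc k} K" by simp
  have ginj: "inj_on g {1..Suc k}" and gK: "g ` {1..Suc k} = K" using g by (auto simp: bij_betw_def)
  have ge0: "g ` {1..r} = e0" using gg1 by (auto simp: bij_betw_def)
  define DD where "DD = pairs_upto (Suc k) - pairs_upto r"
  have DD: "P \<subseteq> {1..Suc k}" "card P = 2" "\<not> P \<subseteq> {1..r}" if "P \<in> DD" for P
    using that by (auto simp: DD_def pairs_upto_def)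
  have gP: "g ` P \<in> PP" if P: "P \<in> DD" for P
  proof -
    have "g ` P \<subseteq> K" using DD(1)[OF P] gK by auto
    moreover have "card (g ` P) = 2"
      using DD[OF P] card_image[OF inj_on_subset[OF ginj DD(1)[OF P]]] by simp
    moreover have "\<not> g ` P \<subseteq> e0"
    proof
      assume "g ` P \<subseteq> e0"
      then have "g ` P \<subseteq> g ` {1..r}" unfolding ge0 .
      moreover have "{1..r} \<subseteq> {1..Suc k}" using rk by auto
      ultimately have "P \<subseteq> {1..r}" using inj_on_image_subset_iff[OF ginj DD(1)[OF P]] by blast
      then show False using DD[OF P] by simp
    qed
    ultimately show ?thesis by (simp add: PP_def)
  qed
  \<comment> \<open>\<open>R P\<close> is to become the image of \<open>pair_ext r P\<close>. These
    blocks are disjoint from \<open>K\<close>, and from each other because the chosen edges overlap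
    only inside \<open>K\<close>.\<close>
  define R where "R = (\<lambda>P. X (g ` P) - g ` P)"
  have XP: "X (g ` P) \<in> E" "X (g ` P) \<inter> K = g ` P" if "P \<in> DD" for P
    using X(1)[OF PPs[OF gP[OF that]]] by auto
  have RK: "R P \<inter> K = {}" if "P \<in> DD" for P using XP[OF that] by (auto simp: R_def)
  have RR: "R P \<inter> R P' = {}" if PP': "P \<in> DD" "P' \<in> DD" "P \<noteq> P'" for P P'
  proof -
    have "g ` P \<noteq> g ` P'" using inj_on_image_eq_iff[OF ginj DD(1)[OF PP'(1)] DD(1)[OF PP'(2)]] PP' by simp
    then have "X (g ` P) \<inter> X (g ` P') \<subseteq> K" using X(2)[OF PPs[OF gP[OF PP'(1)]] PPs[OF gP[OF PP'(2)]]] by simp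
    then show ?thesis using RK[OF PP'(1)] by (auto simp: R_def)
  qed
  have cR: "card (R P) = r - 2" "finite (R P)" if P: "P \<in> DD" for P
  proof -
    have fX: "finite (X (g ` P))" "card (X (g ` P)) = r" using E[OF XP(1)[OF P]] finite_subset[OF _ fin] by auto
    then show "finite (R P)" by (simp add: R_def)
    have "g ` P \<subseteq> X (g ` P)" using XP[OF P] by auto
    moreover have "finite (g ` P)" using DD(1)[OF P] finite_subset by auto
    moreover have "card (g ` P) = 2" using gP[OF P] by (simp add: PP_def)
    ultimately show "card (R P) = r - 2" using fX by (simp add: R_def card_Diff_subset)
  qed
  have "\<exists>b. bij_betw b {..<r-2} (R P)" if "P \<in> DD" for P
    using finite_same_card_bij[of "{..<r-2}" "R P"] cR[OF that] by auto
  then obtain b where b: "\<And>P. P \<in> DD \<Longrightarrow> bij_betw (b P) {..<r-2} (R P)" by metis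
  define h where "h = (\<lambda>z. case z of Inl i \<Rightarrow> g i | Inr (P, l) \<Rightarrow> b P l)"
  have hI: "h ` Inl ` S = g ` S" for S by (auto simp: h_def image_image)
  have hext: "h ` pair_ext r P = R P" if "P \<in> DD" for P
    using b[OF that] by (auto simp: h_def pair_ext_def image_image bij_betw_def)
  define F where "F = expanded_clique r (Suc k)"
  have Fr: "r_graph r F" unfolding F_def using rk by (intro expanded_clique_r_graph) auto
  have FV: "hverts F = Inl ` {1..Suc k} \<union> (\<Union>P\<in>DD. pair_ext r P)"
    and FE: "hedges F = {Inl ` {1..r}} \<union> (\<lambda>P. pair_ext r P \<union> Inl ` P) ` DD"
    by (simp_all add: F_def expanded_clique_def DD_def)
  have hinj: "inj_on h (hverts F)"
  proof (rule inj_onI)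
    fix y z assume y: "y \<in> hverts F" and z: "z \<in> hverts F" and eq: "h y = h z"
    have cases: "(\<exists>i\<in>{1..Suc k}. w = Inl i) \<or> (\<exists>P\<in>DD. \<exists>l<r-2. w = Inr (P, l))" if "w \<in> hverts F" for w
      using that unfolding FV by (auto simp: pair_ext_def)
    have hInl: "h (Inl i) \<in> K" if "i \<in> {1..Suc k}" for i using that gK by (auto simp: h_def)
    have hInr: "h (Inr (P, l)) \<in> R P" if "P \<in> DD" "l < r - 2" for P l
      using that b[OF that(1)] by (auto simp: h_def bij_betw_def)
    from cases[OF y] cases[OF z] show "y = z"
    proof (elim disjE bexE exE conjE)
      fix i j assume "i \<in> {1..Suc k}" "j \<in> {1..Suc k}" "y = Inl i" "z = Inl j"
      then show ?thesis using eq ginj by (auto simp: h_def inj_on_def)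
    next
      fix i P l assume "i \<in> {1..Suc k}" "P \<in> DD" "l < r - 2" "y = Inl i" "z = Inr (P, l)"
      then show ?thesis using eq hInl[of i] hInr[of P l] RK[of P] by auto
    next
      fix i P l assume "i \<in> {1..Suc k}" "P \<in> DD" "l < r - 2" "z = Inl i" "y = Inr (P, l)"
      then show ?thesis using eq hInl[of i] hInr[of P l] RK[of P] by auto
    next
      fix P l P' l' assume *: "P \<in> DD" "l < r - 2" "y = Inr (P, l)" "P' \<in> DD" "l' < r - 2" "z = Inr (P', l')"
      have "P = P'"
      proof (rule ccontr)
        assume "P \<noteq> P'"
        then show False using RR[OF *(1,4)] hInr[OF *(1,2)] hInr[OF *(4,5)] eq * by auto
      qed
      moreover from this have "l = l'" using b[OF *(1)] eq * by (auto simp: h_def bij_betw_def inj_on_def)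
      ultimately show ?thesis using * by simp
    qed
  qed
  define G where "G = (h ` hverts F, (\<lambda>e. h ` e) ` hedges F)"
  have isoFG: "hgraph_iso F G"
    unfolding hgraph_iso_def using hinj by (intro exI[of _ h]) (auto simp: G_def bij_betw_def)
  have isoGF: "hgraph_iso G F"
    by (rule hgraph_iso_sym[OF isoFG]) (use Fr in \<open>auto simp: r_graph_def\<close>)
  have hedge: "h ` (pair_ext r P \<union> Inl ` P) = X (g ` P)" if "P \<in> DD" for P
    unfolding image_Un hext[OF that] hI using XP[OF that] by (auto simp: R_def)
  have "hverts G \<subseteq> hverts H"
  proof -
    have "hverts G = K \<union> (\<Union>P\<in>DD. R P)" by (simp add: G_def FV image_Un hI gK[simplified] image_UN hext)
    moreover have "R P \<subseteq> V" if "P \<in> DD" for P using E[OF XP(1)[OF that]] by (auto simp: R_def)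
    ultimately show ?thesis using K by (auto simp: V_def)
  qed
  moreover have "hedges G \<subseteq> hedges H"
  proof
    fix e assume "e \<in> hedges G"
    then have "e = g ` {1..r} \<or> (\<exists>P\<in>DD. e = h ` (pair_ext r P \<union> Inl ` P))"
      by (auto simp: G_def FE hI)
    then show "e \<in> hedges H" using ge0 e0 hedge XP by (auto simp: E_def)
  qed
  moreover have "\<forall>e\<in>hedges G. e \<subseteq> hverts G" using Fr by (auto simp: G_def r_graph_def)
  ultimately have "hsubgraph G H" by (simp add: hsubgraph_def)
  with isoGF show ?thesis unfolding hgraph_free_def F_def Suc_eq_plus1 by blast
qed

text \<open>With all pairs heavy, the edge \<open>f\<close> for the excused pair has to be
  manufactured. As \<open>K\<close> has more than \<open>r\<close> vertices, some pair joins
  \<open>e0\<close> to a vertex outside it, and heaviness with the rest of \<open>K\<close>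
  forbidden yields an edge meeting \<open>K\<close> only in this pair.\<close>

lemma heavy_clique_embedding:
  assumes H: "r_graph r H" and rk: "2 \<le> r" "r \<le> k"
    and K: "K \<subseteq> hverts H" "card K = Suc k"
    and e0: "e0 \<in> hedges H" "e0 \<subseteq> K"
    and hv: "\<And>u v. u \<in> K \<Longrightarrow> v \<in> K \<Longrightarrow> u \<noteq> v \<Longrightarrow> heavy M (hverts H) (hedges H) u v"
    and M: "Suc k + r * Suc (2 ^ Suc k) \<le> M"
  shows "\<not> hgraph_free (expanded_clique r (k + 1)) H"
proof -
  have fK: "finite K" using K by (simp add: card_ge_0_finite)
  have "card e0 = r" using H e0 by (auto simp: r_graph_def)
  then have "\<not> K \<subseteq> e0" "e0 \<noteq> {}" using rk K e0 by auto
  then obtain u v where uv: "u \<in> K" "v \<in> K" "v \<notin> e0" "u \<in> e0" using e0 by blast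
  have "card (K - {u, v}) \<le> M" using fK K M card_mono[OF fK, of "K - {u,v}"] by auto
  moreover have "heavy M (hverts H) (hedges H) u v" using hv uv by auto
  ultimately obtain f where f: "f \<in> hedges H" "u \<in> f" "v \<in> f" "f \<inter> (K - {u, v}) = {}"
  proof -
    have "K - {u, v} \<subseteq> hverts H" "u \<notin> K - {u, v}" "v \<notin> K - {u, v}" using K by auto
    then show ?thesis using that \<open>card (K - {u, v}) \<le> M\<close> \<open>heavy M (hverts H) (hedges H) u v\<close>
      unfolding heavy_def by meson
  qed
  have "f \<inter> K = {u, v}" using f uv by auto
  moreover have "u \<noteq> v" using uv by auto
  ultimately show ?thesis
    by (rule expanded_clique_embedding[OF H rk K e0 f(1) _ _ _ M]) (rule hv)
qed

section \<open>Degree stability\<close>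

text \<open>The bound is a quotient instead of a power with exponent \<open>r - card T\<close>, so
  it stays correct for \<open>card T > r\<close>, where truncated subtraction would
  interfere.\<close>

lemma card_supersets_le:
  assumes fin: "finite V" "V \<noteq> {}" and E: "\<And>e. e \<in> E \<Longrightarrow> e \<subseteq> V \<and> card e = r"
    and T: "finite T"
  shows "real (card {e\<in>E. T \<subseteq> e}) \<le> real (card V) ^ r / real (card V) ^ card T"
proof (cases "card T \<le> r")
  case False
  have "{e\<in>E. T \<subseteq> e} = {}"
  proof (rule ccontr)
    assume "{e\<in>E. T \<subseteq> e} \<noteq> {}"
    then obtain e where "e \<in> E" "T \<subseteq> e" by auto
    then show False using E[of e] card_mono[of e T] finite_subset[of e V] fin False by auto
  qed
  then show ?thesis by (simp only: card.empty) simp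
next
  case True
  have n: "card V > 0" using fin by (simp add: card_gt_0_iff)
  have "card {e\<in>E. T \<subseteq> e} = card ((\<lambda>e. e - T) ` {e\<in>E. T \<subseteq> e})"
    by (rule card_image[symmetric]) (auto simp: inj_on_def)
  also have "\<dots> \<le> card {S. S \<subseteq> V \<and> card S = r - card T}"
    using E fin T by (intro card_mono) (auto intro: finite_subset[of _ "Pow V"] simp: card_Diff_subset)
  also have "\<dots> = card V choose (r - card T)" using fin by (simp add: n_subsets)
  also have "\<dots> \<le> card V ^ (r - card T)"
    by (cases "r - card T \<le> card V") (auto simp: binomial_le_pow binomial_eq_0)
  finally have "real (card {e\<in>E. T \<subseteq> e}) \<le> real (card V) ^ (r - card T)"
    by (metis of_nat_le_iff of_nat_power)
  also have "\<dots> = real (card V) ^ r / real (card V) ^ card T"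
    using True n by (simp add: power_diff)
  finally show ?thesis .
qed

lemma card_supersets_hitting_le:
  assumes fin: "finite V" "V \<noteq> {}" and E: "\<And>e. e \<in> E \<Longrightarrow> e \<subseteq> V \<and> card e = r"
    and T: "finite T" and Z: "finite Z" "Z \<inter> T = {}"
  shows "real (card {e\<in>E. T \<subseteq> e \<and> e \<inter> Z \<noteq> {}})
    \<le> card Z * (real (card V) ^ r / real (card V) ^ Suc (card T))"
proof -
  have "{e\<in>E. T \<subseteq> e \<and> e \<inter> Z \<noteq> {}} = (\<Union>z\<in>Z. {e\<in>E. insert z T \<subseteq> e})" by auto
  then have "real (card {e\<in>E. T \<subseteq> e \<and> e \<inter> Z \<noteq> {}}) = card (\<Union>z\<in>Z. {e\<in>E. insert z T \<subseteq> e})" by simp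
  also have "\<dots> \<le> card Z * (real (card V) ^ r / real (card V) ^ Suc (card T))"
  proof (rule card_UN_le_mult[OF Z(1)])
    fix z assume "z \<in> Z"
    then have "z \<notin> T" using Z(2) by blast
    then have "card (insert z T) = Suc (card T)" using T by simp
    then show "real (card {e\<in>E. insert z T \<subseteq> e}) \<le> real (card V) ^ r / real (card V) ^ Suc (card T)"
      using card_supersets_le[OF fin E, of E "insert z T"] T by simp
  qed
  finally show ?thesis .
qed

text \<open>A bounded witness against heaviness meets every edge through the pair, which saves a
  factor of order \<open>card V\<close> over the trivial codegree bound.\<close>

lemma codegree_not_heavy_le:
  assumes fin: "finite V" "V \<noteq> {}" and E: "\<And>e. e \<in> E \<Longrightarrow> e \<subseteq> V \<and> card e = r"
    and uv: "u \<noteq> v" "\<not> heavy M V E u v"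
  shows "real (card {e\<in>E. {u, v} \<subseteq> e}) \<le> M * (real (card V) ^ r / real (card V) ^ 3)"
proof -
  obtain Z where Z: "Z \<subseteq> V" "card Z \<le> M" "u \<notin> Z" "v \<notin> Z"
    "\<And>e. e \<in> E \<Longrightarrow> u \<in> e \<Longrightarrow> v \<in> e \<Longrightarrow> e \<inter> Z \<noteq> {}" using uv unfolding heavy_def by meson
  have fZ: "finite Z" using finite_subset[OF Z(1) fin(1)] .
  have "{e\<in>E. {u, v} \<subseteq> e} = {e\<in>E. {u, v} \<subseteq> e \<and> e \<inter> Z \<noteq> {}}" using Z(5) by blast
  then have "real (card {e\<in>E. {u, v} \<subseteq> e}) = card {e\<in>E. {u, v} \<subseteq> e \<and> e \<inter> Z \<noteq> {}}" by (rule arg_cong)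
  also have "\<dots> \<le> card Z * (real (card V) ^ r / real (card V) ^ Suc (card {u,v}))"
    by (rule card_supersets_hitting_le[OF fin E]) (use fZ Z in auto)
  also have "\<dots> \<le> M * (real (card V) ^ r / real (card V) ^ 3)"
    using Z uv by (intro mult_mono) (auto simp: numeral_3_eq_3)
  finally show ?thesis .
qed

text \<open>Heaviness refers to all of \<open>V\<close> and \<open>E\<close> even when the edges are
  restricted to \<open>V'\<close>, so that cliques found inside \<open>V'\<close> can be embedded
  with the help of the whole hypergraph.\<close>

definition heavy_edges :: "nat \<Rightarrow> 'a set \<Rightarrow> 'a set set \<Rightarrow> 'a set \<Rightarrow> 'a set set" where
  "heavy_edges M V E V' = {e\<in>E. e \<subseteq> V' \<and> (\<forall>u\<in>e. \<forall>v\<in>e. u \<noteq> v \<longrightarrow> heavy M V E u v)}"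

lemma shadow_heavy_edges: "shadow (heavy_edges M V E V') u v \<Longrightarrow> heavy M V E u v"
  by (auto simp: shadow_def heavy_edges_def)

text \<open>Two vertices of the same class cannot lie in a common edge \<open>f\<close>: otherwise one completes them
  to a set of \<open>k + 1\<close> vertices, one further vertex from every other class, in which all pairs but
  this one are heavy, and \<open>f\<close> itself covers the remaining pair.\<close>

lemma near_partition_rainbow:
  fixes \<eta> \<gamma> :: real
  assumes H: "r_graph r H" and rk: "2 \<le> r" "r \<le> k"
    and free: "hgraph_free (expanded_clique r (k + 1)) H"
    and V: "V = hverts H" "V \<noteq> {}" and E: "E = hedges H" and n: "n = real (card V)"
    and V': "V' \<subseteq> V" and E': "E' = heavy_edges M V E V'"
    and M: "Suc k + r * Suc (2 ^ Suc k) \<le> M"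
    and np: "near_partition V' E' k (\<eta> * n) Q col"
    and cls: "\<And>q. q \<in> Q \<Longrightarrow> (1 / k - \<eta>) * n \<le> card {v\<in>V'. col v = q}"
    and deg: "\<And>v. v \<in> V' \<Longrightarrow> \<gamma> * n ^ (r - 1) \<le> card {e\<in>E'. v \<in> e}"
    and num: "r + \<eta> * n < \<gamma> * n" "r + (real k + 1) * (\<eta> * n) < (1 / k - \<eta>) * n" "0 \<le> \<eta>"
    and f: "f \<in> E" "u \<in> f" "v \<in> f" "u \<in> V'" "v \<in> V'" "u \<noteq> v"
  shows "col u \<noteq> col v"
proof
  assume same: "col u = col v"
  have fin: "finite V" and Er: "\<And>e. e \<in> E \<Longrightarrow> e \<subseteq> V \<and> card e = r"
    using H by (auto simp: r_graph_def V E)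
  have n0: "0 < n" using fin V by (simp add: n card_gt_0_iff)
  have fV': "finite V'" using V' fin finite_subset by auto
  have Er': "e \<subseteq> V' \<and> card e = r" "e \<in> E" "e \<subseteq> V" if "e \<in> E'" for e
    using that Er V' by (auto simp: E' heavy_edges_def)
  have ff: "finite f" "card f = r" using Er[OF f(1)] fin finite_subset by auto
  have Q: "finite Q" "card Q = k" "col ` V' \<subseteq> Q" using np by (auto simp: near_partition_def)
  have proper: "col x \<noteq> col y" if "shadow E' x y" "x \<in> V'" "y \<in> V'" for x y
    using np that unfolding near_partition_def by blast
  define Bad where "Bad = (\<lambda>t. {w\<in>V'. col w \<noteq> col t \<and> \<not> shadow E' t w})"
  have Bad: "card (Bad t) \<le> \<eta> * n" "finite (Bad t)" if "t \<in> V'" for t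
    using np that fV' by (auto simp: near_partition_def Bad_def)
  \<comment> \<open>The edge \<open>e0\<close> through \<open>u\<close> must avoid the rest of
    \<open>f\<close>, so that \<open>f\<close> meets the final set only in \<open>u\<close> and
    \<open>v\<close>, and the vertices missing from the neighbourhood of \<open>v\<close>, so that
    \<open>v\<close> is adjacent to the rest of \<open>e0\<close>. The vertex \<open>u\<close> is
    not in \<open>Bad v\<close> because it has the colour of \<open>v\<close>. At most
    \<open>card Z * n ^ (r - 2)\<close> edges through \<open>u\<close> are spoilt, fewer than its
    degree.\<close>
  define Z where "Z = (f - {u}) \<union> Bad v"
  have fZ: "finite Z" using ff Bad f by (simp add: Z_def)
  have uZ: "Z \<inter> {u} = {}" using same by (auto simp: Z_def Bad_def)
  have "card Z \<le> card (f - {u}) + card (Bad v)" unfolding Z_def by (rule card_Un_le)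
  then have cZ: "card Z \<le> r + \<eta> * n"
    using ff card_mono[of f "f - {u}"] Bad(1)[OF f(5)] by fastforce
  have "\<exists>e0\<in>E'. u \<in> e0 \<and> e0 \<inter> Z = {}"
  proof (rule ccontr)
    assume "\<not> ?thesis"
    then have eq: "{e\<in>E'. u \<in> e} = {e\<in>E'. {u} \<subseteq> e \<and> e \<inter> Z \<noteq> {}}" by auto
    have "\<gamma> * n ^ (r - 1) \<le> card {e\<in>E'. {u} \<subseteq> e \<and> e \<inter> Z \<noteq> {}}" using deg[OF f(4)] eq by simp
    also have "\<dots> \<le> card Z * (n ^ r / n ^ Suc (card {u}))"
      unfolding n using Er' by (intro card_supersets_hitting_le fin V fZ uZ) auto
    also have "\<dots> \<le> (r + \<eta> * n) * (n ^ r / n ^ Suc (card {u}))"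
      using cZ n0 by (intro mult_right_mono) auto
    also have "\<dots> < (\<gamma> * n) * (n ^ r / n ^ Suc (card {u}))"
      using num n0 by (intro mult_strict_right_mono) auto
    also have "\<dots> = \<gamma> * n ^ (r - 1)"
      using n0 rk by (cases r) (auto simp: field_simps)
    finally show False by simp
  qed
  then obtain e0 where e0: "e0 \<in> E'" "u \<in> e0" "e0 \<inter> Z = {}" by auto
  have e0V: "e0 \<subseteq> V'" "card e0 = r" "finite e0" using Er'(1)[OF e0(1)] fV' finite_subset by auto
  have ve0: "v \<notin> e0" using e0(3) f by (auto simp: Z_def)
  have she0: "shadow E' x y" if "x \<in> e0" "y \<in> e0" "x \<noteq> y" for x y
    using that e0 by (auto simp: shadow_def)
  have inje0: "inj_on col e0"
    using proper she0 e0V by (meson inj_onI subsetD)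
  have vsh: "shadow E' v w" if w: "w \<in> e0" "w \<noteq> u" for w
  proof -
    have "col u \<noteq> col w" using proper[OF she0[OF e0(2) w(1)]] w e0V f by auto
    then show ?thesis using e0(3) w e0V same by (auto simp: Z_def Bad_def)
  qed
  \<comment> \<open>\<open>u\<close> and \<open>v\<close> share a colour, so these
    \<open>r + 1\<close> vertices use only \<open>r\<close> colours, and one vertex from each of the
    other \<open>k - r\<close> colours brings the total to \<open>Suc k\<close>.\<close>
  define Core where "Core = insert v e0"
  have Core: "Core \<subseteq> V'" "card Core = Suc r" "finite Core" using e0V f ve0 by (auto simp: Core_def)
  have colCore: "col ` Core = col ` e0"
    using same imageI[OF e0(2), of col] by (simp add: Core_def insert_absorb)
  have greedy: "\<exists>S\<subseteq>V'. card S = card D \<and> finite S \<and> col ` S \<subseteq> D \<and> S \<inter> f = {} \<and>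
     (\<forall>s\<in>S. \<forall>t\<in>S \<union> Core. s \<noteq> t \<longrightarrow> shadow E' s t)" if "finite D" "D \<subseteq> Q - col ` e0" for D
    using that
  proof (induction rule: finite_induct)
    case empty
    show ?case by (intro exI[of _ "{}"]) auto
  next
    case (insert q D)
    then obtain S where S: "S \<subseteq> V'" "card S = card D" "finite S" "col ` S \<subseteq> D" "S \<inter> f = {}"
      and Ssh: "\<And>s t. s \<in> S \<Longrightarrow> t \<in> S \<union> Core \<Longrightarrow> s \<noteq> t \<Longrightarrow> shadow E' s t" by auto
    define T where "T = S \<union> Core"
    have T: "T \<subseteq> V'" "finite T" using S Core by (auto simp: T_def)
    have "card (insert q D) \<le> card (Q - col ` e0)" using insert.prems Q by (intro card_mono) auto
    also have "\<dots> = k - r"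
      using Q e0V card_image[OF inje0] by (subst card_Diff_subset) auto
    finally have "card D \<le> k - r" using insert.hyps by simp
    then have "card T \<le> k + 1"
      using card_Un_le[of S Core] S Core rk by (simp add: T_def)
    then have cT: "real (card T) \<le> real k + 1" by linarith
    \<comment> \<open>A vertex of colour \<open>q\<close> outside \<open>X\<close> is adjacent to
      everything chosen so far and keeps \<open>f\<close> off the enlarged set. \<open>X\<close> is
      smaller than the class of \<open>q\<close>, so such a vertex exists.\<close>
    define X where "X = f \<union> (\<Union>t\<in>T. Bad t)"
    have fX: "finite X" using ff T Bad by (auto simp: X_def)
    have "card (\<Union>t\<in>T. Bad t) \<le> card T * (\<eta> * n)"
      using T Bad by (intro card_UN_le_mult) auto
    also have "\<dots> \<le> (real k + 1) * (\<eta> * n)" using cT num n0 by (intro mult_right_mono) auto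
    finally have "card X < (1 / k - \<eta>) * n"
      using card_Un_le[of f "\<Union>t\<in>T. Bad t"] ff num unfolding X_def by linarith
    also have "\<dots> \<le> card {v\<in>V'. col v = q}" using cls insert.prems by auto
    finally have "card X < card {v\<in>V'. col v = q}" by simp
    then have "\<not> {v\<in>V'. col v = q} \<subseteq> X" using card_mono[OF fX] by (meson not_le)
    then obtain s where s: "s \<in> V'" "col s = q" "s \<notin> X" by auto
    have colT: "col t \<noteq> q" if "t \<in> T" for t
    proof (cases "t \<in> S")
      case True then show ?thesis using S(4) insert.hyps by auto
    next
      case False
      then have "col t \<in> col ` e0" using that colCore by (auto simp: T_def)
      then show ?thesis using insert.prems by auto
    qed
    have sT: "shadow E' t s" "shadow E' s t" if "t \<in> T" for t
    proof -
      have "s \<notin> Bad t" using s that by (auto simp: X_def)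
      then show "shadow E' t s" using s colT[OF that] by (auto simp: Bad_def)
      then show "shadow E' s t" by (rule shadow_sym)
    qed
    have "s \<notin> S" using colT[of s] s by (auto simp: T_def)
    show ?case
    proof (intro exI[of _ "insert s S"] conjI ballI impI)
      show "card (insert s S) = card (insert q D)" using S insert.hyps \<open>s \<notin> S\<close> by simp
      show "insert s S \<inter> f = {}" using S s by (auto simp: X_def)
      show "shadow E' x t" if "x \<in> insert s S" "t \<in> insert s S \<union> Core" "x \<noteq> t" for x t
        using that sT Ssh by (auto simp: T_def)
    qed (use S s in auto)
  qed
  obtain S where S: "S \<subseteq> V'" "card S = card (Q - col ` e0)" "finite S" "col ` S \<subseteq> Q - col ` e0" "S \<inter> f = {}"
    and Ssh: "\<And>s t. s \<in> S \<Longrightarrow> t \<in> S \<union> Core \<Longrightarrow> s \<noteq> t \<Longrightarrow> shadow E' s t"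
    using greedy[of "Q - col ` e0"] Q by auto
  have cS: "card S = k - r" using Q e0V card_image[OF inje0] S(2) by (subst (asm) card_Diff_subset) auto
  have "S \<inter> Core = {}" using S(4) colCore by blast
  define K where "K = S \<union> Core"
  have cK: "card K = Suc k" using \<open>S \<inter> Core = {}\<close> S Core cS rk by (simp add: K_def card_Un_disjoint)
  have "\<not> hgraph_free (expanded_clique r (k + 1)) H"
  proof (rule expanded_clique_embedding[OF H rk _ cK _ _ _ _ f(6) _ M])
    show "K \<subseteq> hverts H" using S Core V' V by (auto simp: K_def)
    show "e0 \<in> hedges H" using Er'(2)[OF e0(1)] E by simp
    show "e0 \<subseteq> K" by (auto simp: K_def Core_def)
    show "f \<in> hedges H" using f E by simp
    show "f \<inter> K = {u, v}" using S(5) e0 f by (auto simp: K_def Core_def Z_def)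
    show "heavy M (hverts H) (hedges H) x y"
      if xy: "x \<in> K" "y \<in> K" "x \<noteq> y" "\<not> {x, y} \<subseteq> e0" "{x, y} \<noteq> {u, v}" for x y
    proof -
      have "shadow E' x y"
      proof (cases "x \<in> S \<or> y \<in> S")
        case True
        then show ?thesis using Ssh[of x y] Ssh[of y x] xy shadow_sym[of E'] by (auto simp: K_def)
      next
        case False
        then have "(x = v \<and> y \<in> e0 \<and> y \<noteq> u) \<or> (y = v \<and> x \<in> e0 \<and> x \<noteq> u)"
          using xy by (auto simp: K_def Core_def)
        then show ?thesis using vsh shadow_sym[of E'] by auto
      qed
      then show ?thesis using shadow_heavy_edges[of M V E V' x y] by (simp add: E' V E)
    qed
  qed
  then show False using free by simp
qed

section \<open>Degree stability in two passes\<close>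

lemma degree_diff_le:
  assumes fin: "finite E"
    and sub: "\<And>e. e \<in> E \<Longrightarrow> v \<in> e \<Longrightarrow> e \<notin> E' \<Longrightarrow> e \<in> B"
    and B: "finite B" and E': "E' \<subseteq> E"
  shows "real (card {e\<in>E. v \<in> e}) - card B \<le> card {e\<in>E'. v \<in> e}"
proof -
  have "{e\<in>E. v \<in> e} \<subseteq> {e\<in>E'. v \<in> e} \<union> B" using sub by auto
  then have "card {e\<in>E. v \<in> e} \<le> card ({e\<in>E'. v \<in> e} \<union> B)"
    using B finite_subset[OF E' fin] by (intro card_mono) auto
  also have "\<dots> \<le> card {e\<in>E'. v \<in> e} + card B" by (rule card_Un_le)
  finally show ?thesis by linarith
qed

lemma sum_degrees:
  assumes "finite V" "finite L" "\<And>e. e \<in> L \<Longrightarrow> e \<subseteq> V \<and> card e = r"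
  shows "(\<Sum>v\<in>V. card {e\<in>L. v \<in> e}) = r * card L"
proof (rule sum_multicount[OF assms(1,2)])
  show "\<forall>e\<in>L. card {v\<in>V. v \<in> e} = r"
  proof
    fix e assume "e \<in> L"
    then have "{v\<in>V. v \<in> e} = e" using assms(3) by auto
    then show "card {v\<in>V. v \<in> e} = r" using assms(3) \<open>e \<in> L\<close> by auto
  qed
qed

theorem degree_stability:
  fixes k r :: nat
  assumes rk: "2 \<le> r" "r \<le> k"
  obtains \<epsilon> :: real and n0 :: nat where "0 < \<epsilon>" and
    "\<And>H :: 'a hgraph. r_graph r H \<Longrightarrow> hgraph_free (expanded_clique r (k + 1)) H \<Longrightarrow>
       n0 \<le> card (hverts H) \<Longrightarrow>
       (\<And>v. v \<in> hverts H \<Longrightarrow> (turan_deg r k - \<epsilon>) * real (card (hverts H)) ^ (r - 1)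
           \<le> card {e\<in>hedges H. v \<in> e}) \<Longrightarrow>
       \<exists>Q (col :: 'a \<Rightarrow> 'a). finite Q \<and> card Q = k \<and> col ` hverts H \<subseteq> Q \<and> (\<forall>e\<in>hedges H. inj_on col e)"
proof -
  define c where "c = turan_deg r k"
  have c0: "0 < c" unfolding c_def using rk by (intro turan_deg_pos) auto
  have k2: "2 \<le> real k" using rk by auto
  \<comment> \<open>The constants are chosen backwards from the second pass: \<open>\<eta>2\<close>
    leaves room for \<open>near_partition_rainbow\<close>, \<open>\<epsilon>2\<close> is the degree
    loss tolerated in the second pass, and \<open>\<eta>1 \<le> \<epsilon>2 / 4\<close> because the
    partition error of the first pass turns into a degree loss in the second. \<open>M\<close> is
    what \<open>expanded_clique_embedding\<close> asks for.\<close>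
  define M where "M = Suc k + r * Suc (2 ^ Suc k)"
  define \<eta>2 where "\<eta>2 = min (c / 4) (1 / (2 * k * (real k + 2)))"
  have \<eta>2: "0 < \<eta>2" using c0 k2 by (simp add: \<eta>2_def)
  obtain \<epsilon>2 :: real where \<epsilon>2: "0 < \<epsilon>2" "\<epsilon>2 \<le> c / 2" and
    part2: "\<And>(V::'a set) V' E. dense_clique_free r k \<epsilon>2 V V' E \<Longrightarrow>
      \<exists>Q col. near_partition V' E k (\<eta>2 * card V) Q col
        \<and> (\<forall>q\<in>Q. (1 / k - \<eta>2) * card V \<le> card {v\<in>V'. col v = q})"
    by (rule min_degree_near_partition[OF rk \<eta>2, where 'a = 'a, folded c_def]) blast
  define \<eta>1 where "\<eta>1 = min \<eta>2 (\<epsilon>2 / 4)"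
  have \<eta>1: "0 < \<eta>1" "\<eta>1 \<le> \<eta>2" "\<eta>1 \<le> \<epsilon>2 / 4" using \<eta>2 \<epsilon>2 by (auto simp: \<eta>1_def)
  obtain \<epsilon>1 :: real where \<epsilon>1: "0 < \<epsilon>1" "\<epsilon>1 \<le> c / 2" and
    part1: "\<And>(V::'a set) V' E. dense_clique_free r k \<epsilon>1 V V' E \<Longrightarrow>
      \<exists>Q col. near_partition V' E k (\<eta>1 * card V) Q col
        \<and> (\<forall>q\<in>Q. (1 / k - \<eta>1) * card V \<le> card {v\<in>V'. col v = q})"
    by (rule min_degree_near_partition[OF rk \<eta>1(1), where 'a = 'a, folded c_def]) blast
  define \<epsilon> where "\<epsilon> = min (\<epsilon>1 / 2) (\<epsilon>2 / 4)"
  have \<epsilon>: "0 < \<epsilon>" "\<epsilon> \<le> \<epsilon>1 / 2" "\<epsilon> \<le> \<epsilon>2 / 4" using \<epsilon>1 \<epsilon>2 by (auto simp: \<epsilon>_def)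
  \<comment> \<open>The bound on \<open>card W\<close> obtained by double counting; it does not
    depend on \<open>n\<close>, so \<open>n0\<close> can make \<open>w / n\<close>
    negligible.\<close>
  define w where "w = 4 * r * M / \<epsilon>1"
  have w0: "0 \<le> w" using \<epsilon>1 by (simp add: w_def)
  define n0 where "n0 = Suc (nat \<lceil>4 * w / \<epsilon>1 + 4 * w / \<epsilon>2 + 4 * M / \<epsilon>2 + 4 * r / c + 2 * k * r\<rceil>)"
  show ?thesis
  proof (rule that[OF \<epsilon>(1)])
    fix H :: "'a hgraph"
    assume H: "r_graph r H" and free: "hgraph_free (expanded_clique r (k + 1)) H"
      and nn: "n0 \<le> card (hverts H)"
      and deg: "\<And>v. v \<in> hverts H \<Longrightarrow> (turan_deg r k - \<epsilon>) * real (card (hverts H)) ^ (r - 1)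
           \<le> card {e\<in>hedges H. v \<in> e}"
    define V where "V = hverts H"
    define E where "E = hedges H"
    define n where "n = real (card V)"
    have big: "4 * w / \<epsilon>1 + 4 * w / \<epsilon>2 + 4 * M / \<epsilon>2 + 4 * r / c + 2 * k * r < n"
    proof -
      have "real n0 \<le> n" using nn by (simp add: n_def V_def)
      then show ?thesis unfolding n0_def by linarith
    qed
    have nnn: "0 \<le> 4 * w / \<epsilon>1" "0 \<le> 4 * w / \<epsilon>2" "0 \<le> 4 * M / \<epsilon>2" "0 \<le> 4 * r / c" "0 \<le> real (2 * k * r)"
      using w0 \<epsilon>1 \<epsilon>2 c0 by auto
    have n0: "0 < n" using big nnn by linarith
    have b1: "w \<le> \<epsilon>1 / 4 * n" and b2: "w \<le> \<epsilon>2 / 4 * n" and b3: "M \<le> \<epsilon>2 / 4 * n"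
      and b4: "r < c / 4 * n" and b5: "2 * k * r < n"
    proof -
      have "4 * w / \<epsilon>1 < n" "4 * w / \<epsilon>2 < n" "4 * M / \<epsilon>2 < n" "4 * r / c < n" "2 * k * r < n"
        using big nnn by linarith+
      then show "w \<le> \<epsilon>1 / 4 * n" "w \<le> \<epsilon>2 / 4 * n" "M \<le> \<epsilon>2 / 4 * n" "r < c / 4 * n" "2 * k * r < n"
        using \<epsilon>1 \<epsilon>2 c0 by (auto simp: field_simps)
    qed
    have fin: "finite V" and Er: "\<And>e. e \<in> E \<Longrightarrow> e \<subseteq> V \<and> card e = r"
      using H by (auto simp: r_graph_def V_def E_def)
    have ne: "V \<noteq> {}" using n0 by (auto simp: n_def)
    have finE: "finite E" using Er fin by (intro finite_subset[of E "Pow V"]) auto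
    have pw: "n ^ r = n * n ^ (r - 1)" using rk by (cases r) auto
    have num: "r + \<eta> * n < (c / 2) * n" "r + (real k + 1) * (\<eta> * n) < (1 / k - \<eta>) * n"
      if \<eta>: "\<eta> \<le> \<eta>2" for \<eta>
    proof -
      have "\<eta> * n \<le> c / 4 * n" using \<eta> n0 by (intro mult_right_mono) (auto simp: \<eta>2_def)
      then show "r + \<eta> * n < (c / 2) * n" using b4 by linarith
      have "\<eta> \<le> 1 / (2 * k * (real k + 2))" using \<eta> by (auto simp: \<eta>2_def)
      then have "(real k + 2) * \<eta> \<le> (real k + 2) * (1 / (2 * k * (real k + 2)))"
        by (intro mult_left_mono) auto
      also have "\<dots> = 1 / (2 * k)" by simp
      finally have "(real k + 2) * \<eta> * n \<le> 1 / (2 * k) * n" using n0 by (intro mult_right_mono) auto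
      moreover have "r < n / (2 * k)" using b5 k2 by (simp add: field_simps)
      ultimately have "r + (real k + 2) * \<eta> * n < n / k" by (simp add: field_simps)
      then show "r + (real k + 1) * (\<eta> * n) < (1 / k - \<eta>) * n" by (simp add: algebra_simps)
    qed
    define L where "L = {e\<in>E. \<exists>u\<in>e. \<exists>v\<in>e. u \<noteq> v \<and> \<not> heavy M V E u v}"
    have codeg: "real (card {e\<in>E. {u, v} \<subseteq> e}) \<le> M * (n ^ r / n ^ 3)"
      if "u \<noteq> v" "\<not> heavy M V E u v" for u v
      unfolding n_def by (rule codegree_not_heavy_le[OF fin ne Er that])
    \<comment> \<open>At most \<open>n^2\<close> pairs are not heavy, and each lies in at most
      \<open>M * n^(r-3)\<close> edges. The degrees in \<open>L\<close> add up to
      \<open>r * card L\<close>, so only boundedly many vertices have such a degree of order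
      \<open>n^(r-1)\<close>; these form \<open>W\<close>.\<close>
    have cL: "card L \<le> M * n ^ (r - 1)"
    proof -
      define I where "I = {(u, v) \<in> V \<times> V. u \<noteq> v \<and> \<not> heavy M V E u v}"
      have fI: "finite I" using fin by (auto simp: I_def intro: finite_subset[of _ "V \<times> V"])
      have "card I \<le> card (V \<times> V)" using fin by (intro card_mono) (auto simp: I_def)
      then have cI: "real (card I) \<le> n * n" by (simp add: card_cartesian_product n_def flip: of_nat_mult)
      have LI: "L \<subseteq> (\<Union>p\<in>I. {e\<in>E. {fst p, snd p} \<subseteq> e})"
      proof
        fix e assume "e \<in> L"
        then obtain u v where uv: "e \<in> E" "u \<in> e" "v \<in> e" "u \<noteq> v" "\<not> heavy M V E u v" by (auto simp: L_def)
        then have "(u, v) \<in> I" using Er[of e] by (auto simp: I_def)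
        then show "e \<in> (\<Union>p\<in>I. {e\<in>E. {fst p, snd p} \<subseteq> e})" using uv by force
      qed
      have "real (card L) \<le> card (\<Union>p\<in>I. {e\<in>E. {fst p, snd p} \<subseteq> e})"
        unfolding of_nat_le_iff using fI finE by (intro card_mono LI) auto
      also have "\<dots> \<le> card I * (M * (n ^ r / n ^ 3))"
        using codeg by (intro card_UN_le_mult fI) (auto simp: I_def)
      also have "\<dots> \<le> (n * n) * (M * (n ^ r / n ^ 3))" using cI n0 by (intro mult_right_mono) auto
      also have "\<dots> = M * n ^ (r - 1)" using n0 by (simp add: pw power3_eq_cube)
      finally show ?thesis .
    qed
    define W where "W = {v\<in>V. \<epsilon>1 / 4 * n ^ (r - 1) < card {e\<in>L. v \<in> e}}"
    have fW: "finite W" "W \<subseteq> V" using fin by (auto simp: W_def)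
    have finL: "finite L" using finE by (auto simp: L_def)
    have cW: "card W \<le> w"
    proof -
      have "card W * (\<epsilon>1 / 4 * n ^ (r - 1)) = (\<Sum>v\<in>W. \<epsilon>1 / 4 * n ^ (r - 1))" by simp
      also have "\<dots> \<le> (\<Sum>v\<in>W. real (card {e\<in>L. v \<in> e}))" by (intro sum_mono) (auto simp: W_def)
      also have "\<dots> \<le> (\<Sum>v\<in>V. real (card {e\<in>L. v \<in> e}))" using fW fin by (intro sum_mono2) auto
      also have "\<dots> = real (\<Sum>v\<in>V. card {e\<in>L. v \<in> e})" by simp
      also have "\<dots> = real (r * card L)"
        using Er by (subst sum_degrees[OF fin finL]) (auto simp: L_def)
      also have "\<dots> \<le> r * (M * n ^ (r - 1))" using mult_left_mono[OF cL, of "real r"] by simp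
      finally have "(card W * (\<epsilon>1 / 4)) * n ^ (r - 1) \<le> (real r * M) * n ^ (r - 1)"
        by (simp add: mult.assoc)
      then have "card W * (\<epsilon>1 / 4) \<le> real r * M" using n0 by (simp add: mult_le_cancel_right)
      then show ?thesis using \<epsilon>1 by (simp add: w_def field_simps)
    qed
    have hitW: "real (card {e\<in>E. {v} \<subseteq> e \<and> e \<inter> (W - {v}) \<noteq> {}}) \<le> (w / n) * n ^ (r - 1)" for v
    proof -
      have "real (card {e\<in>E. {v} \<subseteq> e \<and> e \<inter> (W - {v}) \<noteq> {}}) \<le> card (W - {v}) * (n ^ r / n ^ Suc (card {v}))"
        unfolding n_def by (rule card_supersets_hitting_le[OF fin ne Er]) (use fW in auto)
      also have "\<dots> \<le> w * (n ^ r / n ^ Suc (card {v}))"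
      proof (rule mult_right_mono)
        have "card (W - {v}) \<le> card W" using fW by (intro card_mono) auto
        then show "real (card (W - {v})) \<le> w" using cW by linarith
      qed (use n0 in auto)
      also have "\<dots> = (w / n) * n ^ (r - 1)" using n0 by (simp add: pw)
      finally show ?thesis .
    qed
    have nocl: False if "K \<subseteq> V" "card K = Suc k"
      "\<And>u v. u \<in> K \<Longrightarrow> v \<in> K \<Longrightarrow> u \<noteq> v \<Longrightarrow> shadow (heavy_edges M V E V') u v"
      "e \<in> heavy_edges M V E V'" "e \<subseteq> K" for K e V'
    proof -
      have "\<not> hgraph_free (expanded_clique r (k + 1)) H"
      proof (rule heavy_clique_embedding[OF H rk _ that(2) _ that(5)])
        show "heavy M (hverts H) (hedges H) u v" if "u \<in> K" "v \<in> K" "u \<noteq> v" for u v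
          using shadow_heavy_edges[OF \<open>\<And>u v. u \<in> K \<Longrightarrow> v \<in> K \<Longrightarrow> u \<noteq> v \<Longrightarrow> shadow (heavy_edges M V E V') u v\<close>[OF that]]
          by (simp add: V_def E_def)
      qed (use that in \<open>auto simp: V_def E_def heavy_edges_def M_def\<close>)
      then show False using free by simp
    qed
    define V' where "V' = V - W"
    define E' where "E' = heavy_edges M V E V'"
    have E'E: "E' \<subseteq> E" by (auto simp: E'_def heavy_edges_def)
    have deg': "(c - \<epsilon>1) * n ^ (r - 1) \<le> card {e\<in>E'. v \<in> e}" if v: "v \<in> V'" for v
    proof -
      let ?B = "{e\<in>L. v \<in> e} \<union> {e\<in>E. {v} \<subseteq> e \<and> e \<inter> (W - {v}) \<noteq> {}}"
      have "card ?B \<le> card {e\<in>L. v \<in> e} + card {e\<in>E. {v} \<subseteq> e \<and> e \<inter> (W - {v}) \<noteq> {}}"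
        by (rule card_Un_le)
      then have "card ?B \<le> \<epsilon>1 / 4 * n ^ (r - 1) + (w / n) * n ^ (r - 1)"
        using hitW[of v] v by (auto simp: V'_def W_def)
      also have "w / n \<le> \<epsilon>1 / 4" using b1 n0 by (simp add: field_simps)
      then have "\<epsilon>1 / 4 * n ^ (r - 1) + (w / n) * n ^ (r - 1) \<le> \<epsilon>1 / 4 * n ^ (r - 1) + \<epsilon>1 / 4 * n ^ (r - 1)"
        using n0 by (intro add_mono mult_right_mono) auto
      finally have B: "card ?B \<le> \<epsilon>1 / 2 * n ^ (r - 1)" by simp
      have "real (card {e\<in>E. v \<in> e}) - card ?B \<le> card {e\<in>E'. v \<in> e}"
      proof (rule degree_diff_le[OF finE _ _ E'E])
        fix e assume e: "e \<in> E" "v \<in> e" "e \<notin> E'"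
        then have "\<not> e \<subseteq> V' \<or> e \<in> L" by (auto simp: E'_def heavy_edges_def L_def)
        then show "e \<in> ?B" using e Er[of e] v by (auto simp: V'_def)
      qed (use finE finL in auto)
      moreover have "(c - \<epsilon>) * n ^ (r - 1) \<le> card {e\<in>E. v \<in> e}"
        using deg[of v] v by (auto simp: V'_def V_def E_def n_def c_def)
      moreover have "\<epsilon> * n ^ (r - 1) \<le> \<epsilon>1 / 2 * n ^ (r - 1)" using \<epsilon> n0 by (intro mult_right_mono) auto
      ultimately show ?thesis using B by (simp add: left_diff_distrib)
    qed
    have VV': "V' \<subseteq> V" "V - V' = W" using fW by (auto simp: V'_def)
    have "\<exists>Q col. near_partition V' E' k (\<eta>1 * card V) Q col
        \<and> (\<forall>q\<in>Q. (1 / k - \<eta>1) * card V \<le> card {v\<in>V'. col v = q})"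
    proof (rule part1, unfold dense_clique_free_def, intro conjI ballI allI impI notI fin ne VV'(1))
      have "\<epsilon>1 / 4 * n \<le> \<epsilon>1 * n" using \<epsilon>1 n0 by (intro mult_right_mono) auto
      then show "card (V - V') \<le> \<epsilon>1 * card V" using cW b1 VV'(2) by (simp add: n_def)
      show "e \<subseteq> V'" "card e = r" if "e \<in> E'" for e using that Er by (auto simp: E'_def heavy_edges_def)
      show "(turan_deg r k - \<epsilon>1) * real (card V) ^ (r - 1) \<le> card {e\<in>E'. v \<in> e}" if "v \<in> V'" for v
        using deg'[OF that] by (simp add: n_def c_def)
      show False if "K \<subseteq> V'" "card K = Suc k" "\<forall>u\<in>K. \<forall>v\<in>K. u \<noteq> v \<longrightarrow> shadow E' u v"
        "e \<in> E'" "e \<subseteq> K" for K e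
        using nocl[of K V' e] that subset_trans[OF that(1) VV'(1)] by (auto simp: E'_def)
    qed (use ne in auto)
    then obtain Q1 col1 where np1: "near_partition V' E' k (\<eta>1 * n) Q1 col1"
      and cls1: "\<And>q. q \<in> Q1 \<Longrightarrow> (1 / k - \<eta>1) * n \<le> card {v\<in>V'. col1 v = q}"
      unfolding n_def by auto
    have half: "(c / 2) * n ^ (r - 1) \<le> (c - x) * n ^ (r - 1)" if "x \<le> c / 2" for x
      using that n0 by (intro mult_right_mono) auto
    have rainbow1: "col1 u \<noteq> col1 v" if "f \<in> E" "u \<in> f" "v \<in> f" "u \<in> V'" "v \<in> V'" "u \<noteq> v" for f u v
    proof (rule near_partition_rainbow[OF H rk free V_def ne E_def n_def VV'(1) E'_def _ np1 cls1])
      show "c / 2 * n ^ (r - 1) \<le> card {e\<in>E'. v \<in> e}" if "v \<in> V'" for v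
        using deg'[OF that] half[OF \<epsilon>1(2)] by linarith
    qed (use that num[OF \<eta>1(2)] \<eta>1 in \<open>auto simp: M_def\<close>)
    define E2 where "E2 = heavy_edges M V E V"
    have E2E: "E2 \<subseteq> E" by (auto simp: E2_def heavy_edges_def)
    define Bad where "Bad = (\<lambda>u. {v\<in>V'. col1 v \<noteq> col1 u \<and> \<not> shadow E' u v})"
    have cBad: "card (Bad u) \<le> \<eta>1 * n" "finite (Bad u)" if "u \<in> V'" for u
      using np1 that fin VV'(1) by (auto simp: near_partition_def Bad_def intro: finite_subset)
    \<comment> \<open>Now the vertices of \<open>W\<close> are included. An edge at \<open>x\<close>
      outside \<open>E2\<close> has a pair that is not heavy. Either \<open>x\<close> is in the pair
      (\<open>B1\<close>), or the edge meets \<open>W\<close> outside \<open>x\<close>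
      (\<open>B2\<close>), or both vertices of the pair lie in \<open>V'\<close>. In the last case
      the first pass gives them different colours, so one belongs to the small set
      \<open>Bad\<close> of the other (\<open>B3\<close>). Each of the three groups, and
      \<open>\<epsilon>\<close>, costs at most a quarter of \<open>\<epsilon>2\<close>.\<close>
    have deg2: "(c - \<epsilon>2) * n ^ (r - 1) \<le> card {e\<in>E2. x \<in> e}" if x: "x \<in> V" for x
    proof -
      define B1 where "B1 = (\<Union>u\<in>{u\<in>V. u \<noteq> x \<and> \<not> heavy M V E x u}. {e\<in>E. {x, u} \<subseteq> e})"
      define B2 where "B2 = {e\<in>E. {x} \<subseteq> e \<and> e \<inter> (W - {x}) \<noteq> {}}"
      define B3 where "B3 = (\<Union>u\<in>V' - {x}. {e\<in>E. {x, u} \<subseteq> e \<and> e \<inter> (Bad u - {x, u}) \<noteq> {}})"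
      have f123: "finite B1" "finite B2" "finite B3" using fin finE by (auto simp: B1_def B2_def B3_def V'_def)
      have "card B1 \<le> card {u\<in>V. u \<noteq> x \<and> \<not> heavy M V E x u} * (M * (n ^ r / n ^ 3))"
        unfolding B1_def using codeg fin by (intro card_UN_le_mult) auto
      also have "\<dots> \<le> n * (M * (n ^ r / n ^ 3))"
        unfolding n_def using fin by (intro mult_right_mono) (auto intro: card_mono)
      also have "\<dots> = M / n * n ^ (r - 1)" using n0 by (simp add: pw power3_eq_cube)
      also have "\<dots> \<le> \<epsilon>2 / 4 * n ^ (r - 1)"
        using b3 n0 by (intro mult_right_mono) (auto simp: field_simps)
      finally have c1: "card B1 \<le> \<epsilon>2 / 4 * n ^ (r - 1)" .
      have "card B2 \<le> w / n * n ^ (r - 1)" unfolding B2_def by (rule hitW)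
      also have "\<dots> \<le> \<epsilon>2 / 4 * n ^ (r - 1)"
        using b2 n0 by (intro mult_right_mono) (auto simp: field_simps)
      finally have c2: "card B2 \<le> \<epsilon>2 / 4 * n ^ (r - 1)" .
      have "card B3 \<le> card (V' - {x}) * ((\<eta>1 * n) * (n ^ r / n ^ 3))"
        unfolding B3_def
      proof (rule card_UN_le_mult)
        fix u assume u: "u \<in> V' - {x}"
        have c3: "Suc (card {x, u}) = 3" using u by auto
        have "real (card {e\<in>E. {x, u} \<subseteq> e \<and> e \<inter> (Bad u - {x, u}) \<noteq> {}})
            \<le> card (Bad u - {x, u}) * (n ^ r / n ^ Suc (card {x, u}))"
          unfolding n_def using u cBad by (intro card_supersets_hitting_le[OF fin ne Er]) auto
        also have "\<dots> \<le> (\<eta>1 * n) * (n ^ r / n ^ Suc (card {x, u}))"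
        proof (rule mult_right_mono)
          have "card (Bad u - {x, u}) \<le> card (Bad u)" using cBad u by (intro card_mono) auto
          then show "real (card (Bad u - {x, u})) \<le> \<eta>1 * n" using cBad(1)[of u] u by auto
        qed (use n0 in auto)
        finally show "real (card {e\<in>E. {x, u} \<subseteq> e \<and> e \<inter> (Bad u - {x, u}) \<noteq> {}}) \<le> (\<eta>1 * n) * (n ^ r / n ^ 3)"
          unfolding c3 .
      qed (use fin in \<open>auto simp: V'_def\<close>)
      also have "\<dots> \<le> n * ((\<eta>1 * n) * (n ^ r / n ^ 3))"
      proof (rule mult_right_mono)
        have "card (V' - {x}) \<le> card V" using fin VV' by (intro card_mono) auto
        then show "real (card (V' - {x})) \<le> n" by (simp add: n_def)
      qed (use n0 \<eta>1 in auto)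
      also have "\<dots> = \<eta>1 * n ^ (r - 1)" using n0 by (simp add: pw power3_eq_cube)
      also have "\<dots> \<le> \<epsilon>2 / 4 * n ^ (r - 1)" using \<eta>1 n0 by (intro mult_right_mono) auto
      finally have c3: "card B3 \<le> \<epsilon>2 / 4 * n ^ (r - 1)" .
      have "card (B1 \<union> B2 \<union> B3) \<le> card B1 + card B2 + card B3"
        using card_Un_le[of "B1 \<union> B2" B3] card_Un_le[of B1 B2] by linarith
      then have cB: "card (B1 \<union> B2 \<union> B3) \<le> 3 * (\<epsilon>2 / 4 * n ^ (r - 1))" using c1 c2 c3 by linarith
      have "real (card {e\<in>E. x \<in> e}) - card (B1 \<union> B2 \<union> B3) \<le> card {e\<in>E2. x \<in> e}"
      proof (rule degree_diff_le[OF finE _ _ E2E])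
        fix e assume e: "e \<in> E" "x \<in> e" "e \<notin> E2"
        then obtain u v where uv: "u \<in> e" "v \<in> e" "u \<noteq> v" "\<not> heavy M V E u v"
          using Er[of e] by (auto simp: E2_def heavy_edges_def)
        have uvV: "u \<in> V" "v \<in> V" using uv e Er[of e] by auto
        show "e \<in> B1 \<union> B2 \<union> B3"
        proof (rule ccontr)
          assume notB: "e \<notin> B1 \<union> B2 \<union> B3"
          have ux: "u \<noteq> x"
          proof
            assume "u = x"
            then have "e \<in> B1" using uv e uvV by (auto simp: B1_def)
            then show False using notB by simp
          qed
          have vx: "v \<noteq> x"
          proof
            assume "v = x"
            then have "\<not> heavy M V E x u" using uv heavy_sym[of M V E] by blast
            then have "e \<in> B1" using uv e uvV \<open>v = x\<close> by (auto simp: B1_def)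
            then show False using notB by simp
          qed
          have "u \<notin> W" "v \<notin> W" using notB uv e ux vx by (auto simp: B2_def)
          then have uvV': "u \<in> V'" "v \<in> V'" using uvV by (auto simp: V'_def)
          have "col1 v \<noteq> col1 u" using rainbow1[OF e(1) uv(1,2) uvV' uv(3)] by simp
          moreover have "\<not> shadow E' u v" using uv(4) shadow_heavy_edges[of M V E V' u v] by (auto simp: E'_def)
          ultimately have "v \<in> Bad u" using uvV' by (simp add: Bad_def)
          then have "e \<in> B3" using e uv ux vx uvV' by (auto simp: B3_def)
          then show False using notB by simp
        qed
      qed (use f123 in auto)
      moreover have "(c - \<epsilon>) * n ^ (r - 1) \<le> card {e\<in>E. x \<in> e}"
        using deg[of x] x by (auto simp: V_def E_def n_def c_def)
      moreover have "\<epsilon> * n ^ (r - 1) \<le> \<epsilon>2 / 4 * n ^ (r - 1)" using \<epsilon> n0 by (intro mult_right_mono) auto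
      ultimately show ?thesis using cB by (simp add: left_diff_distrib)
    qed
    have "\<exists>Q col. near_partition V E2 k (\<eta>2 * card V) Q col
        \<and> (\<forall>q\<in>Q. (1 / k - \<eta>2) * card V \<le> card {v\<in>V. col v = q})"
    proof (rule part2, unfold dense_clique_free_def, intro conjI ballI allI impI notI fin ne subset_refl)
      show "card (V - V) \<le> \<epsilon>2 * card V" using \<epsilon>2 by simp
      show "e \<subseteq> V" "card e = r" if "e \<in> E2" for e using that Er by (auto simp: E2_def heavy_edges_def)
      show "(turan_deg r k - \<epsilon>2) * real (card V) ^ (r - 1) \<le> card {e\<in>E2. v \<in> e}" if "v \<in> V" for v
        using deg2[OF that] by (simp add: n_def c_def)
      show False if "K \<subseteq> V" "card K = Suc k" "\<forall>u\<in>K. \<forall>v\<in>K. u \<noteq> v \<longrightarrow> shadow E2 u v"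
        "e \<in> E2" "e \<subseteq> K" for K e
        using nocl[of K V e] that by (auto simp: E2_def)
    qed (use ne in auto)
    then obtain Q col where np: "near_partition V E2 k (\<eta>2 * n) Q col"
      and cls: "\<And>q. q \<in> Q \<Longrightarrow> (1 / k - \<eta>2) * n \<le> card {v\<in>V. col v = q}"
      unfolding n_def by auto
    have rainbow: "col u \<noteq> col v" if "f \<in> E" "u \<in> f" "v \<in> f" "u \<in> V" "v \<in> V" "u \<noteq> v" for f u v
    proof (rule near_partition_rainbow[OF H rk free V_def ne E_def n_def subset_refl E2_def _ np cls])
      show "c / 2 * n ^ (r - 1) \<le> card {e\<in>E2. v \<in> e}" if "v \<in> V" for v
        using deg2[OF that] half[OF \<epsilon>2(2)] by linarith
    qed (use that num[OF order.refl] \<eta>2 in \<open>auto simp: M_def\<close>)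
    have "inj_on col e" if e: "e \<in> E" for e
    proof (rule inj_onI)
      fix u v assume "u \<in> e" "v \<in> e" "col u = col v"
      then show "u = v" using rainbow[OF e, of u v] Er[OF e] by auto
    qed
    then show "\<exists>Q (col :: 'a \<Rightarrow> 'a). finite Q \<and> card Q = k \<and> col ` hverts H \<subseteq> Q \<and> (\<forall>e\<in>hedges H. inj_on col e)"
      using np by (intro exI[of _ Q] exI[of _ col]) (auto simp: near_partition_def V_def E_def)
  qed
qed

section \<open>Optimal part sizes\<close>

text \<open>Weighted AM-GM for \<open>1\<close> and \<open>z\<close>: the bound
  \<open>ln t \<le> t - 1\<close> is used at \<open>1 / m\<close> and \<open>z / m\<close> with
  \<open>m\<close> the weighted mean, and the right-hand sides cancel. Strictness comes from
  \<open>m \<noteq> 1\<close>; it is the source of the uniqueness of balanced part sizes.\<close>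

lemma young_powr:
  fixes q z :: real
  assumes q: "0 < q" "q < 1" and z: "0 \<le> z"
  shows "z powr q \<le> 1 - q + q * z" and "z \<noteq> 1 \<Longrightarrow> z powr q < 1 - q + q * z"
proof -
  have strict: "z powr q < 1 - q + q * z" if z1: "z \<noteq> 1"
  proof (cases "z = 0")
    case False
    then have z0: "0 < z" using z by simp
    define m where "m = 1 - q + q * z"
    have m0: "0 < m" unfolding m_def using q z0 by (intro add_pos_pos) auto
    have m1: "m \<noteq> 1" using z1 q by (auto simp: m_def algebra_simps)
    have a: "ln (1 / m) < 1 / m - 1"
      using ln_le_minus_one[of "1 / m"] ln_eq_minus_one[of "1 / m"] m0 m1 by force
    have b: "ln (z / m) \<le> z / m - 1" using ln_le_minus_one[of "z / m"] m0 z0 by simp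
    have "(1 - q) * ln (1 / m) + q * ln (z / m) < (1 - q) * (1 / m - 1) + q * (z / m - 1)"
      using a b q by (intro add_less_le_mono mult_strict_left_mono mult_left_mono) auto
    also have "\<dots> = (1 - q + q * z) / m - 1" by (simp add: diff_divide_distrib add_divide_distrib algebra_simps)
    also have "\<dots> = 0" using m0 by (simp add: m_def[symmetric])
    also have "(1 - q) * ln (1 / m) + q * ln (z / m) = q * ln z - ln m"
      using m0 z0 by (simp add: ln_div algebra_simps)
    finally have "exp (q * ln z) < exp (ln m)" unfolding exp_less_cancel_iff by simp
    then have "exp (q * ln z) < m" using m0 by simp
    then show ?thesis using z0 by (simp add: powr_def m_def)
  qed (use q in auto)
  show "z powr q \<le> 1 - q + q * z" using strict by (cases "z = 1") auto
  show "z powr q < 1 - q + q * z" if "z \<noteq> 1" using strict that .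
qed

text \<open>\<open>young_powr\<close> is applied to the numbers \<open>n / S * x v powr p\<close>,
  whose mean is one, so its bounds add up to exactly \<open>n\<close>.\<close>

lemma sum_le_power_mean:
  fixes x :: "'a \<Rightarrow> real"
  assumes fin: "finite V" and p: "1 < p" and x: "\<And>v. v \<in> V \<Longrightarrow> 0 \<le> x v"
  shows "sum x V \<le> card V powr (1 - 1 / p) * (\<Sum>v\<in>V. x v powr p) powr (1 / p)"
proof (cases "(\<Sum>v\<in>V. x v powr p) = 0")
  case True
  then have "\<forall>v\<in>V. x v powr p = 0" using fin by (subst (asm) sum_nonneg_eq_0_iff) auto
  then have "sum x V = 0" by (intro sum.neutral) auto
  then show ?thesis by simp
next
  case False
  define S where "S = (\<Sum>v\<in>V. x v powr p)"
  have S: "0 < S" using False sum_nonneg[of V "\<lambda>v. x v powr p"] by (simp add: S_def)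
  define n where "n = real (card V)"
  have "V \<noteq> {}" using False by auto
  then have n: "0 < n" using fin by (simp add: n_def card_gt_0_iff)
  have "(n / S) powr (1 / p) * x v \<le> 1 - 1 / p + 1 / p * (n / S * x v powr p)" if v: "v \<in> V" for v
  proof -
    have "(n / S * x v powr p) powr (1 / p) = (n / S) powr (1 / p) * (x v powr p) powr (1 / p)"
      by (rule powr_mult)
    also have "(x v powr p) powr (1 / p) = x v" using x[OF v] p by (simp add: powr_powr)
    finally have "(n / S * x v powr p) powr (1 / p) = (n / S) powr (1 / p) * x v" .
    then show ?thesis using young_powr(1)[of "1 / p" "n / S * x v powr p"] p n S by simp
  qed
  then have "(\<Sum>v\<in>V. (n / S) powr (1 / p) * x v) \<le> (\<Sum>v\<in>V. 1 - 1 / p + 1 / p * (n / S * x v powr p))"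
    by (rule sum_mono)
  also have "\<dots> = n * (1 - 1 / p) + 1 / p * (n / S * S)"
    by (simp add: sum.distrib sum_distrib_left[symmetric] sum_divide_distrib[symmetric] S_def n_def)
  also have "\<dots> = n" using S by (simp add: algebra_simps)
  finally have "(n / S) powr (1 / p) * sum x V \<le> n" by (simp add: sum_distrib_left)
  then have "sum x V \<le> n / (n / S) powr (1 / p)"
    using n S by (simp add: pos_le_divide_eq mult.commute)
  also have "\<dots> = n powr (1 - 1 / p) * S powr (1 / p)"
    using n S by (simp add: powr_divide powr_diff)
  finally show ?thesis by (simp add: n_def S_def)
qed

text \<open>The largest possible sum of \<open>n\<close> nonnegative numbers whose \<open>p\<close>-th powers add up to \<open>Y\<close>.\<close>

definition part_sum :: "real \<Rightarrow> real \<Rightarrow> real \<Rightarrow> real" where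
  "part_sum p n Y = n powr (1 - 1 / p) * Y powr (1 / p)"

lemma part_sum_nonneg: "0 \<le> part_sum p n Y"
  by (simp add: part_sum_def)

lemma part_sum_scale:
  assumes "1 < p" "0 \<le> t" "0 \<le> n" "0 \<le> Y"
  shows "part_sum p (t * n) (t * Y) = t * part_sum p n Y"
proof -
  have "t powr (1 - 1 / p) * t powr (1 / p) = t" using assms by (cases "t = 0") (auto simp: powr_add[symmetric])
  then show ?thesis using assms by (simp add: part_sum_def powr_mult mult_ac)
qed

text \<open>Superadditivity is concavity for a function homogeneous of degree one. After division by
  the totals, each summand is at most a weighted mean of \<open>n1 / N\<close> and
  \<open>Y1 / Y\<close>, respectively of \<open>n2 / N\<close> and \<open>Y2 / Y\<close>, and these
  two means add up to one. The condition for strictness is non-proportionality, written without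
  division.\<close>

lemma part_sum_superadditive:
  assumes p: "1 < p" and nn: "0 \<le> n1" "0 \<le> n2" "0 \<le> Y1" "0 \<le> Y2"
  shows "part_sum p n1 Y1 + part_sum p n2 Y2 \<le> part_sum p (n1 + n2) (Y1 + Y2)"
    and "n1 * Y2 \<noteq> n2 * Y1 \<Longrightarrow> part_sum p n1 Y1 + part_sum p n2 Y2 < part_sum p (n1 + n2) (Y1 + Y2)"
proof -
  define q where "q = 1 / p"
  have q: "0 < q" "q < 1" using p by (auto simp: q_def)
  have young2: "u powr (1 - q) * w powr q \<le> (1 - q) * u + q * w"
    "u \<noteq> w \<Longrightarrow> u powr (1 - q) * w powr q < (1 - q) * u + q * w" if "0 \<le> u" "0 \<le> w" for u w :: real
  proof -
    have "u = 0 \<or> 0 < u" using that by linarith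
    then have "u powr (1 - q) * w powr q \<le> (1 - q) * u + q * w \<and>
      (u \<noteq> w \<longrightarrow> u powr (1 - q) * w powr q < (1 - q) * u + q * w)"
    proof
      assume "u = 0" then show ?thesis using q that by auto
    next
      assume 2: "0 < u"
      have eq: "u powr (1 - q) * w powr q = u * (w / u) powr q"
        using 2 that by (simp add: powr_diff powr_divide)
      have eq2: "(1 - q) * u + q * w = u * (1 - q + q * (w / u))" using 2 by (simp add: field_simps)
      have wu: "0 \<le> w / u" using that by simp
      have "u * (w / u) powr q \<le> u * (1 - q + q * (w / u))"
        using young_powr(1)[OF q wu] 2 by (intro mult_left_mono) auto
      moreover have "u * (w / u) powr q < u * (1 - q + q * (w / u))" if "u \<noteq> w"
        using young_powr(2)[OF q wu] 2 that by (intro mult_strict_left_mono) auto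
      ultimately show ?thesis unfolding eq eq2 by blast
    qed
    then show "u powr (1 - q) * w powr q \<le> (1 - q) * u + q * w"
      "u \<noteq> w \<Longrightarrow> u powr (1 - q) * w powr q < (1 - q) * u + q * w" by auto
  qed
  define N where "N = n1 + n2"
  define Y where "Y = Y1 + Y2"
  have "part_sum p n1 Y1 + part_sum p n2 Y2 \<le> part_sum p N Y \<and>
    (n1 * Y2 \<noteq> n2 * Y1 \<longrightarrow> part_sum p n1 Y1 + part_sum p n2 Y2 < part_sum p N Y)"
  proof (cases "N = 0 \<or> Y = 0")
    case True
    then show ?thesis
    proof
      assume "N = 0"
      then have "n1 = 0" "n2 = 0" using nn by (auto simp: N_def)
      then show ?thesis by (simp add: part_sum_def N_def)
    next
      assume "Y = 0"
      then have "Y1 = 0" "Y2 = 0" using nn by (auto simp: Y_def)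
      then show ?thesis by (simp add: part_sum_def Y_def)
    qed
  next
    case False
    then have N: "0 < N" and Y: "0 < Y" using nn by (auto simp: N_def Y_def)
    define C where "C = part_sum p N Y"
    have C: "0 < C" using N Y by (simp add: C_def part_sum_def)
    have eq: "part_sum p m Z = C * ((m / N) powr (1 - q) * (Z / Y) powr q)" if "0 \<le> m" "0 \<le> Z" for m Z
      using N Y that by (simp add: part_sum_def C_def q_def powr_divide)
    have sum1: "(1 - q) * (n1 / N) + q * (Y1 / Y) + ((1 - q) * (n2 / N) + q * (Y2 / Y)) = 1"
    proof -
      have "n1 / N + n2 / N = 1" "Y1 / Y + Y2 / Y = 1" using N Y unfolding add_divide_distrib[symmetric] by (auto simp: N_def Y_def)
      then have "(1 - q) * (n1 / N + n2 / N) + q * (Y1 / Y + Y2 / Y) = 1" by simp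
      then show ?thesis by (simp add: algebra_simps)
    qed
    have le1: "(n1 / N) powr (1 - q) * (Y1 / Y) powr q \<le> (1 - q) * (n1 / N) + q * (Y1 / Y)"
      and le2: "(n2 / N) powr (1 - q) * (Y2 / Y) powr q \<le> (1 - q) * (n2 / N) + q * (Y2 / Y)"
      using nn N Y by (intro young2(1); simp)+
    have "C * ((n1 / N) powr (1 - q) * (Y1 / Y) powr q + (n2 / N) powr (1 - q) * (Y2 / Y) powr q) \<le> C * 1"
      using le1 le2 sum1 C by (intro mult_left_mono) auto
    moreover have "C * ((n1 / N) powr (1 - q) * (Y1 / Y) powr q + (n2 / N) powr (1 - q) * (Y2 / Y) powr q) < C * 1"
      if ne: "n1 * Y2 \<noteq> n2 * Y1"
    proof -
      have "n1 / N \<noteq> Y1 / Y"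
      proof
        assume "n1 / N = Y1 / Y"
        then have "n1 * Y = Y1 * N" using N Y by (simp add: frac_eq_eq)
        then show False using ne by (simp add: N_def Y_def algebra_simps)
      qed
      then have "(n1 / N) powr (1 - q) * (Y1 / Y) powr q < (1 - q) * (n1 / N) + q * (Y1 / Y)"
        using nn N Y by (intro young2(2)) auto
      then show ?thesis using le2 sum1 C by (intro mult_strict_left_mono) auto
    qed
    ultimately show ?thesis
      unfolding eq[OF nn(1,3)] eq[OF nn(2,4)] C_def[symmetric] by (auto simp: distrib_left)
  qed
  then show "part_sum p n1 Y1 + part_sum p n2 Y2 \<le> part_sum p (n1 + n2) (Y1 + Y2)"
    "n1 * Y2 \<noteq> n2 * Y1 \<Longrightarrow> part_sum p n1 Y1 + part_sum p n2 Y2 < part_sum p (n1 + n2) (Y1 + Y2)"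
    by (auto simp: N_def Y_def)
qed

text \<open>Replacing \<open>(na, Ya)\<close> and \<open>(nb, Yb)\<close> by two convex combinations whose first
  coordinates are \<open>na - 1\<close> and \<open>nb + 1\<close>; concavity of \<open>part_sum\<close> does the rest.\<close>

lemma part_sum_mix:
  fixes na nb Ya Yb :: real
  assumes p: "1 < p" and n: "0 \<le> nb" "nb + 2 \<le> na" and Y: "0 \<le> Ya" "0 \<le> Yb"
  obtains Ya' Yb' where "0 \<le> Ya'" "0 \<le> Yb'" "Ya' + Yb' = Ya + Yb"
    "part_sum p na Ya + part_sum p nb Yb \<le> part_sum p (na - 1) Ya' + part_sum p (nb + 1) Yb'"
    "part_sum p na Ya * part_sum p nb Yb \<le> part_sum p (na - 1) Ya' * part_sum p (nb + 1) Yb'"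
    "0 < part_sum p na Ya \<Longrightarrow>
      part_sum p na Ya * part_sum p nb Yb < part_sum p (na - 1) Ya' * part_sum p (nb + 1) Yb'"
proof -
  define \<tau> where "\<tau> = 1 / (na - nb)"
  have \<tau>: "0 < \<tau>" "\<tau> < 1" using n by (auto simp: \<tau>_def field_simps)
  define s where "s = part_sum p na Ya"
  define t where "t = part_sum p nb Yb"
  have st: "0 \<le> s" "0 \<le> t" by (simp_all add: s_def t_def part_sum_nonneg)
  define Ya' where "Ya' = (1 - \<tau>) * Ya + \<tau> * Yb"
  define Yb' where "Yb' = \<tau> * Ya + (1 - \<tau>) * Yb"
  define s' where "s' = part_sum p (na - 1) Ya'"
  define t' where "t' = part_sum p (nb + 1) Yb'"
  have \<tau>n: "\<tau> * (na - nb) = 1" using n by (simp add: \<tau>_def)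
  have ea: "na - 1 = (1 - \<tau>) * na + \<tau> * nb" and eb: "nb + 1 = \<tau> * na + (1 - \<tau>) * nb"
    using \<tau>n by (simp_all add: algebra_simps)
  have na0: "0 \<le> na" using n by simp
  have sc: "part_sum p ((1 - \<tau>) * na) ((1 - \<tau>) * Ya) = (1 - \<tau>) * s" "part_sum p (\<tau> * nb) (\<tau> * Yb) = \<tau> * t"
    "part_sum p (\<tau> * na) (\<tau> * Ya) = \<tau> * s" "part_sum p ((1 - \<tau>) * nb) ((1 - \<tau>) * Yb) = (1 - \<tau>) * t"
    unfolding s_def t_def using \<tau> n Y p na0 by (auto intro!: part_sum_scale)
  have nn: "0 \<le> (1 - \<tau>) * na" "0 \<le> \<tau> * nb" "0 \<le> (1 - \<tau>) * Ya" "0 \<le> \<tau> * Yb"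
    "0 \<le> \<tau> * na" "0 \<le> (1 - \<tau>) * nb" "0 \<le> \<tau> * Ya" "0 \<le> (1 - \<tau>) * Yb"
    using \<tau> n Y na0 by auto
  have s': "(1 - \<tau>) * s + \<tau> * t \<le> s'"
    using part_sum_superadditive(1)[OF p nn(1-4)] unfolding s'_def ea Ya'_def sc .
  have t': "\<tau> * s + (1 - \<tau>) * t \<le> t'"
    using part_sum_superadditive(1)[OF p nn(5-8)] unfolding t'_def eb Yb'_def sc .
  have prod: "((1 - \<tau>) * s + \<tau> * t) * (\<tau> * s + (1 - \<tau>) * t) = s * t + \<tau> * (1 - \<tau>) * (s - t)\<^sup>2"
    by (simp add: power2_eq_square algebra_simps)
  have m: "0 \<le> (1 - \<tau>) * s + \<tau> * t" "0 \<le> \<tau> * s + (1 - \<tau>) * t" using \<tau> st by auto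
  have le: "s * t + \<tau> * (1 - \<tau>) * (s - t)\<^sup>2 \<le> s' * t'"
    unfolding prod[symmetric] using s' t' m by (intro mult_mono) auto
  have sq: "0 \<le> \<tau> * (1 - \<tau>) * (s - t)\<^sup>2" using \<tau> by auto
  \<comment> \<open>For \<open>s \<noteq> t\<close> the averaging already gains a positive multiple
    of \<open>(s - t)^2\<close>. For \<open>s = t\<close> that gain vanishes and strict
    superadditivity has to help: proportional data would force \<open>t = (nb / na) * s\<close>,
    which is less than \<open>s\<close>.\<close>
  have strict: "s * t < s' * t'" if s0: "0 < s"
  proof (cases "s = t")
    case False
    then have "0 < \<tau> * (1 - \<tau>) * (s - t)\<^sup>2" using \<tau> by auto
    then show ?thesis using le by linarith
  next
    case True
    have ne: "na * Yb \<noteq> nb * Ya"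
    proof
      assume eq: "na * Yb = nb * Ya"
      have "Yb = (nb / na) * Ya" "nb = (nb / na) * na" using eq n by (auto simp: field_simps)
      then have "t = part_sum p ((nb / na) * na) ((nb / na) * Ya)" by (simp add: t_def)
      also have "\<dots> = (nb / na) * s" unfolding s_def using n Y p by (intro part_sum_scale) auto
      finally have "t = (nb / na) * s" .
      moreover have "nb / na < 1" using n by simp
      ultimately have "t < 1 * s" using s0 by (metis mult_strict_right_mono)
      then show False using True by simp
    qed
    then have "((1 - \<tau>) * na) * (\<tau> * Yb) \<noteq> (\<tau> * nb) * ((1 - \<tau>) * Ya)"
    proof -
      have "((1 - \<tau>) * na) * (\<tau> * Yb) = (\<tau> * (1 - \<tau>)) * (na * Yb)"
        "(\<tau> * nb) * ((1 - \<tau>) * Ya) = (\<tau> * (1 - \<tau>)) * (nb * Ya)" by (simp_all only: mult_ac)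
      then show ?thesis using \<tau> ne by simp
    qed
    then have "(1 - \<tau>) * s + \<tau> * t < s'"
      using part_sum_superadditive(2)[OF p nn(1-4)] unfolding s'_def ea Ya'_def sc by simp
    then have "s < s'" using True by (simp add: algebra_simps)
    moreover have "s \<le> t'" using t' True by (simp add: algebra_simps)
    ultimately have "s * s < s' * t'" using s0 by (intro mult_less_le_imp_less) auto
    then show ?thesis using True by simp
  qed
  show ?thesis
  proof (rule that[of Ya' Yb'])
    show "0 \<le> Ya'" "0 \<le> Yb'" using \<tau> Y by (auto simp: Ya'_def Yb'_def)
    show "Ya' + Yb' = Ya + Yb" by (simp add: Ya'_def Yb'_def algebra_simps)
    show "part_sum p na Ya + part_sum p nb Yb \<le> part_sum p (na - 1) Ya' + part_sum p (nb + 1) Yb'"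
      using s' t' unfolding s_def t_def s'_def t'_def by (simp add: algebra_simps)
    show "part_sum p na Ya * part_sum p nb Yb \<le> part_sum p (na - 1) Ya' * part_sum p (nb + 1) Yb'"
      using le sq unfolding s_def[symmetric] t_def[symmetric] s'_def[symmetric] t'_def[symmetric] by linarith
    show "part_sum p na Ya * part_sum p nb Yb < part_sum p (na - 1) Ya' * part_sum p (nb + 1) Yb'"
      if "0 < part_sum p na Ya" using strict that unfolding s_def t_def s'_def t'_def .
  qed
qed

section \<open>Balancing the classes of a colouring\<close>

definition class_size :: "'a set \<Rightarrow> ('a \<Rightarrow> 'c) \<Rightarrow> 'c \<Rightarrow> nat" where
  "class_size V c i = card {v\<in>V. c v = i}"

definition balanced :: "'a set \<Rightarrow> ('a \<Rightarrow> 'c) \<Rightarrow> 'c set \<Rightarrow> bool" where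
  "balanced V c I \<longleftrightarrow> (\<forall>i\<in>I. \<forall>j\<in>I. class_size V c i \<le> class_size V c j + 1)"

lemma sum_by_class:
  assumes "finite V" "finite I" "c ` V \<subseteq> I"
  shows "(\<Sum>i\<in>I. \<Sum>v\<in>{v\<in>V. c v = i}. f v) = (\<Sum>v\<in>V. f v)"
  using assms by (rule sum.group)

lemma sum_class_size:
  assumes "finite V" "finite I" "c ` V \<subseteq> I"
  shows "(\<Sum>i\<in>I. class_size V c i) = card V"
  using sum_by_class[OF assms, of "\<lambda>_. 1::nat"] by (simp add: class_size_def)

lemma esym_pos:
  assumes fin: "finite J" and nn: "\<And>i. i \<in> J \<Longrightarrow> 0 \<le> x i" and c: "s \<le> card {i\<in>J. 0 < x i}"
  shows "0 < esym s J x"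
proof -
  obtain S where S: "S \<subseteq> {i\<in>J. 0 < x i}" "card S = s" "finite S"
    using obtain_subset_with_card_n[OF c] by auto
  have "0 < (\<Prod>i\<in>S. x i)" using S by (intro prod_pos) auto
  also have "\<dots> \<le> esym s J x"
    unfolding esym_def
    by (rule member_le_sum[where f = "\<lambda>S. prod x S"])
      (use S fin nn in \<open>auto intro!: prod_nonneg intro: finite_subset[of _ "Pow J"]\<close>)
  finally show ?thesis .
qed

text \<open>One vertex moves from a class to one with at least two vertices fewer, and
  \<open>part_sum_mix\<close> redistributes the power sums of the two classes. The sum of squared
  class sizes is the termination measure of the iteration. Strictness asks for \<open>r\<close>
  nonempty classes so that \<open>r - 2\<close> positive entries remain beside the two that
  change.\<close>

lemma balance_step:
  fixes Y :: "'c \<Rightarrow> real"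
  assumes fin: "finite V" "finite I" and c: "c ` V \<subseteq> I" and p: "1 < p" and r: "2 \<le> r"
    and unb: "\<not> balanced V c I" and Y: "\<And>i. i \<in> I \<Longrightarrow> 0 \<le> Y i"
  obtains c' Y' where "c' ` V \<subseteq> I" "\<And>i. i \<in> I \<Longrightarrow> 0 \<le> Y' i" "sum Y' I = sum Y I"
    "(\<Sum>i\<in>I. (class_size V c' i)\<^sup>2) < (\<Sum>i\<in>I. (class_size V c i)\<^sup>2)"
    "esym r I (\<lambda>i. part_sum p (class_size V c i) (Y i)) \<le> esym r I (\<lambda>i. part_sum p (class_size V c' i) (Y' i))"
    "(\<And>i. i \<in> I \<Longrightarrow> 0 < class_size V c i \<Longrightarrow> 0 < Y i) \<Longrightarrow> r \<le> card {i\<in>I. 0 < class_size V c i} \<Longrightarrow>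
     esym r I (\<lambda>i. part_sum p (class_size V c i) (Y i)) < esym r I (\<lambda>i. part_sum p (class_size V c' i) (Y' i))"
proof -
  define N where "N = class_size V c"
  from unb obtain a b where ab: "a \<in> I" "b \<in> I" "N b + 2 \<le> N a"
    by (auto simp: balanced_def N_def not_le)
  have neq: "a \<noteq> b" using ab by auto
  have "{v\<in>V. c v = a} \<noteq> {}" using ab(3) unfolding N_def class_size_def by (metis card.empty add_2_eq_Suc' not_less_eq_eq zero_le)
  then obtain w where w: "w \<in> V" "c w = a" by auto
  define c' where "c' = c(w := b)"
  define N' where "N' = class_size V c'"
  have "{v\<in>V. c' v = a} = {v\<in>V. c v = a} - {w}" using neq by (auto simp: c'_def)
  then have N'a: "N' a = N a - 1" using w fin by (simp add: N'_def N_def class_size_def)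
  have "{v\<in>V. c' v = b} = insert w {v\<in>V. c v = b}" using w by (auto simp: c'_def)
  then have N'b: "N' b = N b + 1" using w fin neq by (simp add: N'_def N_def class_size_def)
  have N'o: "N' i = N i" if "i \<noteq> a" "i \<noteq> b" for i
  proof -
    have "{v\<in>V. c' v = i} = {v\<in>V. c v = i}" using w that by (auto simp: c'_def)
    then show ?thesis by (simp add: N'_def N_def class_size_def)
  qed
  have ra: "real (N' a) = real (N a) - 1" "real (N' b) = real (N b) + 1" using N'a N'b ab by auto
  have "real (N b) + 2 \<le> real (N a)" using ab by linarith
  then obtain Ya' Yb' where Y': "0 \<le> Ya'" "0 \<le> Yb'" "Ya' + Yb' = Y a + Y b"
    "part_sum p (N a) (Y a) + part_sum p (N b) (Y b) \<le> part_sum p (N' a) Ya' + part_sum p (N' b) Yb'"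
    "part_sum p (N a) (Y a) * part_sum p (N b) (Y b) \<le> part_sum p (N' a) Ya' * part_sum p (N' b) Yb'"
    "0 < part_sum p (N a) (Y a) \<Longrightarrow>
      part_sum p (N a) (Y a) * part_sum p (N b) (Y b) < part_sum p (N' a) Ya' * part_sum p (N' b) Yb'"
    using part_sum_mix[OF p, of "N b" "N a" "Y a" "Y b"] Y ab unfolding ra by auto
  define Y1 where "Y1 = Y(a := Ya', b := Yb')"
  have Y1: "Y1 a = Ya'" "Y1 b = Yb'" "\<And>i. i \<noteq> a \<Longrightarrow> i \<noteq> b \<Longrightarrow> Y1 i = Y i"
    using neq by (auto simp: Y1_def)
  have sI: "sum f I = f a + (f b + sum f (I - {a,b}))" for f :: "'c \<Rightarrow> 'z :: comm_monoid_add"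
  proof -
    have "sum f I = f a + sum f (I - {a})" using fin ab by (intro sum.remove) auto
    also have "sum f (I - {a}) = f b + sum f (I - {a} - {b})" using fin ab neq by (intro sum.remove) auto
    also have "I - {a} - {b} = I - {a,b}" by auto
    finally show ?thesis .
  qed
  let ?f = "\<lambda>i. part_sum p (N i) (Y i)" and ?g = "\<lambda>i. part_sum p (N' i) (Y1 i)"
  have go: "?g i = ?f i" if "i \<noteq> a" "i \<noteq> b" for i using that N'o Y1 by simp
  show ?thesis
  proof (rule that[of c' Y1])
    show "c' ` V \<subseteq> I" using c ab by (auto simp: c'_def)
    show "0 \<le> Y1 i" if "i \<in> I" for i using that Y Y' by (auto simp: Y1_def)
    have "sum Y1 (I - {a,b}) = sum Y (I - {a,b})" using Y1(3) by (intro sum.cong) auto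
    then show "sum Y1 I = sum Y I" unfolding sI[of Y1] sI[of Y] Y1 using Y'(3) by simp
    have "(\<Sum>i\<in>I - {a,b}. (N' i)\<^sup>2) = (\<Sum>i\<in>I - {a,b}. (N i)\<^sup>2)" using N'o by (intro sum.cong) auto
    moreover have "(N' a)\<^sup>2 + (N' b)\<^sup>2 < (N a)\<^sup>2 + (N b)\<^sup>2"
    proof -
      obtain d where d: "N a = N b + 2 + d" using ab le_Suc_ex by metis
      show ?thesis unfolding N'a N'b d by (simp add: power2_eq_square algebra_simps)
    qed
    ultimately show "(\<Sum>i\<in>I. (class_size V c' i)\<^sup>2) < (\<Sum>i\<in>I. (class_size V c i)\<^sup>2)"
      unfolding N_def[symmetric] N'_def[symmetric] sI[of "\<lambda>i. (N' i)\<^sup>2"] sI[of "\<lambda>i. (N i)\<^sup>2"] by simp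
    show "esym r I (\<lambda>i. part_sum p (class_size V c i) (Y i)) \<le> esym r I (\<lambda>i. part_sum p (class_size V c' i) (Y1 i))"
      unfolding N_def[symmetric] N'_def[symmetric]
    proof (rule esym_mono_pair[OF fin(2) ab(1,2) neq])
      show "?f a + ?f b \<le> ?g a + ?g b" "?f a * ?f b \<le> ?g a * ?g b" unfolding Y1 using Y'(4,5) by auto
    qed (auto simp: part_sum_nonneg go)
    assume pos: "\<And>i. i \<in> I \<Longrightarrow> 0 < class_size V c i \<Longrightarrow> 0 < Y i" and many: "r \<le> card {i\<in>I. 0 < class_size V c i}"
    have posf: "0 < ?f i" if "i \<in> I" "0 < N i" for i
      using pos[OF that(1)] that by (auto simp: N_def part_sum_def)
    show "esym r I (\<lambda>i. part_sum p (class_size V c i) (Y i)) < esym r I (\<lambda>i. part_sum p (class_size V c' i) (Y1 i))"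
      unfolding N_def[symmetric] N'_def[symmetric]
    proof (rule esym_strict_mono_pair[OF fin(2) ab(1,2) neq r])
      show "?f a + ?f b \<le> ?g a + ?g b" unfolding Y1 using Y'(4) by auto
      have "0 < ?f a" using posf ab by auto
      then show "?f a * ?f b < ?g a * ?g b" unfolding Y1 using Y'(6) by auto
      show "0 < esym (r - 2) (I - {a, b}) ?f"
      proof (rule esym_pos)
        have "{i\<in>I. 0 < N i} - {a,b} \<subseteq> {i\<in>I - {a,b}. 0 < ?f i}" using posf by auto
        then have "card ({i\<in>I. 0 < N i} - {a,b}) \<le> card {i\<in>I - {a,b}. 0 < ?f i}"
          using fin by (intro card_mono) auto
        moreover have "card {i\<in>I. 0 < N i} - card {a,b} \<le> card ({i\<in>I. 0 < N i} - {a,b})"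
          by (rule diff_card_le_card_Diff) auto
        ultimately show "r - 2 \<le> card {i\<in>I - {a,b}. 0 < ?f i}" using many neq by (simp add: N_def)
      qed (use fin in \<open>auto simp: part_sum_nonneg\<close>)
    qed (auto simp: part_sum_nonneg go)
  qed
qed

lemma exists_balanced:
  fixes Y :: "'c \<Rightarrow> real"
  assumes fin: "finite V" "finite I" and c: "c ` V \<subseteq> I" and p: "1 < p" and r: "2 \<le> r"
    and Y: "\<And>i. i \<in> I \<Longrightarrow> 0 \<le> Y i"
  shows "\<exists>c' Y'. c' ` V \<subseteq> I \<and> (\<forall>i\<in>I. 0 \<le> Y' i) \<and> sum Y' I = sum Y I \<and> balanced V c' I \<and>
    esym r I (\<lambda>i. part_sum p (class_size V c i) (Y i)) \<le> esym r I (\<lambda>i. part_sum p (class_size V c' i) (Y' i))"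
  using c Y
proof (induction "\<Sum>i\<in>I. (class_size V c i)\<^sup>2" arbitrary: c Y rule: less_induct)
  case less
  show ?case
  proof (cases "balanced V c I")
    case True
    then show ?thesis using less.prems by (intro exI[of _ c] exI[of _ Y]) auto
  next
    case False
    obtain c1 Y1 where 1: "c1 ` V \<subseteq> I" "\<And>i. i \<in> I \<Longrightarrow> 0 \<le> Y1 i" "sum Y1 I = sum Y I"
      "(\<Sum>i\<in>I. (class_size V c1 i)\<^sup>2) < (\<Sum>i\<in>I. (class_size V c i)\<^sup>2)"
      "esym r I (\<lambda>i. part_sum p (class_size V c i) (Y i)) \<le> esym r I (\<lambda>i. part_sum p (class_size V c1 i) (Y1 i))"
      by (rule balance_step[OF fin less.prems(1) p r False less.prems(2)]) auto
    obtain c2 Y2 where "c2 ` V \<subseteq> I" "\<forall>i\<in>I. 0 \<le> Y2 i" "sum Y2 I = sum Y1 I" "balanced V c2 I"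
      "esym r I (\<lambda>i. part_sum p (class_size V c1 i) (Y1 i)) \<le> esym r I (\<lambda>i. part_sum p (class_size V c2 i) (Y2 i))"
      using less.hyps[OF 1(4) 1(1), of Y1] 1(2) by blast
    then show ?thesis using 1(3,5) by (intro exI[of _ c2] exI[of _ Y2]) auto
  qed
qed

text \<open>The edges with colour set \<open>S\<close> are the transversals of the classes in
  \<open>S\<close>, hence the images of the functions in \<open>Pi\<^sub>E S K\<close>; summing over
  them expands the product of the class sums.\<close>

lemma complete_partite_sum:
  fixes x :: "'a \<Rightarrow> real"
  assumes fin: "finite V" "finite I" and c: "c ` V \<subseteq> I"
  shows "(\<Sum>e | e \<subseteq> V \<and> card e = r \<and> inj_on c e. \<Prod>v\<in>e. x v) = esym r I (\<lambda>i. \<Sum>v\<in>{v\<in>V. c v = i}. x v)"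
proof -
  define R where "R = {e. e \<subseteq> V \<and> card e = r \<and> inj_on c e}"
  define SS where "SS = {S. S \<subseteq> I \<and> card S = r}"
  define K where "K = (\<lambda>i. {v\<in>V. c v = i})"
  have fR: "finite R" "finite SS"
    using fin by (auto simp: R_def SS_def intro: finite_subset[of _ "Pow V"] finite_subset[of _ "Pow I"])
  have img: "(\<lambda>e. c ` e) ` R \<subseteq> SS" using c by (auto simp: R_def SS_def card_image)
  have "(\<Sum>e\<in>R. \<Prod>v\<in>e. x v) = (\<Sum>S\<in>SS. \<Sum>e\<in>{e\<in>R. c ` e = S}. \<Prod>v\<in>e. x v)"
    using sum.group[OF fR img, of "\<lambda>e. prod x e"] by simp
  also have "\<dots> = (\<Sum>S\<in>SS. \<Prod>i\<in>S. sum x (K i))"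
  proof (rule sum.cong[OF refl])
    fix S assume S: "S \<in> SS"
    have fS: "finite S" using S fin finite_subset by (auto simp: SS_def)
    have Kc: "c (g i) = i" "g i \<in> V" if "g \<in> Pi\<^sub>E S K" "i \<in> S" for g i
      using that by (auto simp: PiE_def Pi_def K_def)
    have injg: "inj_on g S" if "g \<in> Pi\<^sub>E S K" for g
      by (rule inj_onI) (metis Kc(1)[OF that])
    have bij: "bij_betw (\<lambda>g. g ` S) (Pi\<^sub>E S K) {e\<in>R. c ` e = S}"
    proof (rule bij_betwI')
      fix g h assume gh: "g \<in> Pi\<^sub>E S K" "h \<in> Pi\<^sub>E S K"
      show "(g ` S = h ` S) = (g = h)"
      proof
        assume eq: "g ` S = h ` S"
        show "g = h"
        proof (rule PiE_ext[OF gh])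
          fix i assume i: "i \<in> S"
          then have "g i \<in> h ` S" using eq by blast
          then obtain j where j: "j \<in> S" "g i = h j" by auto
          then have "i = j" using Kc(1)[OF gh(1) i] Kc(1)[OF gh(2) j(1)] by simp
          then show "g i = h i" using j by simp
        qed
      qed simp
    next
      fix g assume g: "g \<in> Pi\<^sub>E S K"
      have "c ` g ` S = S" using Kc(1)[OF g] by (auto simp: image_image)
      moreover have "inj_on c (g ` S)" by (rule inj_onI) (auto simp: Kc(1)[OF g])
      ultimately show "g ` S \<in> {e\<in>R. c ` e = S}"
        using Kc(2)[OF g] card_image[OF injg[OF g]] S by (auto simp: R_def SS_def)
    next
      fix e assume e: "e \<in> {e\<in>R. c ` e = S}"
      then have e': "e \<subseteq> V" "inj_on c e" "c ` e = S" by (auto simp: R_def)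
      define g where "g = restrict (inv_into e c) S"
      have gi: "g (c v) = v" if "v \<in> e" for v
        using that e' by (auto simp: g_def inv_into_f_f)
      have "g \<in> Pi\<^sub>E S K"
      proof (rule PiE_I)
        fix i assume "i \<in> S"
        then obtain v where "v \<in> e" "i = c v" using e' by auto
        then show "g i \<in> K i" using gi e' by (auto simp: K_def)
      qed (simp add: g_def)
      moreover have "e = g ` S" using gi e'(3) by (force simp: image_iff)
      ultimately show "\<exists>g\<in>Pi\<^sub>E S K. e = g ` S" by blast
    qed
    have "(\<Prod>i\<in>S. sum x (K i)) = (\<Sum>g\<in>Pi\<^sub>E S K. \<Prod>i\<in>S. x (g i))"
      using fin fS by (intro prod_sum_PiE) (auto simp: K_def)
    also have "\<dots> = (\<Sum>g\<in>Pi\<^sub>E S K. \<Prod>v\<in>g ` S. x v)"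
      by (rule sum.cong[OF refl]) (simp add: prod.reindex[OF injg])
    also have "\<dots> = (\<Sum>e\<in>{e\<in>R. c ` e = S}. \<Prod>v\<in>e. x v)"
      by (rule sum.reindex_bij_betw[OF bij])
    finally show "(\<Sum>e\<in>{e\<in>R. c ` e = S}. \<Prod>v\<in>e. x v) = (\<Prod>i\<in>S. sum x (K i))" ..
  qed
  finally show ?thesis by (simp add: R_def SS_def K_def esym_def)
qed

text \<open>With \<open>N j\<close> minimal, the total is \<open>card I * N j + t\<close>, where
  \<open>t\<close> counts the larger classes. Class \<open>j\<close> is not among them, so
  \<open>t < card I\<close>, and quotient and remainder can be read off.\<close>

lemma balanced_class_sizes:
  assumes fin: "finite V" "finite I" and c: "c ` V \<subseteq> I" and I: "I \<noteq> {}" and bal: "balanced V c I"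
  defines "m \<equiv> card V div card I"
  shows "\<And>i. i \<in> I \<Longrightarrow> class_size V c i = m \<or> class_size V c i = Suc m"
    and "card {i\<in>I. class_size V c i = Suc m} = card V mod card I"
proof -
  define N where "N = class_size V c"
  obtain j where j: "j \<in> I" "\<And>i. i \<in> I \<Longrightarrow> N j \<le> N i"
    using arg_min_if_finite[OF fin(2) I, of N] by (metis not_le)
  have Ni: "N i = N j \<or> N i = Suc (N j)" if "i \<in> I" for i
    using bal j that unfolding balanced_def N_def[symmetric] by (metis Suc_eq_plus1 le_SucE le_antisym)
  define t where "t = card {i\<in>I. N i = Suc (N j)}"
  have "card V = (\<Sum>i\<in>I. N i)" using sum_class_size[OF fin c] by (simp add: N_def)
  also have "\<dots> = (\<Sum>i\<in>I. N j + (if N i = Suc (N j) then 1 else 0))"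
    by (rule sum.cong) (use Ni in force)+
  also have "\<dots> = card I * N j + t"
    using fin by (simp add: sum.distrib t_def sum.If_cases Int_def)
  finally have n: "card V = card I * N j + t" .
  have "j \<notin> {i\<in>I. N i = Suc (N j)}" by simp
  then have "{i\<in>I. N i = Suc (N j)} \<subset> I" using j(1) by blast
  then have t: "t < card I" unfolding t_def using fin by (intro psubset_card_mono) auto
  have m: "m = N j" unfolding m_def n using t by simp
  show "\<And>i. i \<in> I \<Longrightarrow> class_size V c i = m \<or> class_size V c i = Suc m" using Ni m by (simp add: N_def)
  show "card {i\<in>I. class_size V c i = Suc m} = card V mod card I"
    unfolding n using t by (simp add: m t_def N_def)
qed

text \<open>Both colourings have equally many classes of each size, so the colours can be matched
  along their class sizes, and then each class with its partner.\<close>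

lemma balanced_iso:
  assumes 1: "finite V" "finite I" "c ` V \<subseteq> I" "balanced V c I"
    and 2: "finite W" "finite J" "d ` W \<subseteq> J" "balanced W d J"
    and card: "card V = card W" "card I = card J" "I \<noteq> {}"
  shows "hgraph_iso (complete_partite r V c) (complete_partite r W d)"
proof -
  define m where "m = card V div card I"
  have J: "J \<noteq> {}" using card 1 2 by auto
  have s1: "\<And>i. i \<in> I \<Longrightarrow> class_size V c i = m \<or> class_size V c i = Suc m"
    "card {i\<in>I. class_size V c i = Suc m} = card V mod card I"
    using balanced_class_sizes[OF 1(1-3) card(3) 1(4)] by (auto simp: m_def)
  have s2: "\<And>i. i \<in> J \<Longrightarrow> class_size W d i = m \<or> class_size W d i = Suc m"
    "card {i\<in>J. class_size W d i = Suc m} = card V mod card I"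
    using balanced_class_sizes[OF 2(1-3) J 2(4)] by (auto simp: m_def card)
  let ?I1 = "{i\<in>I. class_size V c i = Suc m}" and ?J1 = "{i\<in>J. class_size W d i = Suc m}"
  obtain f1 where f1: "bij_betw f1 ?I1 ?J1"
    using finite_same_card_bij[of ?I1 ?J1] 1 2 s1(2) s2(2) by auto
  have "card (I - ?I1) = card (J - ?J1)"
    using 1 2 s1(2) s2(2) card by (subst (1 2) card_Diff_subset) auto
  then obtain f2 where f2: "bij_betw f2 (I - ?I1) (J - ?J1)"
    using finite_same_card_bij[of "I - ?I1" "J - ?J1"] 1 2 by auto
  define \<pi> where "\<pi> = (\<lambda>i. if i \<in> ?I1 then f1 i else f2 i)"
  have b1: "bij_betw \<pi> ?I1 ?J1" using f1 by (subst bij_betw_cong[of _ _ f1]) (auto simp: \<pi>_def)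
  have b2: "bij_betw \<pi> (I - ?I1) (J - ?J1)" using f2 by (subst bij_betw_cong[of _ _ f2]) (auto simp: \<pi>_def)
  have "bij_betw \<pi> (?I1 \<union> (I - ?I1)) (?J1 \<union> (J - ?J1))" by (rule bij_betw_combine[OF b1 b2]) auto
  moreover have "?I1 \<union> (I - ?I1) = I" "?J1 \<union> (J - ?J1) = J" by auto
  ultimately have \<pi>: "bij_betw \<pi> I J" by simp
  have sz: "class_size V c i = class_size W d (\<pi> i)" if i: "i \<in> I" for i
  proof (cases "i \<in> ?I1")
    case True
    then have "\<pi> i \<in> ?J1" using b1 by (auto simp: bij_betw_def)
    then show ?thesis using True by simp
  next
    case False
    then have "\<pi> i \<in> J - ?J1" using b2 i by (auto simp: bij_betw_def)
    then show ?thesis using False i s1(1) s2(1) by auto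
  qed
  have "\<exists>b. bij_betw b {v\<in>V. c v = i} {v\<in>W. d v = \<pi> i}" if "i \<in> I" for i
    using finite_same_card_bij[of "{v\<in>V. c v = i}" "{v\<in>W. d v = \<pi> i}"] sz[OF that] 1 2
    by (auto simp: class_size_def)
  then obtain b where b: "\<And>i. i \<in> I \<Longrightarrow> bij_betw (b i) {v\<in>V. c v = i} {v\<in>W. d v = \<pi> i}" by metis
  define f where "f = (\<lambda>v. b (c v) v)"
  have cI: "c v \<in> I" if "v \<in> V" for v using that 1 by auto
  have fv: "f v \<in> W" "d (f v) = \<pi> (c v)" if "v \<in> V" for v
    using b[OF cI[OF that]] that by (auto simp: f_def bij_betw_def)
  have inj: "inj_on f V"
  proof (rule inj_onI)
    fix u v assume uv: "u \<in> V" "v \<in> V" "f u = f v"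
    then have "\<pi> (c u) = \<pi> (c v)" using fv by metis
    then have "c u = c v" using \<pi> cI uv by (auto simp: bij_betw_def inj_on_def)
    then show "u = v" using b[OF cI[OF uv(1)]] uv by (auto simp: f_def bij_betw_def inj_on_def)
  qed
  have "f ` V = W"
    using fv inj 1 2 card card_image[OF inj] by (intro card_subset_eq) auto
  then have bf: "bij_betw f V W" using inj by (simp add: bij_betw_def)
  have injc: "inj_on d (f ` e) = inj_on c e" if e: "e \<subseteq> V" for e
  proof -
    have "inj_on d (f ` e) = inj_on (d \<circ> f) e"
      using inj_on_subset[OF inj e] by (rule comp_inj_on_iff)
    also have "\<dots> = inj_on (\<pi> \<circ> c) e" using fv e by (intro inj_on_cong) auto
    also have "\<dots> = inj_on c e"
    proof
      show "inj_on (\<pi> \<circ> c) e \<Longrightarrow> inj_on c e" by (rule inj_on_imageI2)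
      assume "inj_on c e"
      moreover have "inj_on \<pi> (c ` e)" using \<pi> cI e by (auto simp: bij_betw_def intro: inj_on_subset)
      ultimately show "inj_on (\<pi> \<circ> c) e" by (rule comp_inj_on)
    qed
    finally show ?thesis .
  qed
  have cf: "card (f ` e) = card e" if "e \<subseteq> V" for e using inj_on_subset[OF inj that] by (rule card_image)
  have "(\<lambda>e. f ` e) ` {e. e \<subseteq> V \<and> card e = r \<and> inj_on c e} = {e. e \<subseteq> W \<and> card e = r \<and> inj_on d e}"
  proof (intro equalityI subsetI)
    fix e assume "e \<in> {e. e \<subseteq> W \<and> card e = r \<and> inj_on d e}"
    moreover from this obtain e' where "e' \<subseteq> V" "e = f ` e'"
      using \<open>f ` V = W\<close> by (metis (no_types, lifting) mem_Collect_eq subset_image_iff)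
    ultimately show "e \<in> (\<lambda>e. f ` e) ` {e. e \<subseteq> V \<and> card e = r \<and> inj_on c e}" using injc cf by auto
  qed (use injc cf \<open>f ` V = W\<close> in auto)
  then show ?thesis unfolding hgraph_iso_def complete_partite_def using bf by (intro exI[of _ f]) simp
qed

lemma balanced_turan:
  fixes n k :: nat
  shows "0 < k \<Longrightarrow> balanced {..<n} (\<lambda>v. v mod k) {..<k}"
  unfolding balanced_def class_size_def
proof (intro ballI)
  fix i j assume "i \<in> {..<k}" "j \<in> {..<k}"
  then show "card {v \<in> {..<n}. v mod k = i} \<le> card {v \<in> {..<n}. v mod k = j} + 1"
    using turan_part_sizes[of i k n] turan_part_sizes[of j k n] by auto
qed

lemma balanced_iso_turan:
  assumes "finite V" "finite I" "c ` V \<subseteq> I" "balanced V c I" "card I = k" "0 < k"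
  shows "hgraph_iso (complete_partite r V c) (turan r (card V) k)"
  unfolding turan_def using assms
  by (intro balanced_iso[where I = I and J = "{..<k}"] balanced_turan) auto

section \<open>The p-spectral radius\<close>

lemma p_norm_eq_1_iff:
  assumes "0 < p"
  shows "p_norm p V x = 1 \<longleftrightarrow> (\<Sum>v\<in>V. \<bar>x v\<bar> powr p) = 1"
proof
  assume "p_norm p V x = 1"
  moreover have "0 \<le> (\<Sum>v\<in>V. \<bar>x v\<bar> powr p)" by (intro sum_nonneg) simp
  then have "(\<Sum>v\<in>V. \<bar>x v\<bar> powr p) = p_norm p V x powr p"
    using assms by (simp add: p_norm_def powr_powr)
  ultimately show "(\<Sum>v\<in>V. \<bar>x v\<bar> powr p) = 1" by simp
qed (simp add: p_norm_def)

text \<open>The form has degree \<open>r\<close> and the power sum has degree \<open>p\<close>,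
  which explains the exponent \<open>r / p\<close>. Vectors vanishing on the vertex set cannot be
  normalised; for them the form is zero because \<open>0 < r\<close> makes every edge
  nonempty.\<close>

lemma graph_form_le_radius:
  assumes H: "r_graph r H" and ne: "hverts H \<noteq> {}" and p: "1 \<le> p" and r: "0 < r"
  shows "graph_form r H z \<le> p_spectral_radius r p H * (\<Sum>v\<in>hverts H. \<bar>z v\<bar> powr p) powr (r / p)"
proof (cases "(\<Sum>v\<in>hverts H. \<bar>z v\<bar> powr p) = 0")
  case True
  have fin: "finite (hverts H)" using H by (simp add: r_graph_def)
  have "\<forall>v\<in>hverts H. \<bar>z v\<bar> powr p = 0" using True fin by (subst (asm) sum_nonneg_eq_0_iff) auto
  then have z: "z v = 0" if "v \<in> hverts H" for v using that by auto
  have "(\<Prod>v\<in>e. z v) = 0" if "e \<in> hedges H" for e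
  proof -
    have e: "e \<subseteq> hverts H" "card e = r" using H that by (auto simp: r_graph_def)
    then have "e \<noteq> {}" "finite e" using r fin finite_subset by auto
    then show ?thesis using z e by (auto intro!: prod_zero)
  qed
  then show ?thesis using True by (simp add: graph_form_def)
next
  case False
  define S where "S = (\<Sum>v\<in>hverts H. \<bar>z v\<bar> powr p)"
  have S: "0 < S" using False sum_nonneg[of "hverts H" "\<lambda>v. \<bar>z v\<bar> powr p"] by (simp add: S_def)
  define a where "a = S powr (- 1 / p)"
  have a: "0 < a" using S by (simp add: a_def)
  define y where "y = (\<lambda>v. a * z v)"
  have ap: "a powr p = 1 / S"
  proof -
    have "a powr p = S powr (- 1)" unfolding a_def powr_powr using p by simp
    then show ?thesis using S by (simp add: powr_minus_divide)
  qed
  have "(\<Sum>v\<in>hverts H. \<bar>y v\<bar> powr p) = a powr p * S"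
    unfolding S_def sum_distrib_left
    by (rule sum.cong[OF refl]) (use a in \<open>simp add: y_def abs_mult powr_mult\<close>)
  then have "p_norm p (hverts H) y = 1" using ap S p by (simp add: p_norm_eq_1_iff)
  then have "graph_form r H y \<le> p_spectral_radius r p H"
    using p_spectral_radius_attained[OF H ne p] by metis
  moreover have "graph_form r H y = a ^ r * graph_form r H z"
  proof -
    have "(\<Prod>v\<in>e. y v) = a ^ r * (\<Prod>v\<in>e. z v)" if "e \<in> hedges H" for e
      using H that by (auto simp: y_def prod.distrib r_graph_def)
    then show ?thesis by (simp add: graph_form_def sum_distrib_left mult_ac)
  qed
  moreover have "a ^ r = 1 / S powr (r / p)"
  proof -
    have "a ^ r = a powr r" using powr_realpow[OF a] by simp
    also have "\<dots> = S powr (- (r / p))" unfolding a_def powr_powr by simp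
    finally show ?thesis by (simp add: powr_minus_divide)
  qed
  ultimately show ?thesis using S by (simp add: S_def[symmetric] field_simps)
qed

lemma p_spectral_radius_nonneg:
  assumes H: "r_graph r H" and ne: "hverts H \<noteq> {}" and p: "1 \<le> p" and r: "0 < r"
  shows "0 \<le> p_spectral_radius r p H"
proof -
  have fin: "finite (hverts H)" using H by (simp add: r_graph_def)
  have "0 \<le> graph_form r H (\<lambda>_. 1)" by (simp add: graph_form_def)
  also have "\<dots> \<le> p_spectral_radius r p H * (\<Sum>v\<in>hverts H. \<bar>1::real\<bar> powr p) powr (r / p)"
    by (rule graph_form_le_radius[OF assms])
  finally show ?thesis using fin ne by (simp add: zero_le_mult_iff card_gt_0_iff)
qed

lemma nonneg_maximizer:
  assumes H: "r_graph r H" and ne: "hverts H \<noteq> {}" and p: "1 \<le> p" and r: "0 < r"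
  obtains x where "\<And>v. 0 \<le> x v" "(\<Sum>v\<in>hverts H. x v powr p) = 1"
    "graph_form r H x = p_spectral_radius r p H"
proof -
  obtain x where x: "p_norm p (hverts H) x = 1" "graph_form r H x = p_spectral_radius r p H"
    "\<And>y. p_norm p (hverts H) y = 1 \<Longrightarrow> graph_form r H y \<le> graph_form r H x"
    using p_spectral_radius_attained[OF H ne p] by metis
  define y where "y = (\<lambda>v. \<bar>x v\<bar>)"
  have ny: "p_norm p (hverts H) y = 1" using x(1) by (simp add: p_norm_def y_def)
  have "graph_form r H x \<le> graph_form r H y"
    unfolding graph_form_def y_def
    by (intro mult_left_mono sum_mono) (auto simp: abs_prod[symmetric])
  then have "graph_form r H y = p_spectral_radius r p H" using x(2) x(3)[OF ny] by simp
  moreover have "(\<Sum>v\<in>hverts H. y v powr p) = 1" using ny p by (simp add: p_norm_eq_1_iff y_def)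
  ultimately show ?thesis using that[of y] by (simp add: y_def)
qed

lemma p_spectral_radius_iso_le:
  assumes iso: "hgraph_iso G H" and G: "r_graph r G" and H: "r_graph r H" and ne: "hverts H \<noteq> {}"
    and p: "1 \<le> p"
  shows "p_spectral_radius r p H \<le> p_spectral_radius r p G"
proof -
  obtain f where f: "bij_betw f (hverts G) (hverts H)" "(\<lambda>e. f ` e) ` hedges G = hedges H"
    using iso by (auto simp: hgraph_iso_def)
  have injf: "inj_on f (hverts G)" using f by (simp add: bij_betw_def)
  have ne': "hverts G \<noteq> {}" using f ne by (auto simp: bij_betw_def)
  have eG: "e \<subseteq> hverts G" if "e \<in> hedges G" for e using G that by (auto simp: r_graph_def)
  obtain x where x: "p_norm p (hverts H) x = 1" "graph_form r H x = p_spectral_radius r p H"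
    using p_spectral_radius_attained[OF H ne p] by metis
  have "p_norm p (hverts G) (x \<circ> f) = 1"
    using x(1) sum.reindex_bij_betw[OF f(1), of "\<lambda>v. \<bar>x v\<bar> powr p"] by (simp add: p_norm_def)
  then have "graph_form r G (x \<circ> f) \<le> p_spectral_radius r p G"
    using p_spectral_radius_attained[OF G ne' p] by metis
  moreover have "graph_form r G (x \<circ> f) = graph_form r H x"
  proof -
    have "inj_on (\<lambda>e. f ` e) (hedges G)"
      by (rule inj_onI) (use inj_on_image_eq_iff[OF injf eG eG] in blast)
    then have "(\<Sum>e\<in>hedges H. prod x e) = (\<Sum>e\<in>hedges G. prod x (f ` e))"
      unfolding f(2)[symmetric] by (subst sum.reindex) auto
    also have "\<dots> = (\<Sum>e\<in>hedges G. prod (x \<circ> f) e)"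
      by (intro sum.cong refl prod.reindex inj_on_subset[OF injf] eG)
    finally show ?thesis by (simp add: graph_form_def)
  qed
  ultimately show ?thesis using x by simp
qed

lemma p_spectral_radius_iso:
  assumes iso: "hgraph_iso G H" and G: "r_graph r G" and H: "r_graph r H" and ne: "hverts H \<noteq> {}"
    and p: "1 \<le> p"
  shows "p_spectral_radius r p G = p_spectral_radius r p H"
proof -
  have sym: "hgraph_iso H G" using G by (intro hgraph_iso_sym[OF iso]) (auto simp: r_graph_def)
  have neG: "hverts G \<noteq> {}" using iso ne by (auto simp: hgraph_iso_def bij_betw_def)
  show ?thesis
    by (rule order_antisym[OF p_spectral_radius_iso_le[OF sym H G neG p] p_spectral_radius_iso_le[OF iso G H ne p]])
qed

lemma graph_form_split:
  assumes H: "r_graph r H"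
  shows "graph_form r H z = fact r * (\<Sum>e\<in>{e\<in>hedges H. v \<notin> e}. \<Prod>w\<in>e. z w)
    + fact r * (\<Sum>e\<in>{e\<in>hedges H. v \<in> e}. \<Prod>w\<in>e-{v}. z w) * z v"
proof -
  have fin: "finite (hverts H)" and E: "\<And>e. e \<in> hedges H \<Longrightarrow> e \<subseteq> hverts H" using H by (auto simp: r_graph_def)
  have finE: "finite (hedges H)" using E fin by (intro finite_subset[of "hedges H" "Pow (hverts H)"]) auto
  have "(\<Sum>e\<in>hedges H. \<Prod>w\<in>e. z w) = (\<Sum>e\<in>{e\<in>hedges H. v \<notin> e} \<union> {e\<in>hedges H. v \<in> e}. \<Prod>w\<in>e. z w)"
    by (rule sum.cong) auto
  also have "\<dots> = (\<Sum>e\<in>{e\<in>hedges H. v \<notin> e}. \<Prod>w\<in>e. z w) + (\<Sum>e\<in>{e\<in>hedges H. v \<in> e}. \<Prod>w\<in>e. z w)"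
    using finE by (intro sum.union_disjoint) auto
  also have "(\<Sum>e\<in>{e\<in>hedges H. v \<in> e}. \<Prod>w\<in>e. z w) = (\<Sum>e\<in>{e\<in>hedges H. v \<in> e}. (\<Prod>w\<in>e-{v}. z w) * z v)"
  proof (rule sum.cong[OF refl])
    fix e assume e: "e \<in> {e\<in>hedges H. v \<in> e}"
    then have "finite e" using finite_subset[OF E fin] by simp
    then show "prod z e = prod z (e - {v}) * z v" using e by (simp add: prod.remove[of e v] mult.commute)
  qed
  finally show ?thesis by (simp add: graph_form_def sum_distrib_right distrib_left mult.assoc)
qed

text \<open>Along a single coordinate the form is affine, so the eigenvalue equation is the vanishing
  of the derivative at an interior minimum of one variable.\<close>

lemma eigen_equation:
  assumes H: "r_graph r H" and p: "1 < p" and r: "0 < r"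
    and x: "\<And>v. 0 \<le> x v" "(\<Sum>v\<in>hverts H. x v powr p) = 1" "graph_form r H x = p_spectral_radius r p H"
    and v: "v \<in> hverts H" "0 < x v"
  shows "fact r * (\<Sum>e\<in>{e\<in>hedges H. v \<in> e}. \<Prod>w\<in>e-{v}. x w) = r * p_spectral_radius r p H * x v powr (p - 1)"
proof -
  define lam where "lam = p_spectral_radius r p H"
  define b where "b = fact r * (\<Sum>e\<in>{e\<in>hedges H. v \<in> e}. \<Prod>w\<in>e-{v}. x w)"
  define a where "a = fact r * (\<Sum>e\<in>{e\<in>hedges H. v \<notin> e}. \<Prod>w\<in>e. x w)"
  have fin: "finite (hverts H)" using H by (simp add: r_graph_def)
  define S where "S = (\<Sum>w\<in>hverts H - {v}. x w powr p)"
  have S1: "x v powr p + S = 1" using x(2) fin v by (simp add: S_def sum.remove)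
  have S0: "0 \<le> S" by (simp add: S_def sum_nonneg)
  have form: "graph_form r H (x(v := z)) = a + b * z" for z
  proof -
    have "(\<Sum>e\<in>{e\<in>hedges H. v \<notin> e}. \<Prod>w\<in>e. (x(v := z)) w) = (\<Sum>e\<in>{e\<in>hedges H. v \<notin> e}. \<Prod>w\<in>e. x w)"
      by (intro sum.cong prod.cong refl) auto
    moreover have "(\<Sum>e\<in>{e\<in>hedges H. v \<in> e}. \<Prod>w\<in>e-{v}. (x(v := z)) w) = (\<Sum>e\<in>{e\<in>hedges H. v \<in> e}. \<Prod>w\<in>e-{v}. x w)"
      by (intro sum.cong prod.cong refl) auto
    ultimately show ?thesis unfolding graph_form_split[OF H, of _ v] a_def b_def by simp
  qed
  have at: "lam = a + b * x v" using form[of "x v"] x(3) by (simp add: lam_def)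
  have ne: "hverts H \<noteq> {}" using v by auto
  define f where "f = (\<lambda>z. lam * (z powr p + S) powr (r / p) - (a + b * z))"
  have f0: "0 \<le> f z" if "0 < z" for z
  proof -
    have "(\<Sum>w\<in>hverts H. \<bar>(x(v := z)) w\<bar> powr p) = z powr p + S"
      using fin v that x(1) by (simp add: sum.remove[of _ v] S_def)
    then have "a + b * z \<le> lam * (z powr p + S) powr (r / p)"
      using graph_form_le_radius[OF H ne _ r, of p "x(v := z)"] p unfolding form lam_def by simp
    then show ?thesis by (simp add: f_def)
  qed
  have fx: "f (x v) = 0" using at S1 by (simp add: f_def)
  have der: "(f has_real_derivative (lam * (r * x v powr (p - 1)) - b)) (at (x v))"
  proof -
    have d1: "((\<lambda>z. z powr p + S) has_real_derivative (p * x v powr (p - 1))) (at (x v))"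
      using v by (auto intro!: derivative_eq_intros has_real_derivative_powr)
    have "((\<lambda>z. (z powr p + S) powr (r / p)) has_real_derivative
        ((r / p) * (x v powr p + S) powr (r / p - of_nat 1) * (p * x v powr (p - 1)))) (at (x v))"
      by (rule DERIV_fun_powr[OF d1]) (simp add: S1)
    then have d2: "((\<lambda>z. (z powr p + S) powr (r / p)) has_real_derivative (r * x v powr (p - 1))) (at (x v))"
      using p by (simp add: S1)
    show ?thesis unfolding f_def by (rule derivative_eq_intros d2 refl | simp)+
  qed
  have "lam * (r * x v powr (p - 1)) - b = 0"
    by (rule DERIV_local_min[OF der v(2)]) (use f0 fx in auto)
  then have "b = r * lam * x v powr (p - 1)" by (simp add: mult_ac)
  then show ?thesis unfolding b_def lam_def .
qed

section \<open>Vertex deletion, limit densities and the degrees forced by a flat maximizer\<close>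

definition delete_vertex :: "'a \<Rightarrow> 'a hgraph \<Rightarrow> 'a hgraph" where
  "delete_vertex v H = (hverts H - {v}, {e\<in>hedges H. v \<notin> e})"

lemma r_graph_delete_vertex: "r_graph r H \<Longrightarrow> r_graph r (delete_vertex v H)"
  by (auto simp: r_graph_def delete_vertex_def)

text \<open>The maximizer itself serves as test vector for the smaller hypergraph. By the eigenvalue
  equation, removing the edges at \<open>v\<close> costs exactly \<open>r * x v powr p\<close> of
  the form, and the remaining power sum is \<open>1 - x v powr p\<close>.\<close>

lemma delete_vertex_radius:
  assumes H: "r_graph r H" and p: "1 < p" and r: "0 < r" and c2: "2 \<le> card (hverts H)"
    and x: "\<And>v. 0 \<le> x v" "(\<Sum>v\<in>hverts H. x v powr p) = 1" "graph_form r H x = p_spectral_radius r p H"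
    and v: "v \<in> hverts H"
  shows "p_spectral_radius r p H * (1 - r * x v powr p)
    \<le> p_spectral_radius r p (delete_vertex v H) * (1 - x v powr p) powr (r / p)"
proof -
  define lam where "lam = p_spectral_radius r p H"
  define b where "b = fact r * (\<Sum>e\<in>{e\<in>hedges H. v \<in> e}. \<Prod>w\<in>e-{v}. x w)"
  have fin: "finite (hverts H)" using H by (simp add: r_graph_def)
  have "b * x v = r * lam * x v powr p"
  proof (cases "x v = 0")
    case False
    then have x0: "0 < x v" using x(1)[of v] by simp
    have "b * x v = r * lam * (x v powr (p - 1) * x v)"
      using eigen_equation[OF H p r x v x0] by (simp add: b_def lam_def)
    also have "x v powr (p - 1) * x v = x v powr p" using x0 by (simp add: powr_mult_base[symmetric] powr_diff)
    finally show ?thesis .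
  qed (use p in simp)
  then have "lam * (1 - r * x v powr p) = lam - b * x v" by (simp add: algebra_simps)
  also have "\<dots> = graph_form r (delete_vertex v H) x"
    using graph_form_split[OF H, of x v] x(3) by (simp add: graph_form_def delete_vertex_def b_def lam_def)
  also have "\<dots> \<le> p_spectral_radius r p (delete_vertex v H) *
      (\<Sum>w\<in>hverts (delete_vertex v H). \<bar>x w\<bar> powr p) powr (r / p)"
  proof (rule graph_form_le_radius[OF r_graph_delete_vertex[OF H]])
    have "card (hverts H - {v}) = card (hverts H) - 1" using v fin by simp
    then have "card (hverts H - {v}) \<noteq> 0" using c2 by linarith
    then have "hverts H - {v} \<noteq> {}" by (metis card.empty)
    then show "hverts (delete_vertex v H) \<noteq> {}" by (simp add: delete_vertex_def)
  qed (use p r in auto)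
  also have "(\<Sum>w\<in>hverts (delete_vertex v H). \<bar>x w\<bar> powr p) = 1 - x v powr p"
    using x fin v by (simp add: delete_vertex_def sum.remove[of _ v])
  finally show ?thesis by (simp add: lam_def)
qed

text \<open>The limit of \<open>fact r\<close> times the number of edges of the Turan hypergraph
  over \<open>n ^ r\<close>. With the constant vector its radius is about this constant times
  \<open>n powr (r - r / p)\<close>.\<close>

definition turan_const :: "nat \<Rightarrow> nat \<Rightarrow> real" where
  "turan_const r k = fact r * (k choose r) / k ^ r"

lemma turan_const_pos: "r \<le> k \<Longrightarrow> 0 < k \<Longrightarrow> 0 < turan_const r k"
  by (simp add: turan_const_def)

text \<open>The handshake identity for the limit densities of edges and degrees.\<close>

lemma turan_const_deg:
  assumes "1 \<le> r" "r \<le> k"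
  shows "r * turan_const r k / fact r = turan_deg r k"
proof -
  obtain r' k' where rk: "r = Suc r'" "k = Suc k'" using assms by (metis Suc_le_D le_trans One_nat_def)
  have "Suc r' * (Suc k' choose Suc r') = Suc k' * (k' choose r')"
    by (rule Suc_times_binomial)
  then have "real r * real (k choose r) = real k * real ((k - 1) choose (r - 1))"
    unfolding rk diff_Suc_1 of_nat_mult[symmetric] by (rule arg_cong)
  then have "r * turan_const r k / fact r = real k * real ((k - 1) choose (r - 1)) / k ^ r"
    by (simp add: turan_const_def)
  also have "\<dots> = turan_deg r k" unfolding turan_deg_def using assms by (cases r) auto
  finally show ?thesis .
qed

text \<open>After scaling by \<open>n powr (1 / p)\<close> the entries are at least
  \<open>1 - \<delta>\<close> and have mean at most one. Single entries have no useful upper bound,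
  so the weight of the link of \<open>v\<close> cannot be compared with its size term by term. But
  every product over an \<open>(r - 1)\<close>-set is at least \<open>a0\<close>, and by Maclaurin
  the total excess over \<open>a0\<close> is at most \<open>n ^ (r - 1) * (1 - a0)\<close>. The link
  is therefore almost as large as its weight, which the eigenvalue equation bounds from
  below.\<close>

lemma degree_lower_bound:
  fixes \<delta> :: real
  assumes H: "r_graph r H" and p: "1 < p" and rk: "2 \<le> r" "r \<le> k"
    and n: "n = real (card (hverts H))" "0 < n"
    and x: "\<And>v. 0 \<le> x v" "(\<Sum>v\<in>hverts H. x v powr p) = 1" "graph_form r H x = p_spectral_radius r p H"
    and \<delta>: "0 < \<delta>" "\<delta> < 1"
    and low: "\<And>v. v \<in> hverts H \<Longrightarrow> (1 - \<delta>) / n \<le> x v powr p"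
    and lam: "(1 - \<delta>) * turan_const r k * n powr (r - r / p) \<le> p_spectral_radius r p H"
    and v: "v \<in> hverts H"
  shows "((1 - \<delta>)\<^sup>2 * turan_deg r k - (1 - (1 - \<delta>) ^ (r - 1))) * n ^ (r - 1) \<le> card {e\<in>hedges H. v \<in> e}"
proof -
  define V where "V = hverts H"
  define E where "E = hedges H"
  define lam where "lam = p_spectral_radius r p H"
  have fin: "finite V" and Er: "\<And>e. e \<in> E \<Longrightarrow> e \<subseteq> V \<and> card e = r"
    using H by (auto simp: r_graph_def V_def E_def)
  have ne: "V \<noteq> {}" using v by (auto simp: V_def)
  have q: "0 < 1 / p" "1 / p < 1" using p by auto
  have xpow: "x u = (x u powr p) powr (1 / p)" for u using x(1)[of u] p by (simp add: powr_powr)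
  have small: "1 - \<delta> \<le> (1 - \<delta>) powr s" if "s \<le> 1" "0 \<le> s" for s
    using powr_mono'[of s 1 "1 - \<delta>"] that \<delta> by simp
  define \<xi> where "\<xi> = (\<lambda>u. n powr (1 / p) * x u)"
  have \<xi>low: "1 - \<delta> \<le> \<xi> u" if u: "u \<in> V" for u
  proof -
    have "1 - \<delta> \<le> (1 - \<delta>) powr (1 / p)" using q by (intro small) auto
    also have "\<dots> \<le> (n * x u powr p) powr (1 / p)"
      using low[of u] u n \<delta> q by (intro powr_mono2) (auto simp: V_def field_simps)
    also have "\<dots> = n powr (1 / p) * (x u powr p) powr (1 / p)" by (rule powr_mult)
    also have "\<dots> = \<xi> u" using xpow[of u] by (simp add: \<xi>_def)
    finally show ?thesis .
  qed
  have \<xi>sum: "sum \<xi> V \<le> n"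
  proof -
    have "sum x V \<le> n powr (1 - 1 / p)"
      using sum_le_power_mean[OF fin p, of x] x(1,2) by (simp add: V_def n)
    then have "n powr (1 / p) * sum x V \<le> n powr (1 / p) * n powr (1 - 1 / p)"
      by (intro mult_left_mono) auto
    also have "\<dots> = n" using n(2) by (simp add: powr_add[symmetric])
    finally show ?thesis by (simp add: \<xi>_def sum_distrib_left)
  qed
  have xv: "0 < x v"
  proof -
    have "0 < (1 - \<delta>) / n" using \<delta> n(2) by simp
    then have "0 < x v powr p" using low[OF v] by linarith
    then show ?thesis using x(1)[of v] by (metis less_eq_real_def powr_eq_0_iff order_less_irrefl)
  qed
  have lam0: "0 \<le> lam"
    unfolding lam_def using H p rk ne by (intro p_spectral_radius_nonneg) (auto simp: V_def)
  define L where "L = (\<lambda>e. e - {v}) ` {e\<in>E. v \<in> e}"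
  have injL: "inj_on (\<lambda>e. e - {v}) {e\<in>E. v \<in> e}" by (auto simp: inj_on_def)
  have L: "S \<subseteq> V" "card S = r - 1" if "S \<in> L" for S
    using that Er finite_subset[OF _ fin] by (auto simp: L_def card_Diff_singleton)
  have cL: "card L = card {e\<in>E. v \<in> e}" unfolding L_def using injL by (rule card_image)
  define A where "A = {S. S \<subseteq> V \<and> card S = r - 1}"
  have fA: "finite A" using fin by (auto simp: A_def intro: finite_subset[of _ "Pow V"])
  have LA: "L \<subseteq> A" using L by (auto simp: A_def)
  define a0 where "a0 = (1 - \<delta>) ^ (r - 1)"
  have a0: "0 \<le> a0" "a0 \<le> 1" using \<delta> by (auto simp: a0_def power_le_one)
  have cA: "card A = card V choose (r - 1)" using fin by (simp add: A_def n_subsets)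
  have cA': "real (card A) \<le> n ^ (r - 1)"
  proof -
    have "card V choose (r - 1) \<le> card V ^ (r - 1)"
      by (cases "r - 1 \<le> card V") (auto simp: binomial_le_pow binomial_eq_0)
    then show ?thesis unfolding cA n V_def[symmetric] by (metis of_nat_le_iff of_nat_power)
  qed
  have "(\<Sum>S\<in>L. (\<Prod>u\<in>S. \<xi> u) - a0) \<le> (\<Sum>S\<in>A. (\<Prod>u\<in>S. \<xi> u) - a0)"
  proof (rule sum_mono2[OF fA LA])
    fix S assume "S \<in> A - L"
    then have S: "S \<subseteq> V" "card S = r - 1" by (auto simp: A_def)
    have "(\<Prod>u\<in>S. 1 - \<delta>) \<le> (\<Prod>u\<in>S. \<xi> u)" using \<xi>low S \<delta> by (intro prod_mono) auto
    then show "0 \<le> (\<Prod>u\<in>S. \<xi> u) - a0" using S by (simp add: a0_def)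
  qed
  also have "\<dots> = esym (r - 1) V \<xi> - card A * a0" by (simp add: esym_def A_def sum_subtractf)
  also have "\<dots> \<le> card A * 1 - card A * a0"
  proof -
    have "0 \<le> \<xi> u" if "u \<in> V" for u using \<xi>low[OF that] \<delta> by linarith
    then have nn: "\<And>u. u \<in> V \<Longrightarrow> 0 \<le> \<xi> u" .
    have "esym (r - 1) V \<xi> \<le> (card V choose (r - 1)) * (sum \<xi> V / card V) ^ (r - 1)"
      by (rule maclaurin_esym[OF fin ne nn])
    also have "\<dots> \<le> real (card V choose (r - 1)) * 1"
    proof (rule mult_left_mono[OF power_le_one])
      show "0 \<le> sum \<xi> V / card V" using nn by (intro divide_nonneg_nonneg sum_nonneg) auto
      show "sum \<xi> V / card V \<le> 1" using \<xi>sum n by (simp add: V_def)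
    qed simp
    finally show ?thesis by (simp add: cA)
  qed
  also have "\<dots> = card A * (1 - a0)" by (simp add: algebra_simps)
  also have "\<dots> \<le> n ^ (r - 1) * (1 - a0)" using cA' a0 by (intro mult_right_mono) auto
  finally have "(\<Sum>S\<in>L. \<Prod>u\<in>S. \<xi> u) - card L * a0 \<le> n ^ (r - 1) * (1 - a0)"
    by (simp add: sum_subtractf)
  moreover have "card L * a0 \<le> card L" using a0 by (simp add: mult_left_le)
  ultimately have upper: "(\<Sum>S\<in>L. \<Prod>u\<in>S. \<xi> u) \<le> card L + n ^ (r - 1) * (1 - a0)" by linarith
  have "(\<Sum>S\<in>L. \<Prod>u\<in>S. \<xi> u) = n powr ((r - 1) / p) * (\<Sum>S\<in>L. \<Prod>u\<in>S. x u)"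
  proof -
    have "(\<Prod>u\<in>S. \<xi> u) = n powr ((r - 1) / p) * (\<Prod>u\<in>S. x u)" if "S \<in> L" for S
    proof -
      have "(\<Prod>u\<in>S. \<xi> u) = (n powr (1 / p)) ^ (r - 1) * (\<Prod>u\<in>S. x u)"
        using L(2)[OF that] by (simp add: \<xi>_def prod.distrib)
      also have "(n powr (1 / p)) ^ (r - 1) = n powr ((r - 1) / p)"
        using n(2) rk by (simp add: powr_realpow[symmetric] powr_powr)
      finally show ?thesis .
    qed
    then show ?thesis by (simp add: sum_distrib_left)
  qed
  also have "(\<Sum>S\<in>L. \<Prod>u\<in>S. x u) = (\<Sum>e\<in>{e\<in>E. v \<in> e}. \<Prod>u\<in>e-{v}. x u)"
    unfolding L_def using injL by (subst sum.reindex) auto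
  also have "\<dots> = r * lam * x v powr (p - 1) / fact r"
    using eigen_equation[OF H p _ x v xv] rk by (simp add: E_def lam_def field_simps)
  also have "n powr ((r - 1) / p) * (r * lam * x v powr (p - 1) / fact r)
      \<ge> n powr ((r - 1) / p) * (r * ((1 - \<delta>) * turan_const r k * n powr (r - r / p)) * ((1 - \<delta>) * n powr (1 / p - 1)) / fact r)"
  proof -
    have "(1 - \<delta>) * n powr (1 / p - 1) \<le> (1 - \<delta>) powr (1 - 1 / p) * n powr (1 / p - 1)"
      using q by (intro mult_right_mono small) auto
    also have "\<dots> = ((1 - \<delta>) / n) powr (1 - 1 / p)"
      using n(2) \<delta> by (simp add: powr_divide powr_minus_divide[of n "1 - 1 / p", simplified])
    also have "\<dots> \<le> (x v powr p) powr (1 - 1 / p)"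
      using low[OF v] \<delta> n(2) q by (intro powr_mono2) auto
    also have "\<dots> = x v powr (p - 1)" using p by (simp add: powr_powr algebra_simps)
    finally have 1: "(1 - \<delta>) * n powr (1 / p - 1) \<le> x v powr (p - 1)" .
    have 2: "(1 - \<delta>) * turan_const r k * n powr (r - r / p) \<le> lam" using lam by (simp add: lam_def)
    have "r * ((1 - \<delta>) * turan_const r k * n powr (r - r / p)) * ((1 - \<delta>) * n powr (1 / p - 1))
      \<le> r * lam * x v powr (p - 1)"
      using 1 2 lam0 \<delta> by (intro mult_mono mult_left_mono) auto
    then show ?thesis by (intro mult_left_mono divide_right_mono) auto
  qed
  also have "n powr ((r - 1) / p) * (r * ((1 - \<delta>) * turan_const r k * n powr (r - r / p)) * ((1 - \<delta>) * n powr (1 / p - 1)) / fact r)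
     = (1 - \<delta>)\<^sup>2 * (r * turan_const r k / fact r) * (n powr ((r - 1) / p) * n powr (r - r / p) * n powr (1 / p - 1))"
    by (simp add: power2_eq_square)
  also have "n powr ((r - 1) / p) * n powr (r - r / p) * n powr (1 / p - 1) = n powr (real (r - 1))"
    unfolding powr_add[symmetric] using rk p by (intro arg_cong[where f = "\<lambda>s. n powr s"])
      (simp add: of_nat_diff field_simps)
  also have "\<dots> = n ^ (r - 1)" using n(2) by (rule powr_realpow)
  also have "r * turan_const r k / fact r = turan_deg r k" using rk by (intro turan_const_deg) auto
  finally have "(1 - \<delta>)\<^sup>2 * turan_deg r k * n ^ (r - 1) \<le> (\<Sum>S\<in>L. \<Prod>u\<in>S. \<xi> u)" .
  with upper have "(1 - \<delta>)\<^sup>2 * turan_deg r k * n ^ (r - 1) \<le> card L + n ^ (r - 1) * (1 - a0)" by linarith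
  then show ?thesis by (simp add: cL E_def a0_def algebra_simps)
qed

section \<open>Comparing \<open>k\<close>-partite hypergraphs with the Turan hypergraph\<close>

lemma r_graph_complete_partite: "finite V \<Longrightarrow> r_graph r (complete_partite r V c)"
  by (auto simp: r_graph_def complete_partite_def)

text \<open>The two comparisons are kept apart because the equality case needs strictness in the
  first: with all entries positive, a single missing edge already lowers the form.\<close>

lemma partite_form_le:
  assumes H: "r_graph r H" and V: "V = hverts H" and p: "1 < p"
    and I: "finite I" "c ` V \<subseteq> I" and rb: "\<And>e. e \<in> hedges H \<Longrightarrow> inj_on c e"
    and x: "\<And>v. 0 \<le> x v"
  shows "graph_form r H x \<le> fact r * esym r I (\<lambda>i. \<Sum>v\<in>{v\<in>V. c v = i}. x v)"
    and "(\<And>v. v \<in> V \<Longrightarrow> 0 < x v) \<Longrightarrow> H \<noteq> complete_partite r V c \<Longrightarrow>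
      graph_form r H x < fact r * esym r I (\<lambda>i. \<Sum>v\<in>{v\<in>V. c v = i}. x v)"
    and "esym r I (\<lambda>i. \<Sum>v\<in>{v\<in>V. c v = i}. x v) \<le>
      esym r I (\<lambda>i. part_sum p (class_size V c i) (\<Sum>v\<in>{v\<in>V. c v = i}. x v powr p))"
proof -
  have fin: "finite V" using H by (simp add: r_graph_def V)
  define R where "R = {e. e \<subseteq> V \<and> card e = r \<and> inj_on c e}"
  have fR: "finite R" using fin by (auto simp: R_def intro: finite_subset[of _ "Pow V"])
  have sub: "hedges H \<subseteq> R" using H rb by (auto simp: R_def r_graph_def V)
  have eq: "(\<Sum>e\<in>R. \<Prod>v\<in>e. x v) = esym r I (\<lambda>i. \<Sum>v\<in>{v\<in>V. c v = i}. x v)"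
    unfolding R_def by (rule complete_partite_sum[OF fin I])
  have "(\<Sum>e\<in>hedges H. \<Prod>v\<in>e. x v) \<le> (\<Sum>e\<in>R. \<Prod>v\<in>e. x v)"
    using x by (intro sum_mono2[OF fR sub] prod_nonneg) auto
  then show "graph_form r H x \<le> fact r * esym r I (\<lambda>i. \<Sum>v\<in>{v\<in>V. c v = i}. x v)"
    unfolding eq[symmetric] graph_form_def by simp
  show "graph_form r H x < fact r * esym r I (\<lambda>i. \<Sum>v\<in>{v\<in>V. c v = i}. x v)"
    if pos: "\<And>v. v \<in> V \<Longrightarrow> 0 < x v" and neq: "H \<noteq> complete_partite r V c"
  proof -
    have "hedges H \<noteq> R"
    proof
      assume "hedges H = R"
      then have "H = complete_partite r V c" using V by (simp add: complete_partite_def R_def prod_eq_iff)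
      then show False using neq by simp
    qed
    then obtain e where e: "e \<in> R" "e \<notin> hedges H" using sub by blast
    have "(\<Sum>e\<in>hedges H. \<Prod>v\<in>e. x v) < (\<Sum>e\<in>R. \<Prod>v\<in>e. x v)"
    proof (rule sum_strict_mono2[OF fR sub])
      show "e \<in> R - hedges H" using e by simp
      show "0 < (\<Prod>v\<in>e. x v)" using e pos by (intro prod_pos) (auto simp: R_def)
    qed (use x in \<open>auto intro: prod_nonneg\<close>)
    then show ?thesis unfolding eq[symmetric] graph_form_def by simp
  qed
  show "esym r I (\<lambda>i. \<Sum>v\<in>{v\<in>V. c v = i}. x v) \<le>
      esym r I (\<lambda>i. part_sum p (class_size V c i) (\<Sum>v\<in>{v\<in>V. c v = i}. x v powr p))"
  proof (rule esym_mono)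
    fix i assume "i \<in> I"
    show "0 \<le> (\<Sum>v\<in>{v\<in>V. c v = i}. x v)" using x by (intro sum_nonneg) auto
    show "(\<Sum>v\<in>{v\<in>V. c v = i}. x v) \<le> part_sum p (class_size V c i) (\<Sum>v\<in>{v\<in>V. c v = i}. x v powr p)"
      unfolding part_sum_def class_size_def using fin x p by (intro sum_le_power_mean) auto
  qed
qed

lemma esym_le_complete_partite_radius:
  assumes fin: "finite V" "V \<noteq> {}" "finite I" and c: "c ` V \<subseteq> I" and p: "1 < p" and r: "0 < r"
    and Y: "\<And>i. i \<in> I \<Longrightarrow> 0 \<le> Y i" "sum Y I = 1"
  shows "fact r * esym r I (\<lambda>i. part_sum p (class_size V c i) (Y i)) \<le> p_spectral_radius r p (complete_partite r V c)"
proof -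
  let ?K = "complete_partite r V c"
  define N where "N = class_size V c"
  \<comment> \<open>The power sum \<open>Y i\<close> is spread evenly over class \<open>i\<close>.
    If the class is empty, its share is lost, so \<open>clsp\<close> is only an inequality and the
    vector may have norm below one.\<close>
  define x where "x = (\<lambda>v. (Y (c v) / N (c v)) powr (1 / p))"
  have x0: "0 \<le> x v" for v by (simp add: x_def)
  have rK: "r_graph r ?K" using fin(1) by (rule r_graph_complete_partite)
  have vK: "hverts ?K = V" by (simp add: complete_partite_def)
  have cls: "(\<Sum>v\<in>{v\<in>V. c v = i}. x v) = part_sum p (N i) (Y i)" if "i \<in> I" for i
  proof -
    have "(\<Sum>v\<in>{v\<in>V. c v = i}. x v) = (\<Sum>v\<in>{v\<in>V. c v = i}. (Y i / N i) powr (1 / p))"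
      by (rule sum.cong) (auto simp: x_def)
    also have "\<dots> = N i * (Y i / N i) powr (1 / p)" by (simp add: N_def class_size_def)
    also have "\<dots> = part_sum p (N i) (Y i)"
    proof (cases "N i = 0")
      case False
      then show ?thesis using Y(1)[OF that] by (simp add: part_sum_def powr_divide powr_diff)
    qed (use p in \<open>simp add: part_sum_def\<close>)
    finally show ?thesis .
  qed
  have clsp: "(\<Sum>v\<in>{v\<in>V. c v = i}. \<bar>x v\<bar> powr p) \<le> Y i" if "i \<in> I" for i
  proof -
    have "(\<Sum>v\<in>{v\<in>V. c v = i}. \<bar>x v\<bar> powr p) = (\<Sum>v\<in>{v\<in>V. c v = i}. Y i / N i)"
      by (rule sum.cong) (use p Y(1)[OF that] in \<open>auto simp: x_def powr_powr\<close>)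
    also have "\<dots> = N i * (Y i / N i)" by (simp add: N_def class_size_def)
    also have "\<dots> \<le> Y i" using Y(1)[OF that] by simp
    finally show ?thesis .
  qed
  have "(\<Sum>v\<in>V. \<bar>x v\<bar> powr p) = (\<Sum>i\<in>I. \<Sum>v\<in>{v\<in>V. c v = i}. \<bar>x v\<bar> powr p)"
    using sum_by_class[OF fin(1,3) c, of "\<lambda>v. \<bar>x v\<bar> powr p"] by simp
  also have "\<dots> \<le> sum Y I" using clsp by (rule sum_mono)
  finally have S: "(\<Sum>v\<in>V. \<bar>x v\<bar> powr p) \<le> 1" using Y by simp
  have "fact r * esym r I (\<lambda>i. part_sum p (N i) (Y i)) = fact r * esym r I (\<lambda>i. \<Sum>v\<in>{v\<in>V. c v = i}. x v)"
    using cls by (simp cong: esym_cong)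
  also have "\<dots> = graph_form r ?K x"
    using complete_partite_sum[OF fin(1,3) c, where x = x and r = r]
    by (simp add: graph_form_def complete_partite_def)
  also have "\<dots> \<le> p_spectral_radius r p ?K * (\<Sum>v\<in>V. \<bar>x v\<bar> powr p) powr (r / p)"
    using graph_form_le_radius[OF rK _ _ r, of p x] fin p by (simp add: vK)
  also have "\<dots> \<le> p_spectral_radius r p ?K * 1"
  proof (rule mult_left_mono)
    show "(\<Sum>v\<in>V. \<bar>x v\<bar> powr p) powr (r / p) \<le> 1" using S p by (intro powr_le1) (auto simp: abs_of_nonneg sum_nonneg)
    show "0 \<le> p_spectral_radius r p ?K"
      using p_spectral_radius_nonneg[OF rK _ _ r, of p] fin p by (simp add: vK)
  qed
  finally show ?thesis by (simp add: N_def)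
qed

lemma esym_balanced_le_turan:
  assumes fin: "finite V" "V \<noteq> {}" "finite I" and c: "c ` V \<subseteq> I" "balanced V c I"
    and k: "card I = k" "0 < k" and p: "1 < p" and r: "0 < r"
    and Y: "\<And>i. i \<in> I \<Longrightarrow> 0 \<le> Y i" "sum Y I = 1"
  shows "fact r * esym r I (\<lambda>i. part_sum p (class_size V c i) (Y i)) \<le> p_spectral_radius r p (turan r (card V) k)"
proof -
  have "hgraph_iso (complete_partite r V c) (turan r (card V) k)"
    using fin c k by (intro balanced_iso_turan)
  then have "p_spectral_radius r p (complete_partite r V c) = p_spectral_radius r p (turan r (card V) k)"
  proof (rule p_spectral_radius_iso)
    show "r_graph r (complete_partite r V c)" "r_graph r (turan r (card V) k)"
      unfolding turan_def using fin by (auto intro: r_graph_complete_partite)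
    show "hverts (turan r (card V) k) \<noteq> {}"
      using fin by (auto simp: turan_def complete_partite_def lessThan_empty_iff)
  qed (use p in simp)
  then show ?thesis using esym_le_complete_partite_radius[OF fin c(1) p r Y] by simp
qed

text \<open>The radius of \<open>H\<close> is bounded by the form of the complete partite
  hypergraph, then by the symmetric function of the part sums, then by the Turan radius. In case of
  equality all links are tight; the first forces \<open>H\<close> to be complete partite, the last
  forces balance.\<close>

lemma partite_radius_compare:
  assumes H: "r_graph r H" and V: "V = hverts H" "V \<noteq> {}" and p: "1 < p" and r: "2 \<le> r"
    and I: "finite I" "c ` V \<subseteq> I" "card I = k" and rb: "\<And>e. e \<in> hedges H \<Longrightarrow> inj_on c e"
    and E: "hedges H \<noteq> {}"
    and x: "\<And>v. 0 \<le> x v" "\<And>v. v \<in> V \<Longrightarrow> 0 < x v" "(\<Sum>v\<in>V. x v powr p) = 1"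
      "graph_form r H x = p_spectral_radius r p H"
  shows "p_spectral_radius r p H \<le> p_spectral_radius r p (turan r (card V) k)"
    and "p_spectral_radius r p H = p_spectral_radius r p (turan r (card V) k) \<Longrightarrow> hgraph_iso H (turan r (card V) k)"
proof -
  let ?T = "p_spectral_radius r p (turan r (card V) k)"
  have fin: "finite V" using H by (simp add: r_graph_def V)
  have k: "0 < k" using I V by (auto simp: card_gt_0_iff)
  define Y where "Y = (\<lambda>i. \<Sum>v\<in>{v\<in>V. c v = i}. x v powr p)"
  have Y0: "0 \<le> Y i" for i by (simp add: Y_def sum_nonneg)
  have Y1: "sum Y I = 1" unfolding Y_def using sum_by_class[OF fin I(1,2), of "\<lambda>v. x v powr p"] x(3) by simp
  let ?s = "\<lambda>i. \<Sum>v\<in>{v\<in>V. c v = i}. x v"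
  let ?phi = "esym r I (\<lambda>i. part_sum p (class_size V c i) (Y i))"
  note pf = partite_form_le[where x = x, OF H V(1) p I(1,2) rb x(1)]
  have le1: "graph_form r H x \<le> fact r * esym r I ?s" by (rule pf(1))
  have le2: "fact r * esym r I ?s \<le> fact r * ?phi" using pf(3) by (simp add: Y_def)
  have le3: "fact r * ?phi \<le> ?T" and strict3: "\<not> balanced V c I \<Longrightarrow> fact r * ?phi < ?T"
  proof -
    obtain c' Y' where c': "c' ` V \<subseteq> I" "\<forall>i\<in>I. 0 \<le> Y' i" "sum Y' I = sum Y I" "balanced V c' I"
      "?phi \<le> esym r I (\<lambda>i. part_sum p (class_size V c' i) (Y' i))"
      using exists_balanced[OF fin I(1,2) p r, of Y] Y0 by blast
    have "fact r * esym r I (\<lambda>i. part_sum p (class_size V c' i) (Y' i)) \<le> ?T"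
      using c' Y1 fin V I k p r by (intro esym_balanced_le_turan) auto
    moreover have "fact r * ?phi \<le> fact r * esym r I (\<lambda>i. part_sum p (class_size V c' i) (Y' i))"
      using c'(5) by simp
    ultimately show "fact r * ?phi \<le> ?T" by linarith
    assume unb: "\<not> balanced V c I"
    \<comment> \<open>One strict \<open>balance_step\<close> comes first, since
      \<open>exists_balanced\<close> supplies only a weak inequality.\<close>
    obtain c1 Y1' where 1: "c1 ` V \<subseteq> I" "\<And>i. i \<in> I \<Longrightarrow> 0 \<le> Y1' i" "sum Y1' I = sum Y I"
      "(\<And>i. i \<in> I \<Longrightarrow> 0 < class_size V c i \<Longrightarrow> 0 < Y i) \<Longrightarrow> r \<le> card {i\<in>I. 0 < class_size V c i} \<Longrightarrow>
       ?phi < esym r I (\<lambda>i. part_sum p (class_size V c1 i) (Y1' i))"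
      by (rule balance_step[OF fin I(1,2) p r unb, of Y]) (use Y0 in auto)
    have lt: "?phi < esym r I (\<lambda>i. part_sum p (class_size V c1 i) (Y1' i))"
    proof (rule 1(4))
      fix i assume "i \<in> I" "0 < class_size V c i"
      then have "{v\<in>V. c v = i} \<noteq> {}" by (auto simp: class_size_def card_gt_0_iff)
      then show "0 < Y i" unfolding Y_def using fin x(2) by (intro sum_pos) fastforce+
    next
      obtain e where e: "e \<in> hedges H" using E by auto
      then have e': "e \<subseteq> V" "card e = r" using H by (auto simp: r_graph_def V)
      have "c ` e \<subseteq> {i\<in>I. 0 < class_size V c i}"
        using e' I fin by (auto simp: class_size_def card_gt_0_iff)
      then have "card (c ` e) \<le> card {i\<in>I. 0 < class_size V c i}" using I by (intro card_mono) auto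
      then show "r \<le> card {i\<in>I. 0 < class_size V c i}" using card_image[OF rb[OF e]] e' by simp
    qed
    obtain c2 Y2 where c2: "c2 ` V \<subseteq> I" "\<forall>i\<in>I. 0 \<le> Y2 i" "sum Y2 I = sum Y1' I" "balanced V c2 I"
      "esym r I (\<lambda>i. part_sum p (class_size V c1 i) (Y1' i)) \<le> esym r I (\<lambda>i. part_sum p (class_size V c2 i) (Y2 i))"
      using exists_balanced[OF fin I(1) 1(1) p r, of Y1'] 1(2) by blast
    have "fact r * esym r I (\<lambda>i. part_sum p (class_size V c2 i) (Y2 i)) \<le> ?T"
      using c2 1(3) Y1 fin V I k p r by (intro esym_balanced_le_turan) auto
    moreover have "fact r * ?phi < fact r * esym r I (\<lambda>i. part_sum p (class_size V c2 i) (Y2 i))"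
      using c2(5) lt by simp
    ultimately show "fact r * ?phi < ?T" by linarith
  qed
  show "p_spectral_radius r p H \<le> ?T" using le1 le2 le3 x(4) by linarith
  assume eq: "p_spectral_radius r p H = ?T"
  have bal: "balanced V c I" using strict3 le1 le2 x(4) eq by force
  have "H = complete_partite r V c" using pf(2) x(2,4) le2 le3 eq by force
  then show "hgraph_iso H (turan r (card V) k)"
    using balanced_iso_turan[OF fin I(1,2) bal I(3) k] by simp
qed

text \<open>Maclaurin for the \<open>k\<close> class sums. Positivity of the maximizer is not
  assumed.\<close>

lemma partite_radius_le:
  assumes H: "r_graph r H" and V: "V = hverts H" "V \<noteq> {}" and p: "1 < p" and r: "0 < r"
    and I: "finite I" "c ` V \<subseteq> I" "card I = k" and rb: "\<And>e. e \<in> hedges H \<Longrightarrow> inj_on c e"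
  shows "p_spectral_radius r p H \<le> turan_const r k * real (card V) powr (r - r / p)"
proof -
  have fin: "finite V" using H by (simp add: r_graph_def V)
  have k: "0 < k" using I V by (auto simp: card_gt_0_iff)
  obtain x where x: "\<And>v. 0 \<le> x v" "(\<Sum>v\<in>V. x v powr p) = 1" "graph_form r H x = p_spectral_radius r p H"
    using nonneg_maximizer[OF H _ _ r, of p] V p by auto
  let ?s = "\<lambda>i. \<Sum>v\<in>{v\<in>V. c v = i}. x v"
  have n: "0 < real (card V)" using fin V by (simp add: card_gt_0_iff)
  have "p_spectral_radius r p H \<le> fact r * esym r I ?s"
    using partite_form_le(1)[where x = x, OF H V(1) p I(1,2) rb x(1)] x(3) by simp
  also have "\<dots> \<le> fact r * ((k choose r) * (sum ?s I / k) ^ r)"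
    using I k x(1) by (intro mult_left_mono esym_le_choose) (auto intro: sum_nonneg)
  also have "sum ?s I = sum x V" by (rule sum_by_class[OF fin I(1,2)])
  also have "fact r * ((k choose r) * (sum x V / k) ^ r) = turan_const r k * sum x V ^ r"
    by (simp add: turan_const_def power_divide)
  also have "\<dots> \<le> turan_const r k * (real (card V) powr (1 - 1 / p)) ^ r"
  proof (intro mult_left_mono power_mono)
    show "sum x V \<le> real (card V) powr (1 - 1 / p)"
      using sum_le_power_mean[OF fin p, of x] x by simp
    show "0 \<le> sum x V" using x by (intro sum_nonneg) auto
    show "0 \<le> turan_const r k" by (simp add: turan_const_def)
  qed
  also have "(real (card V) powr (1 - 1 / p)) ^ r = real (card V) powr (r - r / p)"
  proof -
    have "(real (card V) powr (1 - 1 / p)) ^ r = real (card V) powr ((1 - 1 / p) * r)"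
      using n by (simp add: powr_realpow[symmetric] powr_powr)
    also have "(1 - 1 / p) * r = r - r / p" by (simp add: algebra_simps)
    finally show ?thesis .
  qed
  finally show ?thesis .
qed

section \<open>Turan hypergraphs and vertex deletion\<close>

text \<open>In the induction step the old error at most doubles, and the cross term
  \<open>\<tau> j * sum \<tau> S\<close> is at most one more copy of the old bound; hence the base
  \<open>3\<close>.\<close>

lemma abs_prod_one_plus_diff_le:
  fixes \<tau> :: "'a \<Rightarrow> real"
  assumes "finite S" "\<And>i. i \<in> S \<Longrightarrow> \<bar>\<tau> i\<bar> \<le> h" "0 \<le> h" "h \<le> 1"
  shows "\<bar>(\<Prod>i\<in>S. 1 + \<tau> i) - 1 - sum \<tau> S\<bar> \<le> 3 ^ card S * h\<^sup>2"
  using assms(1,2)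
proof (induction rule: finite_induct)
  case (insert j S)
  let ?P = "\<Prod>i\<in>S. 1 + \<tau> i" and ?s = "sum \<tau> S"
  have IH: "\<bar>?P - 1 - ?s\<bar> \<le> 3 ^ card S * h\<^sup>2" using insert by auto
  have j: "\<bar>\<tau> j\<bar> \<le> h" using insert by auto
  have s: "\<bar>?s\<bar> \<le> card S * h"
  proof -
    have "\<bar>?s\<bar> \<le> (\<Sum>i\<in>S. \<bar>\<tau> i\<bar>)" by (rule sum_abs)
    also have "\<dots> \<le> (\<Sum>i\<in>S. h)" using insert by (intro sum_mono) auto
    finally show ?thesis by simp
  qed
  have eq: "(\<Prod>i\<in>insert j S. 1 + \<tau> i) - 1 - sum \<tau> (insert j S) = (?P - 1 - ?s) * (1 + \<tau> j) + \<tau> j * ?s"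
    using insert by (simp add: algebra_simps)
  have "\<bar>(?P - 1 - ?s) * (1 + \<tau> j)\<bar> \<le> (3 ^ card S * h\<^sup>2) * 2"
    unfolding abs_mult using IH j assms by (intro mult_mono) auto
  moreover have "\<bar>\<tau> j * ?s\<bar> \<le> h * (card S * h)"
    unfolding abs_mult using j s assms by (intro mult_mono) auto
  moreover have "h * (card S * h) \<le> 3 ^ card S * h\<^sup>2"
  proof -
    have "card S < 3 ^ card S" by (rule less_exp[THEN order_less_le_trans]) (simp add: power_mono)
    then have "real (card S) \<le> 3 ^ card S"
      by (metis less_imp_le of_nat_le_iff of_nat_numeral of_nat_power)
    then have "real (card S) * h\<^sup>2 \<le> 3 ^ card S * h\<^sup>2" by (intro mult_right_mono) auto
    then show ?thesis by (simp add: power2_eq_square mult_ac)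
  qed
  ultimately have "\<bar>(?P - 1 - ?s) * (1 + \<tau> j) + \<tau> j * ?s\<bar> \<le> 3 * (3 ^ card S * h\<^sup>2)" by linarith
  then show ?case unfolding eq using insert by simp
qed (use assms in auto)

text \<open>The test weights are proportional to the class sizes, which amounts to the constant
  vector and thus to counting edges. With class sizes \<open>a * (1 + \<tau> i)\<close>, the
  deviations are at most \<open>k / n\<close> and add up to zero. Every class occurs in equally many
  \<open>r\<close>-sets of classes, so the linear term of the count cancels and only an error of
  order \<open>1 / n^2\<close> is left.\<close>

lemma turan_radius_ge:
  assumes p: "1 < p" and r: "0 < r" and rk: "r \<le> k" "k \<le> n"
  shows "turan_const r k * real n powr (r - r / p) * (1 - 3 ^ r * k\<^sup>2 / n\<^sup>2)
    \<le> p_spectral_radius r p (turan r n k)"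
proof -
  have k: "0 < k" and n: "0 < n" using r rk by auto
  define I where "I = {..<k}"
  define V where "V = {..<n}"
  define c where "c = (\<lambda>v::nat. v mod k)"
  define N where "N = class_size V c"
  have fin: "finite V" "V \<noteq> {}" "finite I" using n by (auto simp: V_def I_def)
  have c: "c ` V \<subseteq> I" using k by (auto simp: c_def I_def)
  have bal: "balanced V c I" unfolding V_def c_def I_def using k by (rule balanced_turan)
  have sumN: "(\<Sum>i\<in>I. real (N i)) = n"
    using sum_class_size[OF fin(1,3) c] by (simp add: N_def V_def flip: of_nat_sum)
  define a where "a = real n / k"
  have a: "0 < a" using n k by (simp add: a_def)
  define \<tau> where "\<tau> = (\<lambda>i. real (N i) / a - 1)"
  have NI: "real (N i) = a * (1 + \<tau> i)" for i using a by (simp add: \<tau>_def)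
  define h where "h = real k / n"
  have h: "0 \<le> h" "h \<le> 1" using rk n by (auto simp: h_def)
  have \<tau>h: "\<bar>\<tau> i\<bar> \<le> h" if i: "i \<in> I" for i
  proof -
    have "N i = n div k \<or> N i = n div k + 1"
      using turan_part_sizes[of i k n] i by (auto simp: N_def class_size_def V_def c_def I_def)
    moreover have "real (n div k) \<le> a" "a < real (n div k) + 1"
    proof -
      have "real (n div k) = \<lfloor>a\<rfloor>" by (simp add: a_def floor_divide_of_nat_eq)
      then show "real (n div k) \<le> a" "a < real (n div k) + 1" by linarith+
    qed
    ultimately have "\<bar>real (N i) - a\<bar> \<le> 1" by auto
    then have "\<bar>real (N i) - a\<bar> / a \<le> 1 / a" using a by (intro divide_right_mono) auto
    moreover have "\<tau> i = (real (N i) - a) / a" using a by (simp add: \<tau>_def diff_divide_distrib)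
    moreover have "h = 1 / a" by (simp add: h_def a_def)
    ultimately show ?thesis using a by (simp add: abs_divide)
  qed
  have \<tau>sum: "sum \<tau> I = 0"
  proof -
    have "sum \<tau> I = (\<Sum>i\<in>I. real (N i)) / a - k" by (simp add: \<tau>_def sum_subtractf sum_divide_distrib I_def)
    then show ?thesis using n k unfolding sumN by (simp add: a_def)
  qed
  define SS where "SS = {S. S \<subseteq> I \<and> card S = r}"
  have fSS: "finite SS" using fin by (auto simp: SS_def intro: finite_subset[of _ "Pow I"])
  have cSS: "card SS = k choose r" using n_subsets[of I r] by (simp add: SS_def I_def)
  have lin: "(\<Sum>S\<in>SS. sum \<tau> S) = 0"
  proof -
    have "(\<Sum>S\<in>SS. sum \<tau> S) = (\<Sum>S\<in>SS. \<Sum>i\<in>{i\<in>I. i \<in> S}. \<tau> i)"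
      by (intro sum.cong refl) (auto simp: SS_def)
    also have "\<dots> = (\<Sum>i\<in>I. \<Sum>S\<in>{S\<in>SS. i \<in> S}. \<tau> i)"
      by (rule sum.swap_restrict) (use fSS fin in auto)
    also have "\<dots> = (\<Sum>i\<in>I. ((k choose r) - ((k - 1) choose r)) * \<tau> i)"
    proof (rule sum.cong[OF refl])
      fix i assume i: "i \<in> I"
      have "{S\<in>SS. i \<in> S} = SS - {S. S \<subseteq> I - {i} \<and> card S = r}" by (auto simp: SS_def)
      moreover have "{S. S \<subseteq> I - {i} \<and> card S = r} \<subseteq> SS" by (auto simp: SS_def)
      moreover have "card {S. S \<subseteq> I - {i} \<and> card S = r} = (k - 1) choose r"
        using n_subsets[of "I - {i}" r] i fin by (simp add: I_def)
      ultimately have "card {S\<in>SS. i \<in> S} = (k choose r) - ((k - 1) choose r)"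
        using fSS cSS by (simp add: card_Diff_subset finite_subset)
      then show "(\<Sum>S\<in>{S\<in>SS. i \<in> S}. \<tau> i) = ((k choose r) - ((k - 1) choose r)) * \<tau> i" by simp
    qed
    also have "\<dots> = 0" using \<tau>sum by (simp add: sum_distrib_left[symmetric])
    finally show ?thesis .
  qed
  have "esym r I (\<lambda>i. real (N i)) = (\<Sum>S\<in>SS. a ^ r * (\<Prod>i\<in>S. 1 + \<tau> i))"
    unfolding esym_def SS_def NI by (intro sum.cong refl) (auto simp: prod.distrib)
  also have "\<dots> \<ge> (\<Sum>S\<in>SS. a ^ r * (1 + sum \<tau> S - 3 ^ r * h\<^sup>2))"
  proof (intro sum_mono mult_left_mono)
    fix S assume S: "S \<in> SS"
    then have "finite S" using fin finite_subset by (auto simp: SS_def)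
    then have "\<bar>(\<Prod>i\<in>S. 1 + \<tau> i) - 1 - sum \<tau> S\<bar> \<le> 3 ^ card S * h\<^sup>2"
      using S \<tau>h h by (intro abs_prod_one_plus_diff_le) (auto simp: SS_def)
    moreover have "card S = r" using S by (simp add: SS_def)
    ultimately show "1 + sum \<tau> S - 3 ^ r * h\<^sup>2 \<le> (\<Prod>i\<in>S. 1 + \<tau> i)" by (simp add: abs_le_iff)
  qed (use a in auto)
  also have "(\<Sum>S\<in>SS. a ^ r * (1 + sum \<tau> S - 3 ^ r * h\<^sup>2)) = a ^ r * ((k choose r) * (1 - 3 ^ r * h\<^sup>2))"
  proof -
    have "(\<Sum>S\<in>SS. 1 + sum \<tau> S - 3 ^ r * h\<^sup>2) = (\<Sum>S\<in>SS. 1 - 3 ^ r * h\<^sup>2) + (\<Sum>S\<in>SS. sum \<tau> S)"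
      unfolding sum.distrib[symmetric] by (rule sum.cong) auto
    also have "\<dots> = (k choose r) * (1 - 3 ^ r * h\<^sup>2)" using lin cSS by simp
    finally show ?thesis unfolding sum_distrib_left[symmetric] by simp
  qed
  finally have low: "a ^ r * ((k choose r) * (1 - 3 ^ r * h\<^sup>2)) \<le> esym r I (\<lambda>i. real (N i))" .
  define Y where "Y = (\<lambda>i. real (N i) / n)"
  have Y: "\<And>i. i \<in> I \<Longrightarrow> 0 \<le> Y i" "sum Y I = 1"
    using sumN n by (auto simp: Y_def sum_divide_distrib[symmetric])
  have ps: "part_sum p (N i) (Y i) = real n powr (- 1 / p) * N i" for i
  proof (cases "N i = 0")
    case False
    then show ?thesis using n by (simp add: part_sum_def Y_def powr_divide powr_diff powr_minus_divide)
  qed (use p in \<open>simp add: part_sum_def\<close>)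
  have es: "esym r I (\<lambda>i. part_sum p (N i) (Y i)) = (real n powr (- 1 / p)) ^ r * esym r I (\<lambda>i. real (N i))"
    unfolding ps esym_def sum_distrib_left by (intro sum.cong refl) (auto simp: prod.distrib)
  have "fact r * ((real n powr (- 1 / p)) ^ r * (a ^ r * ((k choose r) * (1 - 3 ^ r * h\<^sup>2))))
     \<le> fact r * ((real n powr (- 1 / p)) ^ r * esym r I (\<lambda>i. real (N i)))"
    using low by (intro mult_left_mono) auto
  also have "\<dots> \<le> p_spectral_radius r p (turan r (card V) k)"
    unfolding es[symmetric] unfolding N_def using fin c bal k p r Y
    by (intro esym_balanced_le_turan) (auto simp: I_def)
  also have "card V = n" by (simp add: V_def)
  also have "fact r * ((real n powr (- 1 / p)) ^ r * (a ^ r * ((k choose r) * (1 - 3 ^ r * h\<^sup>2))))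
     = turan_const r k * ((real n powr (- 1 / p)) ^ r * real n ^ r) * (1 - 3 ^ r * h\<^sup>2)"
    by (simp add: turan_const_def a_def power_divide)
  also have "(real n powr (- 1 / p)) ^ r * real n ^ r = real n powr (r - r / p)"
  proof -
    have np: "0 < real n powr (- 1 / p)" "0 < real n" using n by auto
    have "(real n powr (- 1 / p)) ^ r = real n powr (- 1 / p * r)"
      using powr_realpow[OF np(1), of r] by (simp add: powr_powr)
    moreover have "real n ^ r = real n powr r" using powr_realpow[OF np(2), of r] by simp
    ultimately show ?thesis by (simp add: powr_add[symmetric])
  qed
  also have "h\<^sup>2 = k\<^sup>2 / n\<^sup>2" by (simp add: h_def power_divide)
  finally show ?thesis by simp
qed

text \<open>Crude, but any bound depending only on the number of vertices can start the induction
  over deletions.\<close>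

lemma radius_le_card:
  assumes H: "r_graph r H" and ne: "hverts H \<noteq> {}" and p: "1 \<le> p" and r: "0 < r"
  shows "p_spectral_radius r p H \<le> fact r * 2 ^ card (hverts H)"
proof -
  have fin: "finite (hverts H)" and E: "hedges H \<subseteq> Pow (hverts H)" using H by (auto simp: r_graph_def)
  obtain x where x: "\<And>v. 0 \<le> x v" "(\<Sum>v\<in>hverts H. x v powr p) = 1" "graph_form r H x = p_spectral_radius r p H"
    using nonneg_maximizer[OF assms] by metis
  have le1: "x v \<le> 1" if v: "v \<in> hverts H" for v
  proof (rule ccontr)
    assume "\<not> x v \<le> 1"
    then have "1 < x v powr p" using p by (intro gr_one_powr) auto
    moreover have "x v powr p \<le> 1" unfolding x(2)[symmetric]
      by (rule member_le_sum) (use v fin in auto)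
    ultimately show False by simp
  qed
  have "(\<Sum>e\<in>hedges H. \<Prod>v\<in>e. x v) \<le> (\<Sum>e\<in>hedges H. 1)"
    using le1 x(1) E by (intro sum_mono prod_le_1) auto
  also have "\<dots> \<le> 2 ^ card (hverts H)"
  proof -
    have "card (hedges H) \<le> 2 ^ card (hverts H)"
      using card_mono[OF _ E] fin by (simp add: card_Pow)
    then have "real (card (hedges H)) \<le> real (2 ^ card (hverts H))" by (rule of_nat_mono)
    then show ?thesis by simp
  qed
  finally show ?thesis unfolding x(3)[symmetric] graph_form_def by simp
qed

section \<open>The effect of a single deletion\<close>

lemma exp_minus_le: "0 \<le> z \<Longrightarrow> exp (- z) \<le> 1 - z + z\<^sup>2" for z :: real
proof -
  assume z: "0 \<le> z"
  have "exp (- z) = 1 / exp z" by (simp add: exp_minus inverse_eq_divide)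
  also have "\<dots> \<le> 1 / (1 + z)" using z exp_ge_add_one_self[of z] by (intro divide_left_mono) auto
  also have "\<dots> \<le> 1 - z + z\<^sup>2"
  proof -
    have "0 \<le> z ^ 3" using z by simp
    then have "1 \<le> (1 - z + z\<^sup>2) * (1 + z)" by (simp add: algebra_simps power2_eq_square power3_eq_cube)
    then show ?thesis using z by (simp add: pos_divide_le_eq)
  qed
  finally show ?thesis .
qed

lemma one_minus_powr_le_exp:
  fixes y s :: real
  assumes "0 \<le> y" "y < 1" "0 \<le> s"
  shows "(1 - y) powr s \<le> exp (- (s * y))"
proof -
  have "ln (1 - y) \<le> - y" using ln_le_minus_one[of "1 - y"] assms by simp
  then have "s * ln (1 - y) \<le> s * (- y)" using assms by (intro mult_left_mono)
  then show ?thesis using assms by (simp add: powr_def)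
qed

text \<open>To first order the claim compares \<open>(r - s) * (1 - \<delta> / 2) / n\<close> with
  \<open>(r - s) * y\<close>. The bound on \<open>y\<close> provides a surplus of
  \<open>(r - s) * \<delta> / n\<close>: one half is given up in the exponent, and the other half
  absorbs the quadratic error \<open>(r / n)^2\<close>, which is what the lower bound on
  \<open>n\<close> is for.\<close>

lemma deletion_factor:
  fixes \<delta> r s y n :: real
  assumes s: "0 \<le> s" "s < r" and \<delta>: "0 < \<delta>" "\<delta> < 1"
    and n: "1 < n" "2 * r\<^sup>2 / ((r - s) * \<delta>) \<le> n" and y: "0 \<le> y" "y \<le> (1 - \<delta>) / n"
  shows "(1 - 1 / n) powr ((r - s) * (1 - \<delta> / 2)) * (1 - y) powr s \<le> 1 - r * y"
proof -
  define \<beta> where "\<beta> = r - s"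
  define \<gamma> where "\<gamma> = \<beta> * (1 - \<delta> / 2)"
  have \<beta>: "0 < \<beta>" using s by (simp add: \<beta>_def)
  have \<gamma>: "0 < \<gamma>" "\<gamma> \<le> \<beta>" using \<beta> \<delta> by (auto simp: \<gamma>_def mult_left_le)
  have yn: "y \<le> 1 / n" using y(2) \<delta> n by (smt (verit) divide_right_mono)
  have y1: "y < 1" using yn n by (smt (verit) divide_less_eq_1)
  define z where "z = \<gamma> / n + s * y"
  have z0: "0 \<le> z" using \<gamma> s y n by (simp add: z_def)
  have zn: "z \<le> r / n"
  proof -
    have "z \<le> \<beta> / n + s * (1 / n)" unfolding z_def using \<gamma> n s yn by (intro add_mono divide_right_mono mult_left_mono) auto
    also have "\<dots> = r / n" by (simp add: \<beta>_def diff_divide_distrib)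
    finally show ?thesis .
  qed
  have "(1 - 1 / n) powr \<gamma> * (1 - y) powr s \<le> exp (- (\<gamma> * (1 / n))) * exp (- (s * y))"
    using one_minus_powr_le_exp[of "1 / n" \<gamma>] one_minus_powr_le_exp[of y s] n \<gamma> s y y1
    by (intro mult_mono) auto
  also have "\<dots> = exp (- z)" by (simp add: z_def exp_add[symmetric])
  also have "\<dots> \<le> 1 - z + z\<^sup>2" using z0 by (rule exp_minus_le)
  also have "\<dots> \<le> 1 - r * y"
  proof -
    have "z\<^sup>2 \<le> (r / n)\<^sup>2" using zn z0 by (intro power_mono) auto
    also have "\<dots> = r\<^sup>2 / n / n" by (simp add: power2_eq_square)
    also have "\<dots> \<le> (\<beta> * \<delta> / 2) / n"
    proof (rule divide_right_mono)
      have "2 * r\<^sup>2 \<le> n * (\<beta> * \<delta>)" using n(2) \<beta> \<delta> by (simp add: \<beta>_def pos_divide_le_eq)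
      then show "r\<^sup>2 / n \<le> \<beta> * \<delta> / 2" using n by (simp add: pos_divide_le_eq field_simps)
    qed (use n in auto)
    finally have z2: "z\<^sup>2 \<le> (\<beta> * \<delta> / 2) / n" .
    have "\<beta> * y \<le> \<beta> * ((1 - \<delta>) / n)" using y \<beta> by (intro mult_left_mono) auto
    moreover have "\<gamma> / n - \<beta> * ((1 - \<delta>) / n) = (\<beta> * \<delta> / 2) / n"
      by (simp add: \<gamma>_def diff_divide_distrib[symmetric]) (simp add: algebra_simps)
    moreover have "z - r * y = \<gamma> / n - \<beta> * y" by (simp add: z_def \<beta>_def algebra_simps)
    ultimately show ?thesis using z2 by linarith
  qed
  finally show ?thesis by (simp add: \<gamma>_def \<beta>_def)
qed

text \<open>The two facts that \<open>partite_radius_compare\<close> consumes; the positive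
  maximizer is what settles its equality case.\<close>

definition positive_partite :: "nat \<Rightarrow> nat \<Rightarrow> real \<Rightarrow> 'a hgraph \<Rightarrow> bool" where
  "positive_partite r k p H \<longleftrightarrow>
    (\<exists>Q (col :: 'a \<Rightarrow> 'a). finite Q \<and> card Q = k \<and> col ` hverts H \<subseteq> Q \<and> (\<forall>e\<in>hedges H. inj_on col e)) \<and>
    (\<exists>x. (\<forall>v. 0 \<le> x v) \<and> (\<forall>v\<in>hverts H. 0 < x v) \<and> (\<Sum>v\<in>hverts H. x v powr p) = 1 \<and>
       graph_form r H x = p_spectral_radius r p H)"

lemma partite_or_deletion:
  fixes k r :: nat and p :: real
  assumes rk: "2 \<le> r" "r \<le> k" and p: "1 < p"
  obtains \<delta> :: real and n1 :: nat where "0 < \<delta>" "\<delta> < 1" "2 \<le> n1" and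
    "\<And>H :: 'a hgraph. r_graph r H \<Longrightarrow> hgraph_free (expanded_clique r (k + 1)) H \<Longrightarrow> n1 \<le> card (hverts H) \<Longrightarrow>
       (1 - \<delta>) * turan_const r k * real (card (hverts H)) powr (r - r / p) \<le> p_spectral_radius r p H \<Longrightarrow>
       positive_partite r k p H \<or>
       (\<exists>v\<in>hverts H. p_spectral_radius r p H * (1 - 1 / card (hverts H)) powr ((r - r / p) * (1 - \<delta> / 2))
          \<le> p_spectral_radius r p (delete_vertex v H))"
proof (rule degree_stability[OF rk, where 'a = 'a])
  fix \<epsilon> :: real and n0 :: nat
  assume \<epsilon>: "0 < \<epsilon>" and stab: "\<And>H :: 'a hgraph. r_graph r H \<Longrightarrow> hgraph_free (expanded_clique r (k + 1)) H \<Longrightarrow>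
       n0 \<le> card (hverts H) \<Longrightarrow>
       (\<And>v. v \<in> hverts H \<Longrightarrow> (turan_deg r k - \<epsilon>) * real (card (hverts H)) ^ (r - 1)
           \<le> card {e\<in>hedges H. v \<in> e}) \<Longrightarrow>
       \<exists>Q (col :: 'a \<Rightarrow> 'a). finite Q \<and> card Q = k \<and> col ` hverts H \<subseteq> Q \<and> (\<forall>e\<in>hedges H. inj_on col e)"
  define c where "c = turan_deg r k"
  have c: "0 < c" unfolding c_def using rk by (intro turan_deg_pos) auto
  \<comment> \<open>By Bernoulli,
    \<open>(1 - \<delta>)^2 * c - (1 - (1 - \<delta>) ^ (r - 1))\<close> is at least
    \<open>c - (2 * c + r) * \<delta>\<close>, so this choice makes the bound of
    \<open>degree_lower_bound\<close> meet the requirement \<open>c - \<epsilon>\<close> of degree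
    stability.\<close>
  define \<delta> where "\<delta> = min (1 / 2) (\<epsilon> / (2 * c + r))"
  have cr: "0 < 2 * c + r" using c by simp
  have \<delta>: "0 < \<delta>" "\<delta> < 1" "\<delta> * (2 * c + r) \<le> \<epsilon>"
  proof -
    show "0 < \<delta>" "\<delta> < 1" using \<epsilon> cr by (auto simp: \<delta>_def)
    have "\<delta> \<le> \<epsilon> / (2 * c + r)" by (simp add: \<delta>_def)
    then show "\<delta> * (2 * c + r) \<le> \<epsilon>" using cr by (simp add: pos_le_divide_eq)
  qed
  define s where "s = r / p"
  have s: "0 \<le> s" "s < r" using p rk by (auto simp: s_def divide_less_eq)
  define n1 where "n1 = max (max n0 2) (nat \<lceil>2 * (real r)\<^sup>2 / ((r - s) * \<delta>)\<rceil>)"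
  show ?thesis
  proof (rule that[OF \<delta>(1,2), of n1])
    show "2 \<le> n1" by (simp add: n1_def)
    fix H :: "'a hgraph"
    assume H: "r_graph r H" and free: "hgraph_free (expanded_clique r (k + 1)) H" and n1: "n1 \<le> card (hverts H)"
      and lam: "(1 - \<delta>) * turan_const r k * real (card (hverts H)) powr (r - r / p) \<le> p_spectral_radius r p H"
    define n where "n = real (card (hverts H))"
    have n2: "2 \<le> card (hverts H)" "n0 \<le> card (hverts H)" using n1 by (auto simp: n1_def)
    have nbig: "2 * (real r)\<^sup>2 / ((r - s) * \<delta>) \<le> n"
    proof -
      have "real (nat \<lceil>2 * (real r)\<^sup>2 / ((r - s) * \<delta>)\<rceil>) \<le> n"
        unfolding n_def of_nat_le_iff using n1 by (simp add: n1_def)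
      then show ?thesis by linarith
    qed
    have n: "1 < n" "0 < n" using n2 by (auto simp: n_def)
    have ne: "hverts H \<noteq> {}" using n by (auto simp: n_def)
    have r0: "0 < r" and p1: "1 \<le> p" using rk p by auto
    obtain x where x: "\<And>v. 0 \<le> x v" "(\<Sum>v\<in>hverts H. x v powr p) = 1" "graph_form r H x = p_spectral_radius r p H"
      using nonneg_maximizer[OF H ne p1 r0] by metis
    have fin: "finite (hverts H)" using H by (simp add: r_graph_def)
    show "positive_partite r k p H \<or>
       (\<exists>v\<in>hverts H. p_spectral_radius r p H * (1 - 1 / card (hverts H)) powr ((r - r / p) * (1 - \<delta> / 2))
          \<le> p_spectral_radius r p (delete_vertex v H))"
    proof (cases "\<forall>v\<in>hverts H. (1 - \<delta>) / n \<le> x v powr p")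
      case True
      have "\<exists>Q (col :: 'a \<Rightarrow> 'a). finite Q \<and> card Q = k \<and> col ` hverts H \<subseteq> Q \<and> (\<forall>e\<in>hedges H. inj_on col e)"
      proof (rule stab[OF H free n2(2)])
        fix v assume v: "v \<in> hverts H"
        have "1 + real (r - 1) * (- \<delta>) \<le> (1 + (- \<delta>)) ^ (r - 1)" using \<delta> by (intro Bernoulli_inequality) auto
        moreover have "real (r - 1) * \<delta> \<le> r * \<delta>" using \<delta> by (intro mult_right_mono) auto
        ultimately have 1: "1 - (1 - \<delta>) ^ (r - 1) \<le> r * \<delta>" by simp
        have "(1 - 2 * \<delta>) * c \<le> (1 - \<delta>)\<^sup>2 * c"
          using c by (intro mult_right_mono) (auto simp: power2_eq_square algebra_simps)
        then have "c - \<epsilon> \<le> (1 - \<delta>)\<^sup>2 * c - (1 - (1 - \<delta>) ^ (r - 1))"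
          using 1 \<delta>(3) by (simp add: algebra_simps)
        then have "(c - \<epsilon>) * n ^ (r - 1) \<le> ((1 - \<delta>)\<^sup>2 * c - (1 - (1 - \<delta>) ^ (r - 1))) * n ^ (r - 1)"
          using n by (intro mult_right_mono) auto
        also have "\<dots> \<le> card {e\<in>hedges H. v \<in> e}"
          unfolding c_def
          by (rule degree_lower_bound[OF H p rk n_def n(2) x \<delta>(1,2) _ _ v]) (use True lam in \<open>auto simp: n_def\<close>)
        finally show "(turan_deg r k - \<epsilon>) * real (card (hverts H)) ^ (r - 1) \<le> card {e\<in>hedges H. v \<in> e}"
          by (simp add: c_def n_def)
      qed
      moreover have "0 < x v" if "v \<in> hverts H" for v
      proof -
        have "0 < (1 - \<delta>) / n" using \<delta> n by simp
        then have "x v powr p \<noteq> 0" using True that by fastforce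
        then show ?thesis using x(1)[of v] by (simp add: less_eq_real_def)
      qed
      ultimately show ?thesis using x unfolding positive_partite_def by blast
    next
      case False
      then obtain v where v: "v \<in> hverts H" "x v powr p < (1 - \<delta>) / n" by auto
      define y where "y = x v powr p"
      define \<gamma> where "\<gamma> = (r - s) * (1 - \<delta> / 2)"
      have y: "0 \<le> y" "y \<le> (1 - \<delta>) / n" using v by (auto simp: y_def)
      have lam0: "0 \<le> p_spectral_radius r p H" by (rule p_spectral_radius_nonneg[OF H ne p1 r0])
      have "(1 - 1 / n) powr \<gamma> * (1 - y) powr s \<le> 1 - r * y"
        unfolding \<gamma>_def by (rule deletion_factor[OF s \<delta>(1,2) n(1) nbig y])
      then have "p_spectral_radius r p H * ((1 - 1 / n) powr \<gamma> * (1 - y) powr s)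
          \<le> p_spectral_radius r p H * (1 - r * y)" using lam0 by (rule mult_left_mono)
      also have "\<dots> \<le> p_spectral_radius r p (delete_vertex v H) * (1 - y) powr s"
        unfolding y_def s_def by (rule delete_vertex_radius[OF H p r0 n2(1) x v(1)])
      finally have "(p_spectral_radius r p H * (1 - 1 / n) powr \<gamma>) * (1 - y) powr s
          \<le> p_spectral_radius r p (delete_vertex v H) * (1 - y) powr s" by (simp add: mult.assoc)
      moreover have "0 < (1 - y) powr s"
      proof -
        have "y < 1 / n" using v(2) \<delta> n by (smt (verit) y_def divide_strict_right_mono)
        then have "y < 1" using n by (smt (verit) divide_less_eq_1)
        then show ?thesis by simp
      qed
      ultimately have "p_spectral_radius r p H * (1 - 1 / n) powr \<gamma> \<le> p_spectral_radius r p (delete_vertex v H)"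
        by (simp add: mult_le_cancel_right)
      then show ?thesis using v(1) by (auto simp: n_def \<gamma>_def s_def)
    qed
  qed
qed

section \<open>Induction over deletions\<close>

lemma positive_partite_radius_le:
  assumes "r_graph r H" "hverts H \<noteq> {}" "1 < p" "0 < r" "positive_partite r k p H"
  shows "p_spectral_radius r p H \<le> turan_const r k * real (card (hverts H)) powr (r - r / p)"
proof -
  obtain Q and col :: "'a \<Rightarrow> 'a" where "finite Q" "card Q = k" "col ` hverts H \<subseteq> Q" "\<forall>e\<in>hedges H. inj_on col e"
    using assms(5) unfolding positive_partite_def by blast
  then show ?thesis using assms by (intro partite_radius_le[where I = Q and c = col]) auto
qed

lemma hgraph_free_delete_vertex: "hgraph_free F H \<Longrightarrow> hgraph_free F (delete_vertex v H)"
  by (erule hgraph_free_subgraph) (auto simp: delete_vertex_def)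

text \<open>If deleting a vertex of small weight is possible, the ratio of the spectral radius to
  \<open>n powr (r - r / p)\<close> increases by a factor \<open>1 + \<Omega>(1 / n)\<close>; the induction bounds how often
  this can happen, starting from any constant bound at \<open>n1\<close>.\<close>

theorem radius_bound_or_deletion:
  fixes k r :: nat and p :: real
  assumes rk: "2 \<le> r" "r \<le> k" and p: "1 < p"
  obtains \<delta> \<rho> :: real and n2 :: nat where "0 < \<delta>" "\<delta> < 1" "0 < \<rho>" "2 \<le> n2" and
    "\<And>H :: 'a hgraph. r_graph r H \<Longrightarrow> hgraph_free (expanded_clique r (k + 1)) H \<Longrightarrow> n2 < card (hverts H) \<Longrightarrow>
       (1 - \<delta>) * turan_const r k * real (card (hverts H)) powr (r - r / p) \<le> p_spectral_radius r p H \<Longrightarrow>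
       positive_partite r k p H \<or>
       p_spectral_radius r p H \<le>
         turan_const r k * real (card (hverts H)) powr (r - r / p) * (1 - 1 / card (hverts H)) powr \<rho>"
proof (rule partite_or_deletion[OF rk p, where 'a = 'a])
  fix \<delta> :: real and n1 :: nat
  assume \<delta>: "0 < \<delta>" "\<delta> < 1" and n12: "2 \<le> n1" and dich:
    "\<And>H :: 'a hgraph. r_graph r H \<Longrightarrow> hgraph_free (expanded_clique r (k + 1)) H \<Longrightarrow> n1 \<le> card (hverts H) \<Longrightarrow>
       (1 - \<delta>) * turan_const r k * real (card (hverts H)) powr (r - r / p) \<le> p_spectral_radius r p H \<Longrightarrow>
       positive_partite r k p H \<or>
       (\<exists>v\<in>hverts H. p_spectral_radius r p H * (1 - 1 / card (hverts H)) powr ((r - r / p) * (1 - \<delta> / 2))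
          \<le> p_spectral_radius r p (delete_vertex v H))"
  \<comment> \<open>A deletion that costs only the factor \<open>(1 - 1 / n) powr \<gamma>\<close>
    raises the ratio to \<open>n powr \<beta>\<close> by the factor
    \<open>(1 - 1 / n) powr (- \<rho>)\<close>.\<close>
  define \<beta> where "\<beta> = r - r / p"
  define \<gamma> where "\<gamma> = \<beta> * (1 - \<delta> / 2)"
  define \<rho> where "\<rho> = \<beta> * \<delta> / 2"
  have "r / p < r" using p rk by (auto simp: divide_less_eq)
  then have \<beta>: "0 < \<beta>" by (simp add: \<beta>_def)
  have \<gamma>: "0 < \<gamma>" "\<beta> = \<gamma> + \<rho>" "0 < \<rho>" using \<beta> \<delta> by (auto simp: \<gamma>_def \<rho>_def algebra_simps)
  define c0 where "c0 = turan_const r k"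
  have c0: "0 < c0" unfolding c0_def using rk by (intro turan_const_pos) auto
  have r0: "0 < r" and p1: "1 \<le> p" using rk p by auto
  define C where "C = fact r * 2 ^ n1 / real n1 powr \<gamma>"
  have C: "0 < C" using n12 by (simp add: C_def)
  have delH: "r_graph r (delete_vertex v H)" "hgraph_free (expanded_clique r (k + 1)) (delete_vertex v H)"
    "card (hverts (delete_vertex v H)) = card (hverts H) - 1"
    if "r_graph r H" "hgraph_free (expanded_clique r (k + 1)) H" "v \<in> hverts H" for v and H :: "'a hgraph"
    using r_graph_delete_vertex[OF that(1)] hgraph_free_delete_vertex[OF that(2)] that
    by (simp_all add: delete_vertex_def r_graph_def)
  have ratio: "real n powr t * (1 - 1 / real n) powr t = real (n - 1) powr t" if "2 \<le> n" for n :: nat and t :: real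
  proof -
    have "real n powr t * (1 - 1 / real n) powr t = (real n * (1 - 1 / real n)) powr t"
      by (rule powr_mult[symmetric])
    also have "real n * (1 - 1 / real n) = real (n - 1)" using that by (simp add: field_simps of_nat_diff)
    finally show ?thesis .
  qed
  \<comment> \<open>The second term of the maximum reproduces itself exactly under a deletion, the
    first one with room to spare, so the maximum is a valid induction hypothesis. \<open>C\<close>
    is chosen to make the base case \<open>n1\<close> true. Since \<open>\<gamma> < \<beta>\<close>,
    the second term is dominated by the first from \<open>n2\<close> on.\<close>
  have bound: "p_spectral_radius r p H \<le> max (c0 * real n powr \<beta>) (C * real n powr \<gamma>)"
    if "n1 \<le> n" "r_graph r H" "hgraph_free (expanded_clique r (k + 1)) H" "card (hverts H) = n"
    for n and H :: "'a hgraph"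
    using that
  proof (induction n arbitrary: H rule: dec_induct)
    case base
    have "hverts H \<noteq> {}" using base n12 by auto
    then have "p_spectral_radius r p H \<le> fact r * 2 ^ n1" using radius_le_card[OF base(1) _ p1 r0] base by simp
    also have "\<dots> = C * real n1 powr \<gamma>" using n12 by (simp add: C_def)
    finally show ?case by simp
  next
    case (step m)
    define n where "n = Suc m"
    have n: "2 \<le> n" "n - 1 = m" "card (hverts H) = n" using step n12 by (auto simp: n_def)
    have ne: "hverts H \<noteq> {}" using n by auto
    show ?case unfolding n_def[symmetric]
    proof (cases "(1 - \<delta>) * c0 * real n powr \<beta> \<le> p_spectral_radius r p H")
      case False
      have "(1 - \<delta>) * c0 * real n powr \<beta> \<le> 1 * c0 * real n powr \<beta>"
        using \<delta> c0 by (intro mult_right_mono) auto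
      then show "p_spectral_radius r p H \<le> max (c0 * real n powr \<beta>) (C * real n powr \<gamma>)" using False by simp
    next
      case True
      have "positive_partite r k p H \<or> (\<exists>v\<in>hverts H. p_spectral_radius r p H * (1 - 1 / real n) powr \<gamma>
          \<le> p_spectral_radius r p (delete_vertex v H))"
        using dich[OF step.prems(1,2)] True step n by (simp add: c0_def \<beta>_def \<gamma>_def)
      then show "p_spectral_radius r p H \<le> max (c0 * real n powr \<beta>) (C * real n powr \<gamma>)"
      proof
        assume "positive_partite r k p H"
        then have "p_spectral_radius r p H \<le> c0 * real n powr \<beta>"
          using positive_partite_radius_le[OF step.prems(1) ne p r0] n by (simp add: c0_def \<beta>_def)
        then show ?thesis by simp
      next
        assume "\<exists>v\<in>hverts H. p_spectral_radius r p H * (1 - 1 / real n) powr \<gamma> \<le> p_spectral_radius r p (delete_vertex v H)"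
        then obtain v where v: "v \<in> hverts H"
          "p_spectral_radius r p H * (1 - 1 / real n) powr \<gamma> \<le> p_spectral_radius r p (delete_vertex v H)" by auto
        have "p_spectral_radius r p (delete_vertex v H) \<le> max (c0 * real m powr \<beta>) (C * real m powr \<gamma>)"
          using step.IH[OF delH(1,2)[OF step.prems(1,2) v(1)]] delH(3)[OF step.prems(1,2) v(1)] n by simp
        also have "\<dots> \<le> max (c0 * real n powr \<beta>) (C * real n powr \<gamma>) * (1 - 1 / real n) powr \<gamma>"
        proof -
          have q: "real n powr \<gamma> * (1 - 1 / real n) powr \<gamma> = real m powr \<gamma>" using ratio[OF n(1), of \<gamma>] unfolding n(2) .
          have "real m powr \<beta> = real m powr \<rho> * real m powr \<gamma>" unfolding \<gamma>(2) powr_add by simp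
          also have "\<dots> \<le> real n powr \<rho> * real m powr \<gamma>"
            using \<gamma> n by (intro mult_right_mono powr_mono2) auto
          also have "\<dots> = real n powr \<beta> * (1 - 1 / real n) powr \<gamma>" unfolding \<gamma>(2) powr_add q[symmetric] by simp
          finally have "c0 * real m powr \<beta> \<le> (c0 * real n powr \<beta>) * (1 - 1 / real n) powr \<gamma>" using c0 by simp
          moreover have "C * real m powr \<gamma> = (C * real n powr \<gamma>) * (1 - 1 / real n) powr \<gamma>" using q by simp
          ultimately have "max (c0 * real m powr \<beta>) (C * real m powr \<gamma>)
            \<le> max (c0 * real n powr \<beta> * (1 - 1 / real n) powr \<gamma>) (C * real n powr \<gamma> * (1 - 1 / real n) powr \<gamma>)"
            by (intro max.mono) (simp_all only: order.refl)
          then show ?thesis by (simp only: max_mult_distrib_right powr_ge_zero if_True)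
        qed
        finally have "p_spectral_radius r p H * (1 - 1 / real n) powr \<gamma>
           \<le> max (c0 * real n powr \<beta>) (C * real n powr \<gamma>) * (1 - 1 / real n) powr \<gamma>" using v(2) by linarith
        moreover have "0 < (1 - 1 / real n) powr \<gamma>" using n by simp
        ultimately show ?thesis by (rule mult_right_le_imp_le)
      qed
    qed
  qed
  define n2 where "n2 = max n1 (nat \<lceil>(C / c0) powr (1 / \<rho>)\<rceil>)"
  have bound2: "p_spectral_radius r p H \<le> c0 * real (card (hverts H)) powr \<beta>"
    if "n2 \<le> card (hverts H)" "r_graph r H" "hgraph_free (expanded_clique r (k + 1)) H" for H :: "'a hgraph"
  proof -
    define n where "n = card (hverts H)"
    have n: "n1 \<le> n" "(C / c0) powr (1 / \<rho>) \<le> n" "0 < n"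
    proof -
      show "n1 \<le> n" "0 < n" using that n12 by (auto simp: n_def n2_def)
      have "real (nat \<lceil>(C / c0) powr (1 / \<rho>)\<rceil>) \<le> n" unfolding n_def of_nat_le_iff using that by (simp add: n2_def)
      then show "(C / c0) powr (1 / \<rho>) \<le> n" by linarith
    qed
    have "C / c0 = ((C / c0) powr (1 / \<rho>)) powr \<rho>" using C c0 \<gamma> by (simp add: powr_powr)
    also have "\<dots> \<le> real n powr \<rho>" using n \<gamma> by (intro powr_mono2) auto
    finally have "C \<le> c0 * real n powr \<rho>" using c0 by (simp add: pos_divide_le_eq mult.commute)
    then have "C * real n powr \<gamma> \<le> c0 * real n powr \<rho> * real n powr \<gamma>" by (intro mult_right_mono) auto
    also have "\<dots> = c0 * real n powr \<beta>" unfolding \<gamma>(2) powr_add by simp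
    finally show ?thesis using bound[OF n(1) that(2,3)] by (simp add: n_def)
  qed
  show ?thesis
  proof (rule that[OF \<delta> \<gamma>(3), of "n2"])
    show "2 \<le> n2" using n12 by (simp add: n2_def)
    fix H :: "'a hgraph"
    assume H: "r_graph r H" and free: "hgraph_free (expanded_clique r (k + 1)) H" and big: "n2 < card (hverts H)"
      and lam: "(1 - \<delta>) * turan_const r k * real (card (hverts H)) powr (r - r / p) \<le> p_spectral_radius r p H"
    define n where "n = card (hverts H)"
    have "n1 \<le> n2" by (simp add: n2_def)
    then have n: "2 \<le> n" "n1 \<le> n" "n2 \<le> n - 1" using big n12 unfolding n_def by linarith+
    have "positive_partite r k p H \<or> (\<exists>v\<in>hverts H. p_spectral_radius r p H * (1 - 1 / real n) powr \<gamma>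
          \<le> p_spectral_radius r p (delete_vertex v H))"
      using dich[OF H free _ lam] n by (simp add: n_def \<beta>_def \<gamma>_def)
    then show "positive_partite r k p H \<or>
       p_spectral_radius r p H \<le>
         turan_const r k * real (card (hverts H)) powr (r - r / p) * (1 - 1 / card (hverts H)) powr \<rho>"
    proof
      assume "\<exists>v\<in>hverts H. p_spectral_radius r p H * (1 - 1 / real n) powr \<gamma> \<le> p_spectral_radius r p (delete_vertex v H)"
      then obtain v where v: "v \<in> hverts H"
        "p_spectral_radius r p H * (1 - 1 / real n) powr \<gamma> \<le> p_spectral_radius r p (delete_vertex v H)" by auto
      have "p_spectral_radius r p (delete_vertex v H) \<le> c0 * real (n - 1) powr \<beta>"
        using bound2[OF _ delH(1,2)[OF H free v(1)]] delH(3)[OF H free v(1)] n by (simp add: n_def)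
      also have "\<dots> = (c0 * real n powr \<beta> * (1 - 1 / real n) powr \<rho>) * (1 - 1 / real n) powr \<gamma>"
        unfolding ratio[OF n(1), symmetric] \<gamma>(2) powr_add by simp
      finally have "p_spectral_radius r p H * (1 - 1 / real n) powr \<gamma>
          \<le> (c0 * real n powr \<beta> * (1 - 1 / real n) powr \<rho>) * (1 - 1 / real n) powr \<gamma>" using v(2) by linarith
      moreover have "0 < (1 - 1 / real n) powr \<gamma>" using n by simp
      ultimately have "p_spectral_radius r p H \<le> c0 * real n powr \<beta> * (1 - 1 / real n) powr \<rho>"
        by (rule mult_right_le_imp_le)
      then show ?thesis by (simp add: c0_def \<beta>_def n_def)
    qed simp
  qed
qed

theorem theorem1p9:
  fixes k r :: nat and p :: real
  assumes "2 \<le> r" and "r \<le> k" and "real r \<le> p"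
  shows "\<exists>n0::nat. \<forall>n>n0. \<forall>H :: nat hgraph.
    r_graph r H \<and> card (hverts H) = n \<and> hgraph_free (expanded_clique r (k + 1)) H \<longrightarrow>
      p_spectral_radius r p H \<le> p_spectral_radius r p (turan r n k) \<and>
      (p_spectral_radius r p H = p_spectral_radius r p (turan r n k) \<longleftrightarrow>
         hgraph_iso H (turan r n k))"
proof (rule radius_bound_or_deletion[OF assms(1,2), where 'a = nat and p = p])
  show p: "1 < p" using assms by simp
  fix \<delta> \<rho> :: real and n2 :: nat
  assume \<delta>: "0 < \<delta>" "\<delta> < 1" and \<rho>: "0 < \<rho>" and n22: "2 \<le> n2" and dich:
    "\<And>H :: nat hgraph. r_graph r H \<Longrightarrow> hgraph_free (expanded_clique r (k + 1)) H \<Longrightarrow> n2 < card (hverts H) \<Longrightarrow>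
       (1 - \<delta>) * turan_const r k * real (card (hverts H)) powr (r - r / p) \<le> p_spectral_radius r p H \<Longrightarrow>
       positive_partite r k p H \<or>
       p_spectral_radius r p H \<le>
         turan_const r k * real (card (hverts H)) powr (r - r / p) * (1 - 1 / card (hverts H)) powr \<rho>"
  define A where "A = 3 ^ r * real k ^ 2"
  have A0: "0 < A" using assms by (simp add: A_def)
  \<comment> \<open>The third summand makes \<open>1 - \<rho> / n + (\<rho> / n)^2\<close> smaller
    than \<open>1 - A / n^2\<close>; the fourth makes the Turan radius exceed the threshold with
    factor \<open>1 - \<delta>\<close>.\<close>
  define n0 where "n0 = n2 + k + nat \<lceil>(A + \<rho>\<^sup>2) / \<rho>\<rceil> + nat \<lceil>A / \<delta>\<rceil>"
  have r0: "0 < r" and p1: "1 \<le> p" using assms p by auto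
  show ?thesis
  proof (rule exI[of _ n0], intro allI impI)
    fix n and H :: "nat hgraph"
    assume big: "n0 < n"
      and "r_graph r H \<and> card (hverts H) = n \<and> hgraph_free (expanded_clique r (k + 1)) H"
    then have H: "r_graph r H" and cn: "card (hverts H) = n" and free: "hgraph_free (expanded_clique r (k + 1)) H"
      by auto
    let ?lam = "p_spectral_radius r p H" and ?T = "p_spectral_radius r p (turan r n k)"
    have n: "n2 < n" "k \<le> n" "(A + \<rho>\<^sup>2) / \<rho> < n" "A / \<delta> < n" "1 < real n"
    proof -
      show "n2 < n" "k \<le> n" "1 < real n" using big n22 by (auto simp: n0_def)
      have "nat \<lceil>(A + \<rho>\<^sup>2) / \<rho>\<rceil> < n" "nat \<lceil>A / \<delta>\<rceil> < n" using big by (auto simp: n0_def)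
      then show "(A + \<rho>\<^sup>2) / \<rho> < n" "A / \<delta> < n" by linarith+
    qed
    have ne: "hverts H \<noteq> {}" using cn n by auto
    have rT: "r_graph r (turan r n k)" unfolding turan_def by (simp add: r_graph_complete_partite)
    have neT: "hverts (turan r n k) \<noteq> {}" using n by (auto simp: turan_def complete_partite_def lessThan_empty_iff)
    have iso_eq: "?lam = ?T" if "hgraph_iso H (turan r n k)"
      by (rule p_spectral_radius_iso[OF that H rT neT p1])
    define g where "g = turan_const r k * real n powr (r - r / p)"
    have g: "0 < g" unfolding g_def using assms n by (intro mult_pos_pos turan_const_pos) auto
    have T: "g * (1 - A / n\<^sup>2) \<le> ?T"
      using turan_radius_ge[OF p r0 assms(2) n(2)] by (simp add: g_def A_def)
    show "?lam \<le> ?T \<and> (?lam = ?T \<longleftrightarrow> hgraph_iso H (turan r n k))"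
    proof (cases "?lam < ?T")
      \<comment> \<open>An isomorphic \<open>H\<close> would have the same radius, so both sides of
        the equivalence are false.\<close>
      case True
      then show ?thesis using iso_eq by auto
    next
      case False
      have n2A: "A / n\<^sup>2 \<le> \<delta>"
      proof -
        have "A < \<delta> * n" using n(4) \<delta> by (simp add: pos_divide_less_eq mult.commute)
        also have "\<dots> \<le> \<delta> * (n * real n)" using n \<delta> by (intro mult_left_mono) auto
        finally show ?thesis using n by (simp add: pos_divide_le_eq power2_eq_square)
      qed
      have lamg: "g * (1 - A / n\<^sup>2) \<le> ?lam" using T False by linarith
      have "g * (1 - \<delta>) \<le> g * (1 - A / n\<^sup>2)" using n2A g by (intro mult_left_mono) auto
      then have "(1 - \<delta>) * turan_const r k * real n powr (r - r / p) \<le> ?lam"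
        using lamg by (simp add: g_def mult_ac)
      then have "positive_partite r k p H \<or> ?lam \<le> g * (1 - 1 / n) powr \<rho>"
        using dich[OF H free] cn n by (simp add: g_def)
      then have "positive_partite r k p H"
      proof
        \<comment> \<open>A deficit of relative order \<open>1 / n\<close> contradicts
          \<open>lamg\<close>, which allows only \<open>A / n^2\<close>.\<close>
        assume le: "?lam \<le> g * (1 - 1 / n) powr \<rho>"
        have "(1 - 1 / real n) powr \<rho> \<le> exp (- (\<rho> * (1 / n)))"
          using n \<rho> by (intro one_minus_powr_le_exp) auto
        also have "\<dots> \<le> 1 - \<rho> * (1 / n) + (\<rho> * (1 / n))\<^sup>2" using \<rho> by (intro exp_minus_le) auto
        also have "\<dots> < 1 - A / n\<^sup>2"
        proof -
          have "A + \<rho>\<^sup>2 < \<rho> * n" using n(3) \<rho> by (simp add: pos_divide_less_eq mult.commute)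
          then have "(A + \<rho>\<^sup>2) / n\<^sup>2 < \<rho> * n / n\<^sup>2" using n by (intro divide_strict_right_mono) auto
          then show ?thesis using n by (simp add: power2_eq_square add_divide_distrib)
        qed
        finally have "g * (1 - 1 / n) powr \<rho> < g * (1 - A / n\<^sup>2)" using g by simp
        then show ?thesis using le lamg by linarith
      qed
      then obtain Q and col :: "nat \<Rightarrow> nat" and x where Q: "finite Q" "card Q = k" "col ` hverts H \<subseteq> Q"
        "\<forall>e\<in>hedges H. inj_on col e"
        and x: "\<forall>v. 0 \<le> x v" "\<forall>v\<in>hverts H. 0 < x v" "(\<Sum>v\<in>hverts H. x v powr p) = 1" "graph_form r H x = ?lam"
        unfolding positive_partite_def by blast
      \<comment> \<open>An edge guarantees \<open>r\<close> nonempty classes, which the strict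
        balancing step requires.\<close>
      have E: "hedges H \<noteq> {}"
      proof
        assume "hedges H = {}"
        then have "?lam = 0" using x(4) by (simp add: graph_form_def)
        moreover have "0 < g * (1 - A / n\<^sup>2)" using g n2A \<delta> by (intro mult_pos_pos) auto
        ultimately show False using lamg by linarith
      qed
      have "?lam \<le> p_spectral_radius r p (turan r (card (hverts H)) k)"
        and "?lam = p_spectral_radius r p (turan r (card (hverts H)) k) \<Longrightarrow> hgraph_iso H (turan r (card (hverts H)) k)"
        using Q x E by (intro partite_radius_compare[OF H refl ne p assms(1), of Q col k x]; auto)+
      then show ?thesis unfolding cn using iso_eq by blast
    qed
  qed
qed

end
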